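(* Let $(R,\mathfrak{m})$ be a Gorenstein local ring, let $\varphi:R\to R$ be a local ring endomorphism, and let $I\subsetneq R$ be an ideal such that $\{\varphi^t(I)R\}_{t\ge0}$ is a decreasing chain of ideals cofinal with $\{I^t\}_{t\ge0}$. Suppose that (a) for every $t\ge 0$, $\operatorname{depth} R/\varphi^{t}(I)R\le\operatorname{depth} R/\varphi^{t+1}(I)R$; (b) the projective dimension of $R/I$ is finite. Then $\operatorname{cd}(R,I)\le\operatorname{pd} R/I$. If, in addition, the natural maps $\operatorname{Ext}^i_R(R/\varphi^t(I)R,R)\to\operatorname{Ext}^i_R(R/\varphi^{t+1}(I)R,R)$ are injective for all $i\ge0$ and all $t\ge0$, then $\operatorname{cd}(R,I)=\operatorname{pd} R/I$.
   Context: All rings are commutative and Noetherian with identity. $\varphi^t$ denotes the $t$-th iterate of $\varphi$ ($\varphi^0=\mathrm{id}$), and $\varphi^t(I)R$ is the ideal generated by $\varphi^t(I)$. Two families of ideals $\{\mathfrak{a}_t\}$, $\{\mathfrak{b}_t\}$ are cofinal if every $\mathfrak{a}_t$ contains some $\mathfrak{b}_s$ and every $\mathfrak{b}_t$ contains some $\mathfrak{a}_s$. The maps on Ext are induced by the natural surjections $R/\varphi^{t+1}(I)R\to R/\varphi^t(I)R$. $\operatorname{cd}(R,I)=\min\{i: H^j_I(R)=0 \text{ for all } j>i\}$ is the cohomological dimension; $\operatorname{pd}$ is projective dimension over $R$. *)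

theory Defs
  imports
    "HOL-Library.Extended_Nat"
    "HOL-Algebra.Module" "HOL-Algebra.Ideal_Product" "HOL-Algebra.Ring_Divisibility"
begin

section \<open>Modules\<close>

text \<open>
  The record of modules extends that of rings; its fields for multiplication and one
  play no role for a module.
\<close>

definition self_module :: "('a, 'r) ring_scheme \<Rightarrow> ('a, 'a) module" where
  "self_module R =
    \<lparr>carrier = carrier R, monoid.mult = monoid.mult R, one = one R,
     zero = zero R, add = add R, smult = monoid.mult R\<rparr>"

definition quot_module :: "('a, 'b, 'm) module_scheme \<Rightarrow> 'b set \<Rightarrow> ('a, 'b set) module" where
  "quot_module M N =
    \<lparr>carrier = a_rcosets\<^bsub>M\<^esub> N, monoid.mult = undefined, one = undefined,
     zero = N, add = set_add M, smult = (\<lambda>a X. \<Union>x\<in>X. N +>\<^bsub>M\<^esub> (a \<odot>\<^bsub>M\<^esub> x))\<rparr>"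

abbreviation quot_by_ideal :: "('a, 'r) ring_scheme \<Rightarrow> 'a set \<Rightarrow> ('a, 'a set) module" where
  "quot_by_ideal R J \<equiv> quot_module (self_module R) J"

definition lin_maps ::
  "('a, 'r) ring_scheme \<Rightarrow> ('a, 'b, 'm) module_scheme \<Rightarrow> ('a, 'c, 'n) module_scheme \<Rightarrow> ('b \<Rightarrow> 'c) set"
where
  "lin_maps R M N = {f \<in> carrier M \<rightarrow> carrier N.
     (\<forall>x\<in>carrier M. \<forall>y\<in>carrier M. f (x \<oplus>\<^bsub>M\<^esub> y) = f x \<oplus>\<^bsub>N\<^esub> f y) \<and>
     (\<forall>a\<in>carrier R. \<forall>x\<in>carrier M. f (a \<odot>\<^bsub>M\<^esub> x) = a \<odot>\<^bsub>N\<^esub> f x)}"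

text \<open>Extensionality makes every linear map be represented by exactly one function.\<close>

definition hom_module ::
  "('a, 'r) ring_scheme \<Rightarrow> ('a, 'b, 'm) module_scheme \<Rightarrow> ('a, 'c, 'n) module_scheme
    \<Rightarrow> ('a, 'b \<Rightarrow> 'c) module"
where
  "hom_module R M N =
    \<lparr>carrier = lin_maps R M N \<inter> extensional (carrier M), monoid.mult = undefined, one = undefined,
     zero = (\<lambda>x\<in>carrier M. \<zero>\<^bsub>N\<^esub>),
     add = (\<lambda>f g. \<lambda>x\<in>carrier M. f x \<oplus>\<^bsub>N\<^esub> g x),
     smult = (\<lambda>a f. \<lambda>x\<in>carrier M. a \<odot>\<^bsub>N\<^esub> f x)\<rparr>"

definition zero_module :: "('a, 'b, 'm) module_scheme \<Rightarrow> bool" where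
  "zero_module M \<longleftrightarrow> carrier M = {\<zero>\<^bsub>M\<^esub>}"


section \<open>Cochain complexes\<close>

text \<open>
  A complex \<open>C 0 \<rightarrow> C 1 \<rightarrow> \<dots>\<close> is given by its modules \<open>C i\<close> and its
  differentials \<open>d i\<close> from \<open>C i\<close> to \<open>C (i + 1)\<close>.
\<close>

definition coboundaries ::
  "(nat \<Rightarrow> ('a, 'c) module) \<Rightarrow> (nat \<Rightarrow> 'c \<Rightarrow> 'c) \<Rightarrow> nat \<Rightarrow> 'c set"
where
  "coboundaries C d i = (case i of 0 \<Rightarrow> {\<zero>\<^bsub>C 0\<^esub>} | Suc k \<Rightarrow> d k ` carrier (C k))"

definition cohomology ::
  "(nat \<Rightarrow> ('a, 'c) module) \<Rightarrow> (nat \<Rightarrow> 'c \<Rightarrow> 'c) \<Rightarrow> nat \<Rightarrow> ('a, 'c set) module"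
where
  "cohomology C d i =
     quot_module ((C i)\<lparr>carrier := a_kernel (C i) (C (Suc i)) (d i)\<rparr>) (coboundaries C d i)"

text \<open>
  The map on cohomology induced by a chain map \<open>u\<close> into the complex \<open>(C, d)\<close>. All members
  of a class are sent into the same class, so the union is that class.
\<close>

definition cohomology_map ::
  "(nat \<Rightarrow> ('a, 'c) module) \<Rightarrow> (nat \<Rightarrow> 'c \<Rightarrow> 'c) \<Rightarrow> (nat \<Rightarrow> 'b \<Rightarrow> 'c) \<Rightarrow> nat \<Rightarrow> 'b set \<Rightarrow> 'c set"
where
  "cohomology_map C d u i X = (\<Union>x\<in>X. coboundaries C d i +>\<^bsub>C i\<^esub> u i x)"


section \<open>Projective and injective modules\<close>

text \<open>
  A definition in HOL cannot quantify over all modules, only over those carried by a given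
  type. The types below are large enough for the definitions to be equivalent to the
  unrestricted ones. For projectivity of \<open>P\<close> the test cases needed include the canonical
  surjection from the free module on the set \<open>carrier P\<close>, whose elements are functions from
  \<open>'p\<close> to \<open>'a\<close>, onto \<open>P\<close> itself: if it splits, \<open>P\<close> is a direct summand of a free module.
  For injectivity, Baer's criterion only needs test modules of the size of \<open>R\<close>.
\<close>

definition projective_module :: "('a, 'r) ring_scheme \<Rightarrow> ('a, 'p) module \<Rightarrow> bool" where
  "projective_module R P \<longleftrightarrow> module R P \<and>
    (\<forall>(B :: ('a, 'p \<Rightarrow> 'a) module) (C :: ('a, 'p) module) g f.
       module R B \<and> module R C \<and>
       g \<in> lin_maps R B C \<and> g ` carrier B = carrier C \<and> f \<in> lin_maps R P C \<longrightarrow>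
       (\<exists>h \<in> lin_maps R P B. \<forall>x\<in>carrier P. g (h x) = f x))"

definition injective_module :: "('a, 'r) ring_scheme \<Rightarrow> ('a, 'e) module \<Rightarrow> bool" where
  "injective_module R E \<longleftrightarrow> module R E \<and>
    (\<forall>(A :: ('a, 'a + 'e) module) (B :: ('a, 'a + 'e) module) j f.
       module R A \<and> module R B \<and>
       j \<in> lin_maps R A B \<and> inj_on j (carrier A) \<and> f \<in> lin_maps R A E \<longrightarrow>
       (\<exists>g \<in> lin_maps R B E. \<forall>x\<in>carrier A. g (j x) = f x))"

text \<open>
  For a nontrivial ring carried by \<open>'a\<close> and a module \<open>M\<close> carried by \<open>'b\<close> the following type
  has room, up to isomorphism, for resolutions of \<open>M\<close>. Let \<open>k\<close> be the cardinality of the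
  index type \<open>('a + 'b) list\<close>, that is, the maximum of the cardinalities of \<open>'a\<close>, \<open>'b\<close>
  and \<open>nat\<close>. In the resolution that in each step takes the free module on all elements of
  the module to be covered, every basis has cardinality at most \<open>k\<close>, so the free modules
  and the syzygies embed into the functions from the index type to \<open>'a\<close>. As these functions
  number \<open>2^k\<close>, modules of at most this size are closed under cokernels and under
  passing from \<open>N\<close> to the injective module of additive maps from \<open>R\<close> to a divisible hull
  of \<open>N\<close>, so injective resolutions exist here as well. Finite projective or injective
  dimension is witnessed by truncating such resolutions at a syzygy or cokernel; hence the
  homological dimensions below are the usual ones.
\<close>

type_synonym ('a, 'b) univ = "('a + 'b) list \<Rightarrow> 'a"

definition projective_resolution ::
  "('a, 'r) ring_scheme \<Rightarrow> ('a, 'b) module \<Rightarrow> ('p \<Rightarrow> 'b) \<Rightarrow>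
    (nat \<Rightarrow> ('a, 'p) module) \<Rightarrow> (nat \<Rightarrow> 'p \<Rightarrow> 'p) \<Rightarrow> bool"
where
  \<comment> \<open>\<open>\<dots> \<rightarrow> P 1 \<rightarrow> P 0 \<rightarrow> M \<rightarrow> 0\<close>, where \<open>d i\<close> maps \<open>P (i + 1)\<close> to \<open>P i\<close>\<close>
  "projective_resolution R M \<epsilon> P d \<longleftrightarrow>
    (\<forall>i. projective_module R (P i)) \<and>
    \<epsilon> \<in> lin_maps R (P 0) M \<and> (\<forall>i. d i \<in> lin_maps R (P (Suc i)) (P i)) \<and>
    \<epsilon> ` carrier (P 0) = carrier M \<and>
    d 0 ` carrier (P 1) = a_kernel (P 0) M \<epsilon> \<and>
    (\<forall>i. d (Suc i) ` carrier (P (Suc (Suc i))) = a_kernel (P (Suc i)) (P i) (d i))"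

definition injective_resolution ::
  "('a, 'r) ring_scheme \<Rightarrow> ('a, 'b) module \<Rightarrow> ('b \<Rightarrow> 'e) \<Rightarrow>
    (nat \<Rightarrow> ('a, 'e) module) \<Rightarrow> (nat \<Rightarrow> 'e \<Rightarrow> 'e) \<Rightarrow> bool"
where
  \<comment> \<open>\<open>0 \<rightarrow> N \<rightarrow> E 0 \<rightarrow> E 1 \<rightarrow> \<dots>\<close>, where \<open>d i\<close> maps \<open>E i\<close> to \<open>E (i + 1)\<close>\<close>
  "injective_resolution R N \<epsilon> E d \<longleftrightarrow>
    (\<forall>i. injective_module R (E i)) \<and>
    \<epsilon> \<in> lin_maps R N (E 0) \<and> (\<forall>i. d i \<in> lin_maps R (E i) (E (Suc i))) \<and>
    inj_on \<epsilon> (carrier N) \<and>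
    \<epsilon> ` carrier N = a_kernel (E 0) (E 1) (d 0) \<and>
    (\<forall>i. d i ` carrier (E i) = a_kernel (E (Suc i)) (E (Suc (Suc i))) (d (Suc i)))"

text \<open>An infimum over the empty set is \<open>\<infinity>\<close>.\<close>

definition proj_dim :: "('a, 'r) ring_scheme \<Rightarrow> ('a, 'b) module \<Rightarrow> enat" where
  "proj_dim R M = Inf {enat n | n. \<exists>\<epsilon> (P :: nat \<Rightarrow> ('a, ('a, 'b) univ) module) d.
     projective_resolution R M \<epsilon> P d \<and> (\<forall>i>n. zero_module (P i))}"

definition inj_dim :: "('a, 'r) ring_scheme \<Rightarrow> ('a, 'b) module \<Rightarrow> enat" where
  "inj_dim R N = Inf {enat n | n. \<exists>\<epsilon> (E :: nat \<Rightarrow> ('a, ('a, 'b) univ) module) d.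
     injective_resolution R N \<epsilon> E d \<and> (\<forall>i>n. zero_module (E i))}"

text \<open>
  A chosen injective resolution; derived functors do not depend on the choice, up to
  natural isomorphism.
\<close>

definition some_injective_resolution ::
  "('a, 'r) ring_scheme \<Rightarrow> ('a, 'b) module \<Rightarrow>
    (nat \<Rightarrow> ('a, ('a, 'b) univ) module) \<times> (nat \<Rightarrow> ('a, 'b) univ \<Rightarrow> ('a, 'b) univ)"
where
  "some_injective_resolution R N = (SOME (E, d). \<exists>\<epsilon>. injective_resolution R N \<epsilon> E d)"

abbreviation inj_res_obj ::
  "('a, 'r) ring_scheme \<Rightarrow> ('a, 'b) module \<Rightarrow> nat \<Rightarrow> ('a, ('a, 'b) univ) module"
where
  "inj_res_obj R N \<equiv> fst (some_injective_resolution R N)"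

abbreviation inj_res_diff ::
  "('a, 'r) ring_scheme \<Rightarrow> ('a, 'b) module \<Rightarrow> nat \<Rightarrow> ('a, 'b) univ \<Rightarrow> ('a, 'b) univ"
where
  "inj_res_diff R N \<equiv> snd (some_injective_resolution R N)"


section \<open>Ext\<close>

text \<open>\<open>Ext\<^sup>i(M, N)\<close> is the \<open>i\<close>-th right derived functor of \<open>Hom(M, -)\<close> at \<open>N\<close>.\<close>

definition hom_complex ::
  "('a, 'r) ring_scheme \<Rightarrow> ('a, 'c) module \<Rightarrow> ('a, 'b) module \<Rightarrow>
    nat \<Rightarrow> ('a, 'c \<Rightarrow> ('a, 'b) univ) module"
where
  "hom_complex R M N i = hom_module R M (inj_res_obj R N i)"

definition hom_diff ::
  "('a, 'r) ring_scheme \<Rightarrow> ('a, 'c) module \<Rightarrow> ('a, 'b) module \<Rightarrow>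
    nat \<Rightarrow> ('c \<Rightarrow> ('a, 'b) univ) \<Rightarrow> ('c \<Rightarrow> ('a, 'b) univ)"
where
  "hom_diff R M N i f = compose (carrier M) (inj_res_diff R N i) f"

definition Ext ::
  "('a, 'r) ring_scheme \<Rightarrow> nat \<Rightarrow> ('a, 'c) module \<Rightarrow> ('a, 'b) module \<Rightarrow>
    ('a, ('c \<Rightarrow> ('a, 'b) univ) set) module"
where
  "Ext R i M N = cohomology (hom_complex R M N) (hom_diff R M N) i"

text \<open>
  The map from \<open>Ext\<^sup>i(M', N)\<close> to \<open>Ext\<^sup>i(M, N)\<close> induced by \<open>h\<close> from \<open>M\<close> to \<open>M'\<close>.
\<close>

definition Ext_map ::
  "('a, 'r) ring_scheme \<Rightarrow> nat \<Rightarrow> ('a, 'c) module \<Rightarrow> ('c \<Rightarrow> 'd) \<Rightarrow> ('a, 'b) module \<Rightarrow>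
    ('d \<Rightarrow> ('a, 'b) univ) set \<Rightarrow> ('c \<Rightarrow> ('a, 'b) univ) set"
where
  "Ext_map R i M h N =
     cohomology_map (hom_complex R M N) (hom_diff R M N) (\<lambda>_ f. compose (carrier M) f h) i"

text \<open>For ideals \<open>J' \<subseteq> J\<close> this is the surjection from \<open>R/J'\<close> to \<open>R/J\<close>.\<close>

definition natural_surj :: "('a, 'r) ring_scheme \<Rightarrow> 'a set \<Rightarrow> 'a set \<Rightarrow> 'a set" where
  "natural_surj R J X = J <+>\<^bsub>R\<^esub> X"


section \<open>Local cohomology\<close>

definition ideal_power :: "('a, 'r) ring_scheme \<Rightarrow> 'a set \<Rightarrow> nat \<Rightarrow> 'a set" where
  "ideal_power R I t = I [^]\<^bsub>ideals_set R\<^esub> t"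

definition torsion_part :: "('a, 'r) ring_scheme \<Rightarrow> 'a set \<Rightarrow> ('a, 'b) module \<Rightarrow> ('a, 'b) module" where
  "torsion_part R I M =
     M\<lparr>carrier := {x \<in> carrier M. \<exists>t. \<forall>a\<in>ideal_power R I t. a \<odot>\<^bsub>M\<^esub> x = \<zero>\<^bsub>M\<^esub>}\<rparr>"

definition local_cohomology ::
  "('a, 'r) ring_scheme \<Rightarrow> 'a set \<Rightarrow> nat \<Rightarrow> ('a, 'b) module \<Rightarrow> ('a, ('a, 'b) univ set) module"
where
  "local_cohomology R I i N =
     cohomology (\<lambda>j. torsion_part R I (inj_res_obj R N j)) (inj_res_diff R N) i"

definition coh_dim :: "('a, 'r) ring_scheme \<Rightarrow> 'a set \<Rightarrow> enat" where
  "coh_dim R I = Inf {enat i | i. \<forall>j>i. zero_module (local_cohomology R I j (self_module R))}"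


section \<open>Local rings, depth\<close>

definition noetherian_local :: "('a, 'r) ring_scheme \<Rightarrow> 'a set \<Rightarrow> bool" where
  "noetherian_local R \<mm> \<longleftrightarrow> cring R \<and> noetherian_ring R \<and>
     maximalideal \<mm> R \<and> (\<forall>\<nn>. maximalideal \<nn> R \<longrightarrow> \<nn> = \<mm>)"

definition gorenstein_local :: "('a, 'r) ring_scheme \<Rightarrow> 'a set \<Rightarrow> bool" where
  "gorenstein_local R \<mm> \<longleftrightarrow> noetherian_local R \<mm> \<and> inj_dim R (self_module R) < \<infinity>"

definition local_endomorphism :: "('a, 'r) ring_scheme \<Rightarrow> 'a set \<Rightarrow> ('a \<Rightarrow> 'a) \<Rightarrow> bool" where
  "local_endomorphism R \<mm> \<phi> \<longleftrightarrow> \<phi> \<in> ring_hom R R \<and> \<phi> ` \<mm> \<subseteq> \<mm>"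

text \<open>The submodule \<open>(x\<^sub>1, \<dots>, x\<^sub>n)M\<close>.\<close>

definition seq_submodule :: "('a, 'r) ring_scheme \<Rightarrow> ('a, 'b) module \<Rightarrow> 'a list \<Rightarrow> 'b set" where
  "seq_submodule R M xs =
     \<Inter>{N. submodule N R M \<and> (\<forall>a\<in>set xs. \<forall>y\<in>carrier M. a \<odot>\<^bsub>M\<^esub> y \<in> N)}"

text \<open>
  That each \<open>x\<^sub>i\<close> is a nonzerodivisor on \<open>M/(x\<^sub>1, \<dots>, x\<^sub>i\<^sub>-\<^sub>1)M\<close> is expressed in \<open>M\<close>.
\<close>

definition regular_sequence :: "('a, 'r) ring_scheme \<Rightarrow> ('a, 'b) module \<Rightarrow> 'a list \<Rightarrow> bool" where
  "regular_sequence R M xs \<longleftrightarrow> set xs \<subseteq> carrier R \<and>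
     (\<forall>i<length xs. \<forall>y\<in>carrier M.
        xs ! i \<odot>\<^bsub>M\<^esub> y \<in> seq_submodule R M (take i xs) \<longrightarrow> y \<in> seq_submodule R M (take i xs)) \<and>
     seq_submodule R M xs \<noteq> carrier M"

text \<open>Meant for nonzero finitely generated modules over a Noetherian local ring.\<close>

definition depth :: "('a, 'r) ring_scheme \<Rightarrow> 'a set \<Rightarrow> ('a, 'b) module \<Rightarrow> enat" where
  "depth R \<mm> M = Sup {enat (length xs) | xs. set xs \<subseteq> \<mm> \<and> regular_sequence R M xs}"


section \<open>Families of ideals\<close>

definition iterated_image_ideal :: "('a, 'r) ring_scheme \<Rightarrow> ('a \<Rightarrow> 'a) \<Rightarrow> 'a set \<Rightarrow> nat \<Rightarrow> 'a set" where
  "iterated_image_ideal R \<phi> I t = genideal R ((\<phi> ^^ t) ` I)"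

definition cofinal_families :: "(nat \<Rightarrow> 'a set) \<Rightarrow> (nat \<Rightarrow> 'a set) \<Rightarrow> bool" where
  "cofinal_families \<aa> \<bb> \<longleftrightarrow> (\<forall>t. \<exists>s. \<bb> s \<subseteq> \<aa> t) \<and> (\<forall>t. \<exists>s. \<aa> s \<subseteq> \<bb> t)"

end

theory Submission
  imports Defs
begin

text \<open>
  Let \<open>E\<close> be an injective resolution of \<open>R\<close> and let \<open>d\<close> be the injective dimension of \<open>R\<close>.
  For an ideal \<open>J\<close>, \<open>Ext\<^sup>i(R/J, R)\<close> is the cohomology of the subcomplex of \<open>E\<close> annihilated by
  \<open>J\<close>, and by cofinality the local cohomology \<open>H\<^sup>i\<^sub>I(R)\<close> is the direct limit of
  \<open>Ext\<^sup>i(R/J\<^sub>t, R)\<close> for \<open>J\<^sub>t = \<phi>\<^sup>t(I)R\<close>. If \<open>p\<close> is the projective dimension of \<open>R/I\<close>, then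
  \<open>Ext\<^sup>i(R/I, R) = 0\<close> for \<open>i > p\<close>, and the sequences
  \<open>0 \<rightarrow> R/(J : x) \<rightarrow> R/J \<rightarrow> R/(J + xR) \<rightarrow> 0\<close> yield \<open>d - p \<le> depth R/I\<close>: otherwise
  \<open>Ext\<^sup>d\<close> would vanish on the residue field, and hence on all cyclic modules. By hypothesis
  \<open>depth R/J\<^sub>t\<close> is at least \<open>d - p\<close> as well, so Nakayama's lemma gives \<open>Ext\<^sup>i(R/J\<^sub>t, R) = 0\<close> for
  \<open>i > p\<close>, and in the limit \<open>H\<^sup>i\<^sub>I(R) = 0\<close>.

  If the maps on Ext are injective, then \<open>Ext\<^sup>i(R/I, R)\<close> embeds into \<open>H\<^sup>i\<^sub>I(R)\<close> and vanishes for \<open>i\<close>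
  above the cohomological dimension \<open>c\<close>. In a resolution of \<open>R/I\<close> by free modules of finite rank
  some syzygy splits off because the projective dimension is finite, and the vanishing of Ext
  carries such a splitting down to stage \<open>c\<close>; therefore the projective dimension is at most \<open>c\<close>.
\<close>

section \<open>Linear maps\<close>

lemma lin_mapsI:
  assumes "\<And>x. x \<in> carrier M \<Longrightarrow> f x \<in> carrier N"
    and "\<And>x y. x \<in> carrier M \<Longrightarrow> y \<in> carrier M \<Longrightarrow> f (x \<oplus>\<^bsub>M\<^esub> y) = f x \<oplus>\<^bsub>N\<^esub> f y"
    and "\<And>a x. a \<in> carrier R \<Longrightarrow> x \<in> carrier M \<Longrightarrow> f (a \<odot>\<^bsub>M\<^esub> x) = a \<odot>\<^bsub>N\<^esub> f x"
  shows "f \<in> lin_maps R M N"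
  using assms unfolding lin_maps_def by blast

lemma lin_maps_closed: "f \<in> lin_maps R M N \<Longrightarrow> x \<in> carrier M \<Longrightarrow> f x \<in> carrier N"
  unfolding lin_maps_def by blast

lemma lin_maps_add:
  "f \<in> lin_maps R M N \<Longrightarrow> x \<in> carrier M \<Longrightarrow> y \<in> carrier M \<Longrightarrow> f (x \<oplus>\<^bsub>M\<^esub> y) = f x \<oplus>\<^bsub>N\<^esub> f y"
  unfolding lin_maps_def by blast

lemma lin_maps_smult:
  "f \<in> lin_maps R M N \<Longrightarrow> a \<in> carrier R \<Longrightarrow> x \<in> carrier M \<Longrightarrow> f (a \<odot>\<^bsub>M\<^esub> x) = a \<odot>\<^bsub>N\<^esub> f x"
  unfolding lin_maps_def by blast

lemma lin_maps_zero:
  assumes "module R M" "module R N" "f \<in> lin_maps R M N"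
  shows "f \<zero>\<^bsub>M\<^esub> = \<zero>\<^bsub>N\<^esub>"
proof -
  interpret M: module R M by fact
  interpret N: module R N by fact
  have "f (\<zero>\<^bsub>R\<^esub> \<odot>\<^bsub>M\<^esub> \<zero>\<^bsub>M\<^esub>) = \<zero>\<^bsub>R\<^esub> \<odot>\<^bsub>N\<^esub> f \<zero>\<^bsub>M\<^esub>"
    using assms(3) by (intro lin_maps_smult) auto
  then show ?thesis using lin_maps_closed[OF assms(3)] by simp
qed

lemma lin_maps_uminus:
  assumes "module R M" "module R N" "f \<in> lin_maps R M N" "x \<in> carrier M"
  shows "f (\<ominus>\<^bsub>M\<^esub> x) = \<ominus>\<^bsub>N\<^esub> f x"
proof -
  interpret M: module R M by fact
  interpret N: module R N by fact
  have "f ((\<ominus>\<^bsub>R\<^esub> \<one>\<^bsub>R\<^esub>) \<odot>\<^bsub>M\<^esub> x) = (\<ominus>\<^bsub>R\<^esub> \<one>\<^bsub>R\<^esub>) \<odot>\<^bsub>N\<^esub> f x"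
    using assms by (intro lin_maps_smult) auto
  then show ?thesis
    using assms lin_maps_closed[OF assms(3)] by (simp add: M.smult_l_minus N.smult_l_minus)
qed

lemma lin_maps_minus:
  assumes "module R M" "module R N" "f \<in> lin_maps R M N" "x \<in> carrier M" "y \<in> carrier M"
  shows "f (x \<ominus>\<^bsub>M\<^esub> y) = f x \<ominus>\<^bsub>N\<^esub> f y"
proof -
  interpret M: module R M by fact
  interpret N: module R N by fact
  show ?thesis
    using assms by (simp add: a_minus_def lin_maps_add lin_maps_uminus)
qed

lemma (in module) minus_eq_zero_iff:
  "x \<in> carrier M \<Longrightarrow> y \<in> carrier M \<Longrightarrow> x \<ominus>\<^bsub>M\<^esub> y = \<zero>\<^bsub>M\<^esub> \<longleftrightarrow> x = y"
  by (metis M.a_inv_closed M.add.inv_solve_right' M.l_zero M.zero_closed a_minus_def)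

lemma (in module) minus_zero_right [simp]:
  "x \<in> carrier M \<Longrightarrow> x \<ominus>\<^bsub>M\<^esub> \<zero>\<^bsub>M\<^esub> = x"
proof -
  have "\<ominus>\<^bsub>M\<^esub> \<zero>\<^bsub>M\<^esub> = \<zero>\<^bsub>M\<^esub>" by (rule M.minus_equality) simp_all
  then show "x \<in> carrier M \<Longrightarrow> x \<ominus>\<^bsub>M\<^esub> \<zero>\<^bsub>M\<^esub> = x" by (simp add: a_minus_def)
qed

lemma (in module) minus_add_cancel:
  "x \<in> carrier M \<Longrightarrow> y \<in> carrier M \<Longrightarrow> (x \<ominus>\<^bsub>M\<^esub> y) \<oplus>\<^bsub>M\<^esub> y = x"
  by (simp add: a_minus_def M.a_assoc M.l_neg)

lemma (in module) smult_minus_distr: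
  "a \<in> carrier R \<Longrightarrow> x \<in> carrier M \<Longrightarrow> y \<in> carrier M \<Longrightarrow>
    a \<odot>\<^bsub>M\<^esub> (x \<ominus>\<^bsub>M\<^esub> y) = a \<odot>\<^bsub>M\<^esub> x \<ominus>\<^bsub>M\<^esub> a \<odot>\<^bsub>M\<^esub> y"
  by (simp add: a_minus_def smult_r_distr smult_r_minus)

lemma (in module) smult_comm:
  "a \<in> carrier R \<Longrightarrow> b \<in> carrier R \<Longrightarrow> x \<in> carrier M \<Longrightarrow>
    a \<odot>\<^bsub>M\<^esub> (b \<odot>\<^bsub>M\<^esub> x) = b \<odot>\<^bsub>M\<^esub> (a \<odot>\<^bsub>M\<^esub> x)"
  by (metis R.m_comm smult_assoc1)

lemma lin_maps_comp:
  assumes "f \<in> lin_maps R M N" "g \<in> lin_maps R N K"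
  shows "(\<lambda>x. g (f x)) \<in> lin_maps R M K"
  using assms unfolding lin_maps_def by (auto simp: Pi_iff)

lemma lin_maps_id: "module R M \<Longrightarrow> (\<lambda>x. x) \<in> lin_maps R M M"
  unfolding lin_maps_def by simp

lemma lin_maps_zero_map:
  assumes "module R N" shows "(\<lambda>x. \<zero>\<^bsub>N\<^esub>) \<in> lin_maps R M N"
proof -
  interpret N: module R N by fact
  show ?thesis unfolding lin_maps_def by simp
qed

lemma lin_maps_minus_map:
  assumes "module R M" "module R N" "f \<in> lin_maps R M N" "g \<in> lin_maps R M N"
  shows "(\<lambda>x. f x \<ominus>\<^bsub>N\<^esub> g x) \<in> lin_maps R M N"
proof -
  interpret M: module R M by fact
  interpret N: module R N by fact
  show ?thesis
    using lin_maps_closed[OF assms(3)] lin_maps_closed[OF assms(4)]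
    by (intro lin_mapsI)
       (auto simp: a_minus_def lin_maps_add[OF assms(3)] lin_maps_add[OF assms(4)]
          lin_maps_smult[OF assms(3)] lin_maps_smult[OF assms(4)] N.minus_add N.a_ac
          N.smult_r_distr N.smult_r_minus)
qed

lemma module_submodule:
  "module R M \<Longrightarrow> submodule N R M \<Longrightarrow> module R (M\<lparr>carrier := N\<rparr>)"
  by (rule submodule.submodule_is_module)

lemma submodule_zero: "submodule N R M \<Longrightarrow> \<zero>\<^bsub>M\<^esub> \<in> N"
  using subgroup.one_closed[OF submodule.axioms(1)] by fastforce

lemma a_kernel_eq: "a_kernel M N f = {x \<in> carrier M. f x = \<zero>\<^bsub>N\<^esub>}"
  by (simp add: a_kernel_def')

lemma submodule_kernel:
  assumes "module R M" "module R N" "f \<in> lin_maps R M N"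
  shows "submodule {x \<in> carrier M. f x = \<zero>\<^bsub>N\<^esub>} R M"
proof -
  interpret M: module R M by fact
  interpret N: module R N by fact
  show ?thesis
    using assms by (intro M.submoduleI)
      (auto simp: lin_maps_zero lin_maps_uminus lin_maps_add lin_maps_smult)
qed

lemma submodule_image:
  assumes "module R M" "module R N" "f \<in> lin_maps R M N" "submodule K R M"
  shows "submodule (f ` K) R N"
proof -
  interpret M: module R M by fact
  interpret N: module R N by fact
  note K = M.submoduleE[OF assms(4)]
  have sub: "\<And>x. x \<in> K \<Longrightarrow> x \<in> carrier M" using K by blast
  show ?thesis
  proof (intro N.submoduleI)
    show "f ` K \<subseteq> carrier N" using sub lin_maps_closed[OF assms(3)] by blast
    obtain k where k: "k \<in> K" using K(2) by blast
    have "k \<oplus>\<^bsub>M\<^esub> \<ominus>\<^bsub>M\<^esub> k \<in> K" using K(3,5) k by blast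
    then have "\<zero>\<^bsub>M\<^esub> \<in> K" using k sub M.r_neg by simp
    then show "\<zero>\<^bsub>N\<^esub> \<in> f ` K" using lin_maps_zero[OF assms(1-3)] by (metis imageI)
    fix a assume "a \<in> f ` K"
    then obtain x where x: "x \<in> K" "a = f x" by blast
    then have "\<ominus>\<^bsub>N\<^esub> a = f (\<ominus>\<^bsub>M\<^esub> x)" using sub lin_maps_uminus[OF assms(1-3)] by simp
    then show "\<ominus>\<^bsub>N\<^esub> a \<in> f ` K" using K(3) x by blast
  next
    fix a b assume "a \<in> f ` K" "b \<in> f ` K"
    then obtain x y where x: "x \<in> K" "a = f x" "y \<in> K" "b = f y" by blast
    then have "a \<oplus>\<^bsub>N\<^esub> b = f (x \<oplus>\<^bsub>M\<^esub> y)" using sub lin_maps_add[OF assms(3)] by simp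
    then show "a \<oplus>\<^bsub>N\<^esub> b \<in> f ` K" using K(5) x by blast
  next
    fix a b assume a: "a \<in> carrier R" and "b \<in> f ` K"
    then obtain x where x: "x \<in> K" "b = f x" by blast
    then have "a \<odot>\<^bsub>N\<^esub> b = f (a \<odot>\<^bsub>M\<^esub> x)" using sub lin_maps_smult[OF assms(3)] a by simp
    then show "a \<odot>\<^bsub>N\<^esub> b \<in> f ` K" using K(4) x a by blast
  qed
qed

section \<open>Modules carried by other types\<close>

definition transport :: "('b \<Rightarrow> 'c) \<Rightarrow> ('a, 'b, 'm) module_scheme \<Rightarrow> ('a, 'c) module" where
  "transport \<sigma> M =
    \<lparr>carrier = \<sigma> ` carrier M, monoid.mult = undefined, one = undefined, zero = \<sigma> \<zero>\<^bsub>M\<^esub>,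
     add = (\<lambda>u v. \<sigma> (inv_into (carrier M) \<sigma> u \<oplus>\<^bsub>M\<^esub> inv_into (carrier M) \<sigma> v)),
     smult = (\<lambda>a u. \<sigma> (a \<odot>\<^bsub>M\<^esub> inv_into (carrier M) \<sigma> u))\<rparr>"

lemma module_transport:
  assumes "module R M" "inj_on \<sigma> (carrier M)"
  shows "module R (transport \<sigma> M)"
proof -
  interpret M: module R M by fact
  have [simp]: "inv_into (carrier M) \<sigma> (\<sigma> x) = x" if "x \<in> carrier M" for x
    using that assms(2) by simp
  have neg: "\<exists>x\<in>carrier M. \<sigma> (x \<oplus>\<^bsub>M\<^esub> y) = \<sigma> \<zero>\<^bsub>M\<^esub>" if "y \<in> carrier M" for y
    using that M.l_neg M.a_inv_closed by metis
  show ?thesis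
    by (intro moduleI abelian_groupI M.is_cring)
       (auto simp: transport_def M.a_ac M.smult_l_distr M.smult_r_distr M.smult_assoc1 intro: neg)
qed

lemma lin_maps_transport:
  assumes "module R M" "inj_on \<sigma> (carrier M)"
  shows "\<sigma> \<in> lin_maps R M (transport \<sigma> M)"
    and "inv_into (carrier M) \<sigma> \<in> lin_maps R (transport \<sigma> M) M"
proof -
  interpret M: module R M by fact
  have [simp]: "inv_into (carrier M) \<sigma> (\<sigma> x) = x" if "x \<in> carrier M" for x
    using that assms(2) by simp
  show "\<sigma> \<in> lin_maps R M (transport \<sigma> M)"
    by (intro lin_mapsI) (auto simp: transport_def)
  show "inv_into (carrier M) \<sigma> \<in> lin_maps R (transport \<sigma> M) M"
    by (intro lin_mapsI) (auto simp: transport_def)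
qed

lemma carrier_transport: "carrier (transport \<sigma> M) = \<sigma> ` carrier M"
  by (simp add: transport_def)

lemma injective_extend:
  fixes E :: "('a, 'e) module" and B :: "('a, 'b, 'm) module_scheme" and \<sigma> :: "'b \<Rightarrow> 'a + 'e"
  assumes E: "injective_module R E" and B: "module R B" and \<sigma>: "inj_on \<sigma> (carrier B)"
    and N: "submodule N R B" and f: "f \<in> lin_maps R (B\<lparr>carrier := N\<rparr>) E"
  shows "\<exists>g \<in> lin_maps R B E. \<forall>x\<in>N. g x = f x"
proof -
  interpret B: module R B by fact
  let ?N = "B\<lparr>carrier := N\<rparr>"
  have NB: "N \<subseteq> carrier B" using B.submoduleE(1)[OF N] .
  have mN: "module R ?N" by (rule module_submodule[OF B N])
  have iN: "inj_on \<sigma> (carrier ?N)" using inj_on_subset[OF \<sigma> NB] by simp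
  let ?j = "\<lambda>u. \<sigma> (inv_into (carrier ?N) \<sigma> u)"
  let ?f = "\<lambda>u. f (inv_into (carrier ?N) \<sigma> u)"
  have incl: "(\<lambda>x. x) \<in> lin_maps R ?N B" using NB by (auto simp: lin_maps_def)
  have j: "?j \<in> lin_maps R (transport \<sigma> ?N) (transport \<sigma> B)"
    using lin_maps_comp[OF lin_maps_comp[OF lin_maps_transport(2)[OF mN iN] incl]
        lin_maps_transport(1)[OF B \<sigma>]] .
  have ij: "inj_on ?j (carrier (transport \<sigma> ?N))"
    using iN by (auto simp: carrier_transport inj_on_def)
  have f': "?f \<in> lin_maps R (transport \<sigma> ?N) E"
    using lin_maps_comp[OF lin_maps_transport(2)[OF mN iN] f] .
  obtain g where g: "g \<in> lin_maps R (transport \<sigma> B) E"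
    "\<forall>x\<in>carrier (transport \<sigma> ?N). g (?j x) = ?f x"
    using E module_transport[OF mN iN] module_transport[OF B \<sigma>] j ij f'
    unfolding injective_module_def by blast
  show ?thesis
  proof (intro bexI ballI)
    show "(\<lambda>x. g (\<sigma> x)) \<in> lin_maps R B E"
      using lin_maps_comp[OF lin_maps_transport(1)[OF B \<sigma>] g(1)] .
    fix x assume "x \<in> N"
    then show "g (\<sigma> x) = f x"
      using g(2) iN by (auto simp: carrier_transport)
  qed
qed

lemma projective_lift:
  fixes P :: "('a, 'p) module" and B :: "('a, 'b, 'm) module_scheme" and C :: "('a, 'c, 'n) module_scheme"
    and \<sigma> :: "'b \<Rightarrow> 'p \<Rightarrow> 'a" and \<tau> :: "'c \<Rightarrow> 'p"
  assumes P: "projective_module R P" and B: "module R B" and C: "module R C"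
    and \<sigma>: "inj_on \<sigma> (carrier B)" and \<tau>: "inj_on \<tau> (carrier C)"
    and g: "g \<in> lin_maps R B C" and f: "f \<in> lin_maps R P C"
    and fg: "\<And>x. x \<in> carrier P \<Longrightarrow> f x \<in> g ` carrier B"
  shows "\<exists>h \<in> lin_maps R P B. \<forall>x\<in>carrier P. g (h x) = f x"
proof -
  interpret B: module R B by fact
  interpret C: module R C by fact
  let ?D = "C\<lparr>carrier := g ` carrier B\<rparr>"
  have sub: "submodule (g ` carrier B) R C"
    using submodule_image[OF B C g B.carrier_is_submodule] .
  have D: "module R ?D" by (rule module_submodule[OF C sub])
  have \<tau>D: "inj_on \<tau> (carrier ?D)" using inj_on_subset[OF \<tau> C.submoduleE(1)[OF sub]] by simp
  have gD: "g \<in> lin_maps R B ?D" using g by (auto simp: lin_maps_def)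
  have fD: "f \<in> lin_maps R P ?D" using f fg by (auto simp: lin_maps_def)
  let ?g = "\<lambda>u. \<tau> (g (inv_into (carrier B) \<sigma> u))"
  have g': "?g \<in> lin_maps R (transport \<sigma> B) (transport \<tau> ?D)"
    using lin_maps_comp[OF lin_maps_comp[OF lin_maps_transport(2)[OF B \<sigma>] gD]
        lin_maps_transport(1)[OF D \<tau>D]] .
  have f': "(\<lambda>x. \<tau> (f x)) \<in> lin_maps R P (transport \<tau> ?D)"
    using lin_maps_comp[OF fD lin_maps_transport(1)[OF D \<tau>D]] .
  have onto: "?g ` carrier (transport \<sigma> B) = carrier (transport \<tau> ?D)"
    using \<sigma> by (auto simp: carrier_transport image_image)
  obtain h where h: "h \<in> lin_maps R P (transport \<sigma> B)" "\<forall>x\<in>carrier P. ?g (h x) = \<tau> (f x)"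
    using P module_transport[OF B \<sigma>] module_transport[OF D \<tau>D] g' f' onto
    unfolding projective_module_def by blast
  show ?thesis
  proof (intro bexI ballI)
    show h': "(\<lambda>x. inv_into (carrier B) \<sigma> (h x)) \<in> lin_maps R P B"
      using lin_maps_comp[OF h(1) lin_maps_transport(2)[OF B \<sigma>]] .
    fix x assume x: "x \<in> carrier P"
    show "g (inv_into (carrier B) \<sigma> (h x)) = f x"
      using h(2) x \<tau> lin_maps_closed[OF g lin_maps_closed[OF h' x]] lin_maps_closed[OF f x]
      by (auto dest: inj_onD)
  qed
qed

section \<open>Ideals and cyclic modules\<close>

lemma module_self: assumes "cring R" shows "module R (self_module R)"
proof -
  interpret cring R by fact
  show ?thesis
    by (intro moduleI abelian_groupI assms)
       (auto simp: self_module_def a_ac l_distr r_distr m_assoc intro: l_neg a_inv_closed)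
qed

lemma self_module_simps [simp]:
  "carrier (self_module R) = carrier R" "zero (self_module R) = zero R"
  "add (self_module R) = add R" "smult (self_module R) = monoid.mult R"
  by (simp_all add: self_module_def)

lemma submodule_self_iff:
  assumes "cring R" shows "submodule J R (self_module R) \<longleftrightarrow> ideal J R"
proof
  interpret cring R by fact
  interpret S: module R "self_module R" by (rule module_self[OF assms])
  {
    assume J: "submodule J R (self_module R)"
    note * = S.submoduleE[OF J]
    have sub: "subgroup J (add_monoid R)"
      using submodule.axioms(1)[OF J] by (simp add: subgroup_def m_inv_def)
    show "ideal J R"
    proof (intro idealI sub)
      fix a x assume ax: "a \<in> J" "x \<in> carrier R"
      then show "x \<otimes>\<^bsub>R\<^esub> a \<in> J" using *(4) by simp
      moreover have "a \<in> carrier R" using *(1) ax by auto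
      ultimately show "a \<otimes>\<^bsub>R\<^esub> x \<in> J" using ax by (simp add: m_comm)
    qed (rule ring_axioms)
  }
  assume J: "ideal J R"
  interpret ideal J R by fact
  have "subgroup J (add_monoid (self_module R))" using a_subgroup by (simp add: subgroup_def m_inv_def)
  then show "submodule J R (self_module R)"
    by (intro submodule.intro submodule_axioms.intro) (auto intro: I_l_closed)
qed

lemma a_r_coset_self_module [simp]: "a_r_coset (self_module R) = a_r_coset R"
  by (rule ext)+ (simp add: a_r_coset_def')

lemma carrier_quot_by_ideal:
  "carrier (quot_by_ideal R J) = (\<lambda>x. J +>\<^bsub>R\<^esub> x) ` carrier R"
  by (auto simp: quot_module_def A_RCOSETS_def' a_r_coset_def')

lemma zero_quot_by_ideal [simp]: "zero (quot_by_ideal R J) = J"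
  by (simp add: quot_module_def)

lemma (in ideal) coset_eq_iff:
  assumes "x \<in> carrier R" "y \<in> carrier R"
  shows "I +> x = I +> y \<longleftrightarrow> x \<ominus> y \<in> I"
  using quotient_eq_iff_same_a_r_cos[OF is_ideal assms] by simp

lemma (in ideal) coset_eq_self_iff:
  assumes "x \<in> carrier R" shows "I +> x = I \<longleftrightarrow> x \<in> I"
  using coset_eq_iff[OF assms zero_closed] assms a_coset_add_zero[OF a_subset]
  by (simp add: a_minus_def)

lemma (in ideal) add_quot_by_ideal:
  assumes "x \<in> carrier R" "y \<in> carrier R"
  shows "(I +> x) \<oplus>\<^bsub>quot_by_ideal R I\<^esub> (I +> y) = I +> (x \<oplus> y)"
  using a_rcos_sum[OF assms]
  by (simp add: quot_module_def set_add_def' self_module_def)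

lemma (in ideal) smult_quot_by_ideal:
  assumes "a \<in> carrier R" "x \<in> carrier R"
  shows "a \<odot>\<^bsub>quot_by_ideal R I\<^esub> (I +> x) = I +> (a \<otimes> x)"
proof -
  have *: "I +> (a \<otimes> y) = I +> (a \<otimes> x)" if y: "y \<in> I +> x" for y
  proof -
    obtain i where i: "i \<in> I" "y = i \<oplus> x" using y by (auto simp: a_r_coset_def')
    have "a \<otimes> y \<ominus> a \<otimes> x = a \<otimes> i"
      using assms i Icarr by (simp add: r_distr a_minus_def a_assoc r_neg)
    then show ?thesis using assms i Icarr by (subst coset_eq_iff) (auto intro: I_l_closed)
  qed
  have "(\<Union>y\<in>I +> x. I +> (a \<otimes> y)) = (\<Union>y\<in>I +> x. I +> (a \<otimes> x))"
    using * by (rule SUP_cong[OF refl])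
  also have "\<dots> = I +> (a \<otimes> x)" using a_rcos_self[OF assms(2)] by auto
  finally show ?thesis by (simp add: quot_module_def)
qed

lemma module_quot:
  fixes R (structure)
  assumes "cring R" "ideal J R" shows "module R (quot_by_ideal R J)"
proof -
  interpret cring R by fact
  interpret ideal J R by fact
  show ?thesis
  proof (intro moduleI abelian_groupI assms)
    fix X assume "X \<in> carrier (quot_by_ideal R J)"
    then obtain x where x: "x \<in> carrier R" "X = J +> x" by (auto simp: carrier_quot_by_ideal)
    then have "(J +> (\<ominus> x)) \<oplus>\<^bsub>quot_by_ideal R J\<^esub> X = \<zero>\<^bsub>quot_by_ideal R J\<^esub>"
      by (simp add: add_quot_by_ideal l_neg coset_eq_self_iff)
    then show "\<exists>Y\<in>carrier (quot_by_ideal R J). Y \<oplus>\<^bsub>quot_by_ideal R J\<^esub> X = \<zero>\<^bsub>quot_by_ideal R J\<^esub>"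
      using x by (auto simp: carrier_quot_by_ideal)
    have "\<zero>\<^bsub>quot_by_ideal R J\<^esub> \<oplus>\<^bsub>quot_by_ideal R J\<^esub> X = (J +> \<zero>) \<oplus>\<^bsub>quot_by_ideal R J\<^esub> X"
      using coset_eq_self_iff[of \<zero>] by simp
    also have "\<dots> = X" using x by (simp add: add_quot_by_ideal del: a_coset_add_zero)
    finally show "\<zero>\<^bsub>quot_by_ideal R J\<^esub> \<oplus>\<^bsub>quot_by_ideal R J\<^esub> X = X" .
  next
    show "\<zero>\<^bsub>quot_by_ideal R J\<^esub> \<in> carrier (quot_by_ideal R J)"
      using coset_eq_self_iff[of \<zero>] by (auto simp: carrier_quot_by_ideal intro: rev_image_eqI)
  qed (auto simp: carrier_quot_by_ideal add_quot_by_ideal smult_quot_by_ideal a_ac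
         l_distr r_distr m_assoc)
qed

definition plus_gen :: "('a, 'r) ring_scheme \<Rightarrow> 'a set \<Rightarrow> 'a \<Rightarrow> 'a set" where
  "plus_gen R J a = {j \<oplus>\<^bsub>R\<^esub> r \<otimes>\<^bsub>R\<^esub> a | j r. j \<in> J \<and> r \<in> carrier R}"

lemma plus_genE:
  assumes "x \<in> plus_gen R J a"
  obtains j r where "x = j \<oplus>\<^bsub>R\<^esub> r \<otimes>\<^bsub>R\<^esub> a" "j \<in> J" "r \<in> carrier R"
  using assms unfolding plus_gen_def by blast

definition colon :: "('a, 'r) ring_scheme \<Rightarrow> 'a set \<Rightarrow> 'a \<Rightarrow> 'a set" where
  "colon R J a = {r \<in> carrier R. r \<otimes>\<^bsub>R\<^esub> a \<in> J}"

context cring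
begin

lemma self_module_is_module: "module R (self_module R)"
  by (rule module_self[OF is_cring])

lemma submodule_self: "submodule J R (self_module R) \<longleftrightarrow> ideal J R"
  by (rule submodule_self_iff[OF is_cring])

lemma ideal_zero: "ideal J R \<Longrightarrow> \<zero> \<in> J"
  by (rule additive_subgroup.zero_closed[OF ideal.axioms(1)])

lemma ideal_minus: "ideal J R \<Longrightarrow> x \<in> J \<Longrightarrow> y \<in> J \<Longrightarrow> x \<ominus> y \<in> J"
  by (simp add: a_minus_def additive_subgroup.a_closed additive_subgroup.a_inv_closed ideal.axioms(1))

lemma plus_gen_eq: "a \<in> carrier R \<Longrightarrow> plus_gen R J a = J <+> (PIdl a)"
  by (auto simp: plus_gen_def set_add_def' cgenideal_def)

lemma ideal_plus_gen: "ideal J R \<Longrightarrow> a \<in> carrier R \<Longrightarrow> ideal (plus_gen R J a) R"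
  by (simp add: plus_gen_eq add_ideals cgenideal_ideal)

lemma plus_gen_incl:
  assumes "ideal J R" "a \<in> carrier R" shows "J \<subseteq> plus_gen R J a" "a \<in> plus_gen R J a"
proof -
  interpret ideal J R by fact
  show "J \<subseteq> plus_gen R J a"
  proof
    fix j assume "j \<in> J"
    then have "j = j \<oplus> \<zero> \<otimes> a" using assms Icarr by simp
    then show "j \<in> plus_gen R J a" using \<open>j \<in> J\<close> unfolding plus_gen_def by blast
  qed
  have "a = \<zero> \<oplus> \<one> \<otimes> a" using assms by simp
  then show "a \<in> plus_gen R J a" unfolding plus_gen_def using zero_closed one_closed additive_subgroup.zero_closed[OF is_additive_subgroup] by blast
qed

lemma plus_gen_minimal:
  assumes "ideal K R" "J \<subseteq> K" "a \<in> K" shows "plus_gen R J a \<subseteq> K"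
proof -
  interpret ideal K R by fact
  show ?thesis using assms(2,3) I_l_closed unfolding plus_gen_def by auto
qed

lemma idealI':
  assumes "J \<subseteq> carrier R" "\<zero> \<in> J" "\<And>x y. x \<in> J \<Longrightarrow> y \<in> J \<Longrightarrow> x \<oplus> y \<in> J"
    "\<And>a x. a \<in> carrier R \<Longrightarrow> x \<in> J \<Longrightarrow> a \<otimes> x \<in> J"
  shows "ideal J R"
proof -
  interpret S: module R "self_module R" by (rule module_self[OF is_cring])
  have "\<ominus>\<^bsub>self_module R\<^esub> x \<in> J" if "x \<in> J" for x
  proof -
    have x: "x \<in> carrier R" using that assms(1) by auto
    have "\<ominus>\<^bsub>self_module R\<^esub> x = (\<ominus> \<one>) \<otimes> x"
      using S.smult_l_minus[of \<one> x] x by simp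
    then show ?thesis using assms(4)[OF _ that] by simp
  qed
  then show ?thesis
    unfolding submodule_self_iff[OF is_cring, symmetric]
    using assms by (intro S.submoduleI) simp_all
qed

lemma ideal_colon: assumes "ideal J R" "a \<in> carrier R" shows "ideal (colon R J a) R"
proof -
  interpret J: ideal J R by fact
  show ?thesis
    using assms(2) by (intro idealI') (auto simp: colon_def l_distr m_assoc J.I_l_closed)
qed

lemma colon_incl: "ideal J R \<Longrightarrow> a \<in> carrier R \<Longrightarrow> J \<subseteq> colon R J a"
  using ideal.Icarr ideal.I_r_closed unfolding colon_def by fastforce

end

lemma noetherian_maximal:
  assumes "noetherian_ring R" "\<And>J. J \<in> S \<Longrightarrow> ideal J R" "J0 \<in> S"
  obtains J where "J \<in> S" "J0 \<subseteq> J" "\<And>K. K \<in> S \<Longrightarrow> J \<subseteq> K \<Longrightarrow> K = J"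
proof -
  interpret noetherian_ring R by fact
  let ?S = "{J \<in> S. J0 \<subseteq> J}"
  have "\<exists>J\<in>?S. \<forall>K\<in>?S. J \<subseteq> K \<longrightarrow> K = J"
  proof (rule subset_Zorn)
    fix C assume C: "subset.chain ?S C"
    show "\<exists>U\<in>?S. \<forall>X\<in>C. X \<subseteq> U"
    proof (cases "C = {}")
      case True then show ?thesis using assms(3) by blast
    next
      case False
      have "subset.chain {I. ideal I R} C"
        using C assms(2) by (auto simp: subset_chain_def)
      then have "\<Union>C \<in> C" using ideal_chain_is_trivial False by blast
      then show ?thesis using C by (auto simp: subset_chain_def)
    qed
  qed
  then obtain J where "J \<in> ?S" "\<forall>K\<in>?S. J \<subseteq> K \<longrightarrow> K = J" ..
  then show ?thesis using that[of J] by (simp add: order_trans[of J0 J])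
qed

section \<open>Free modules of finite rank\<close>

definition free_module :: "('a, 'r) ring_scheme \<Rightarrow> 'i set \<Rightarrow> ('a, 'i \<Rightarrow> 'a) module" where
  "free_module R A =
    \<lparr>carrier = {x. (\<forall>i\<in>A. x i \<in> carrier R) \<and> (\<forall>i. i \<notin> A \<longrightarrow> x i = \<zero>\<^bsub>R\<^esub>)},
     monoid.mult = undefined, one = undefined, zero = (\<lambda>_. \<zero>\<^bsub>R\<^esub>),
     add = (\<lambda>x y i. x i \<oplus>\<^bsub>R\<^esub> y i), smult = (\<lambda>a x i. a \<otimes>\<^bsub>R\<^esub> x i)\<rparr>"

definition unit_vec :: "('a, 'r) ring_scheme \<Rightarrow> 'i \<Rightarrow> 'i \<Rightarrow> 'a" where
  "unit_vec R i = (\<lambda>k. if k = i then \<one>\<^bsub>R\<^esub> else \<zero>\<^bsub>R\<^esub>)"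

lemma free_module_simps:
  "carrier (free_module R A) = {x. (\<forall>i\<in>A. x i \<in> carrier R) \<and> (\<forall>i. i \<notin> A \<longrightarrow> x i = \<zero>\<^bsub>R\<^esub>)}"
  "zero (free_module R A) = (\<lambda>_. \<zero>\<^bsub>R\<^esub>)"
  "add (free_module R A) = (\<lambda>x y i. x i \<oplus>\<^bsub>R\<^esub> y i)"
  "smult (free_module R A) = (\<lambda>a x i. a \<otimes>\<^bsub>R\<^esub> x i)"
  by (simp_all add: free_module_def)

context cring
begin

lemma free_coord_closed: "x \<in> carrier (free_module R A) \<Longrightarrow> x i \<in> carrier R"
  by (cases "i \<in> A") (auto simp: free_module_simps)

lemma free_module_closed:
  assumes "x \<in> carrier (free_module R A)" "y \<in> carrier (free_module R A)" "a \<in> carrier R"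
  shows "(\<lambda>i. x i \<oplus> y i) \<in> carrier (free_module R A)"
    and "(\<lambda>i. a \<otimes> x i) \<in> carrier (free_module R A)"
    and "(\<lambda>i. \<ominus> x i) \<in> carrier (free_module R A)"
  using assms by (auto simp: free_module_simps)

lemma module_free: "module R (free_module R A)"
proof -
  have *: "x i \<in> carrier R" if "x \<in> carrier (free_module R A)" for x i
    using that by (rule free_coord_closed)
  show ?thesis
  proof (intro moduleI abelian_groupI is_cring, goal_cases)
    case (1 x y) then show ?case using free_module_closed[OF 1 zero_closed] by (simp add: free_module_simps(3))
  next
    case 2 show ?case by (simp add: free_module_simps)
  next
    case (3 x y z) then show ?case by (simp add: free_module_simps(3) * a_assoc)
  next
    case (4 x y) then show ?case by (simp add: free_module_simps(3) * a_comm)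
  next
    case (5 x) then show ?case by (simp add: free_module_simps(2,3) *)
  next
    case (6 x)
    have "(\<lambda>i. \<ominus> x i) \<oplus>\<^bsub>free_module R A\<^esub> x = \<zero>\<^bsub>free_module R A\<^esub>"
      using *[OF 6] by (simp add: free_module_simps(2,3) l_neg)
    then show ?case using free_module_closed(3)[OF 6 6 zero_closed] by blast
  next
    case (7 a x) then show ?case using free_module_closed(2) by (simp add: free_module_simps(4))
  next
    case (8 a b x) then show ?case by (simp add: free_module_simps(3,4) * l_distr)
  next
    case (9 a x y) then show ?case by (simp add: free_module_simps(3,4) * r_distr)
  next
    case (10 a b x) then show ?case by (simp add: free_module_simps(4) * m_assoc)
  next
    case (11 x) then show ?case by (simp add: free_module_simps(4) *)
  qed
qed

end

context cring
begin

lemma unit_vec_closed: "i \<in> A \<Longrightarrow> unit_vec R i \<in> carrier (free_module R A)"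
  by (auto simp: free_module_simps unit_vec_def)

lemma free_module_mono: "A \<subseteq> B \<Longrightarrow> carrier (free_module R A) \<subseteq> carrier (free_module R B)"
proof
  fix x assume "A \<subseteq> B" "x \<in> carrier (free_module R A)"
  then show "x \<in> carrier (free_module R B)"
    using free_coord_closed[of x A] by (auto simp: free_module_simps)
qed

lemma lin_maps_coord: "(\<lambda>x. x i) \<in> lin_maps R (free_module R A) (self_module R)"
  using free_coord_closed by (intro lin_mapsI) (simp_all add: free_module_simps(3,4))

definition free_hom :: "('a, 'c, 'n) module_scheme \<Rightarrow> 'i set \<Rightarrow> ('i \<Rightarrow> 'c) \<Rightarrow> ('i \<Rightarrow> 'a) \<Rightarrow> 'c" where
  "free_hom M A b x = (\<Oplus>\<^bsub>M\<^esub>i\<in>A. x i \<odot>\<^bsub>M\<^esub> b i)"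

lemma lin_maps_free_hom:
  assumes "module R M" "finite A" "\<And>i. i \<in> A \<Longrightarrow> b i \<in> carrier M"
  shows "free_hom M A b \<in> lin_maps R (free_module R A) M"
proof -
  interpret M: module R M by fact
  have c: "x i \<odot>\<^bsub>M\<^esub> b i \<in> carrier M" if "x \<in> carrier (free_module R A)" "i \<in> A" for x i
    using assms(3)[OF that(2)] free_coord_closed[OF that(1)] by simp
  show ?thesis
  proof (intro lin_mapsI)
    fix x y assume x: "x \<in> carrier (free_module R A)" and y: "y \<in> carrier (free_module R A)"
    show "free_hom M A b x \<in> carrier M"
      unfolding free_hom_def using c[OF x] by (intro M.finsum_closed) auto
    have "free_hom M A b (x \<oplus>\<^bsub>free_module R A\<^esub> y)
        = (\<Oplus>\<^bsub>M\<^esub>i\<in>A. x i \<odot>\<^bsub>M\<^esub> b i \<oplus>\<^bsub>M\<^esub> y i \<odot>\<^bsub>M\<^esub> b i)"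
      unfolding free_hom_def using c[OF x] c[OF y] assms(3) free_coord_closed[OF x] free_coord_closed[OF y]
      by (intro M.finsum_cong') (auto simp: free_module_simps(3) M.smult_l_distr)
    also have "\<dots> = free_hom M A b x \<oplus>\<^bsub>M\<^esub> free_hom M A b y"
      unfolding free_hom_def using c[OF x] c[OF y] by (intro M.finsum_addf) auto
    finally show "free_hom M A b (x \<oplus>\<^bsub>free_module R A\<^esub> y) = free_hom M A b x \<oplus>\<^bsub>M\<^esub> free_hom M A b y" .
  next
    fix a x assume a: "a \<in> carrier R" and x: "x \<in> carrier (free_module R A)"
    have "free_hom M A b (a \<odot>\<^bsub>free_module R A\<^esub> x) = (\<Oplus>\<^bsub>M\<^esub>i\<in>A. a \<odot>\<^bsub>M\<^esub> (x i \<odot>\<^bsub>M\<^esub> b i))"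
      unfolding free_hom_def using a c[OF x] assms(3) free_coord_closed[OF x]
      by (intro M.finsum_cong') (auto simp: free_module_simps(4) M.smult_assoc1)
    also have "\<dots> = a \<odot>\<^bsub>M\<^esub> free_hom M A b x"
      unfolding free_hom_def using c[OF x] assms(2) a by (intro M.finsum_smult_ldistr[symmetric]) auto
    finally show "free_hom M A b (a \<odot>\<^bsub>free_module R A\<^esub> x) = a \<odot>\<^bsub>M\<^esub> free_hom M A b x" .
  qed
qed

lemma free_hom_unit_vec:
  assumes "module R M" "finite A" "\<And>i. i \<in> A \<Longrightarrow> b i \<in> carrier M" "k \<in> A"
  shows "free_hom M A b (unit_vec R k) = b k"
proof -
  interpret M: module R M by fact
  have "free_hom M A b (unit_vec R k) = (\<Oplus>\<^bsub>M\<^esub>i\<in>A. if k = i then b i else \<zero>\<^bsub>M\<^esub>)"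
    unfolding free_hom_def using assms(3) by (intro M.finsum_cong') (auto simp: unit_vec_def)
  also have "\<dots> = b k" using assms by (intro M.finsum_singleton) auto
  finally show ?thesis .
qed

lemma free_expand:
  assumes "module R M" "finite A" "f \<in> lin_maps R (free_module R A) M" "x \<in> carrier (free_module R A)"
  shows "f x = free_hom M A (\<lambda>i. f (unit_vec R i)) x"
  using assms(2-)
proof (induction A arbitrary: x rule: finite_induct)
  interpret M: module R M by fact
  case empty
  have "x = \<zero>\<^bsub>free_module R {}\<^esub>" using empty by (auto simp: free_module_simps)
  then show ?case
    using lin_maps_zero[OF module_free assms(1) empty(1)] by (simp add: free_hom_def)
next
  interpret M: module R M by fact
  case (insert a A)
  let ?F = "free_module R (insert a A)"
  interpret F: module R ?F by (rule module_free)
  have f': "f \<in> lin_maps R (free_module R A) M"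
    using insert(4) subsetD[OF free_module_mono[OF subset_insertI[of A a]]]
    by (simp add: lin_maps_def free_module_simps(3,4) Pi_iff)
  define y where "y = x(a := \<zero>)"
  have y: "y \<in> carrier (free_module R A)" using insert by (auto simp: y_def free_module_simps)
  have yF: "y \<in> carrier ?F" using y free_module_mono[of A "insert a A"] by auto
  have e: "unit_vec R a \<in> carrier ?F" by (rule unit_vec_closed) simp
  have xc: "\<And>i. x i \<in> carrier R" using insert(5) by (rule free_coord_closed)
  have c: "f (unit_vec R i) \<in> carrier M" if "i \<in> insert a A" for i
    using lin_maps_closed[OF insert(4) unit_vec_closed[OF that]] .
  have "x = x a \<odot>\<^bsub>?F\<^esub> unit_vec R a \<oplus>\<^bsub>?F\<^esub> y"
    using xc by (auto simp: y_def unit_vec_def free_module_simps(3,4) fun_eq_iff)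
  then have "f x = x a \<odot>\<^bsub>M\<^esub> f (unit_vec R a) \<oplus>\<^bsub>M\<^esub> f y"
    using lin_maps_add[OF insert(4) F.smult_closed[OF xc e] yF] lin_maps_smult[OF insert(4) xc e] by metis
  also have "f y = (\<Oplus>\<^bsub>M\<^esub>i\<in>A. x i \<odot>\<^bsub>M\<^esub> f (unit_vec R i))"
    unfolding insert.IH[OF f' y] free_hom_def using insert(2) xc c
    by (intro M.finsum_cong') (auto simp: y_def)
  finally show ?case
    unfolding free_hom_def using insert(1,2) xc c by (simp add: Pi_def)
qed

lemma free_lift:
  assumes A: "finite A" and B: "module R B" and C: "module R C"
    and g: "g \<in> lin_maps R B C" and f: "f \<in> lin_maps R (free_module R A) C"
    and fg: "\<And>x. x \<in> carrier (free_module R A) \<Longrightarrow> f x \<in> g ` carrier B"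
  shows "\<exists>h \<in> lin_maps R (free_module R A) B. \<forall>x\<in>carrier (free_module R A). g (h x) = f x"
proof -
  interpret B: module R B by fact
  interpret C: module R C by fact
  have "\<forall>i\<in>A. \<exists>b\<in>carrier B. g b = f (unit_vec R i)"
    using fg unit_vec_closed by (metis image_iff)
  then obtain b where b: "\<And>i. i \<in> A \<Longrightarrow> b i \<in> carrier B" "\<And>i. i \<in> A \<Longrightarrow> g (b i) = f (unit_vec R i)"
    by metis
  let ?h = "free_hom B A b"
  have h: "?h \<in> lin_maps R (free_module R A) B" by (rule lin_maps_free_hom[OF B A b(1)])
  have cf: "f (unit_vec R i) \<in> carrier C" if "i \<in> A" for i
    using lin_maps_closed[OF f unit_vec_closed[OF that]] .
  have "g (?h x) = f x" if x: "x \<in> carrier (free_module R A)" for x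
  proof -
    have "g (?h x) = free_hom C A (\<lambda>i. g (?h (unit_vec R i))) x"
      by (rule free_expand[OF C A lin_maps_comp[OF h g] x])
    also have "\<dots> = free_hom C A (\<lambda>i. f (unit_vec R i)) x"
      unfolding free_hom_def[of C]
      using b cf free_coord_closed[OF x]
      by (intro C.finsum_cong') (simp_all add: free_hom_unit_vec[OF B A] Pi_def)
    also have "\<dots> = f x" by (rule free_expand[OF C A f x, symmetric])
    finally show ?thesis .
  qed
  then show ?thesis using h by blast
qed

lemma projective_retract:
  assumes A: "finite A" and P: "module R P"
    and i: "i \<in> lin_maps R P (free_module R A)" and r: "r \<in> lin_maps R (free_module R A) P"
    and ri: "\<And>x. x \<in> carrier P \<Longrightarrow> r (i x) = x"
  shows "projective_module R P"
  unfolding projective_module_def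
proof (intro conjI P allI impI, elim conjE)
  fix B :: "('a, 'd \<Rightarrow> 'a) module" and C :: "('a, 'd) module" and g f
  assume B: "module R B" and C: "module R C" and g: "g \<in> lin_maps R B C"
    and onto: "g ` carrier B = carrier C" and f: "f \<in> lin_maps R P C"
  have "f (r x) \<in> g ` carrier B" if "x \<in> carrier (free_module R A)" for x
    using lin_maps_closed[OF f lin_maps_closed[OF r that]] onto by simp
  then obtain h where h: "h \<in> lin_maps R (free_module R A) B"
    "\<forall>x\<in>carrier (free_module R A). g (h x) = f (r x)"
    using free_lift[OF A B C g lin_maps_comp[OF r f]] by blast
  show "\<exists>h\<in>lin_maps R P B. \<forall>x\<in>carrier P. g (h x) = f x"
  proof (intro bexI[of _ "\<lambda>x. h (i x)"] ballI)
    show "(\<lambda>x. h (i x)) \<in> lin_maps R P B" by (rule lin_maps_comp[OF i h(1)])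
    show "g (h (i x)) = f x" if "x \<in> carrier P" for x
      using h(2) lin_maps_closed[OF i that] ri[OF that] by simp
  qed
qed

lemma ideal_leading_coeff:
  assumes "submodule N R (free_module R A)"
  shows "ideal ((\<lambda>x. x a) ` N) R"
  using submodule_image[OF module_free self_module_is_module lin_maps_coord assms]
  by (simp add: submodule_self)

lemma submodule_Int:
  assumes "module R M" "submodule N R M" "submodule K R M"
  shows "submodule (N \<inter> K) R M"
proof -
  interpret M: module R M by fact
  show ?thesis
    using M.submoduleE[OF assms(2)] M.submoduleE[OF assms(3)] submodule_zero[OF assms(2)] submodule_zero[OF assms(3)]
    by (intro M.submoduleI) auto
qed

lemma submodule_free_iff:
  fixes A B :: "'i set"
  assumes AB: "A \<subseteq> B"
  shows "submodule N R (free_module R A) \<longleftrightarrow>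
    submodule N R (free_module R B) \<and> N \<subseteq> carrier (free_module R A)"
proof -
  interpret A: module R "free_module R A" by (rule module_free)
  interpret B: module R "free_module R B" by (rule module_free)
  have neg: "\<ominus>\<^bsub>free_module R C\<^esub> x = (\<lambda>i. \<ominus> x i)" if "x \<in> carrier (free_module R C)" for x and C :: "'i set"
  proof -
    interpret C: module R "free_module R C" by (rule module_free)
    show ?thesis
      using free_coord_closed[OF that] free_module_closed(3)[OF that that zero_closed] that
      by (intro C.minus_equality) (simp_all add: free_module_simps(2,3) l_neg)
  qed
  have z: "(\<lambda>_. \<zero>) \<in> H" if "submodule H R (free_module R C)" for H and C :: "'i set"
    using submodule_zero[OF that] by (simp add: free_module_simps)
  have sub: "carrier (free_module R A) \<subseteq> carrier (free_module R B)" using free_module_mono[OF AB] .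
  show ?thesis
  proof
    assume N: "submodule N R (free_module R A)"
    note * = A.submoduleE[OF N]
    have "submodule N R (free_module R B)"
    proof (rule B.submoduleI)
      fix x assume x: "x \<in> N"
      then have "x \<in> carrier (free_module R A)" "x \<in> carrier (free_module R B)" using *(1) sub by auto
      then show "\<ominus>\<^bsub>free_module R B\<^esub> x \<in> N" using *(3)[OF x] neg by simp
    qed (use * sub z[OF N] in \<open>auto simp: free_module_simps(2-4)\<close>)
    then show "submodule N R (free_module R B) \<and> N \<subseteq> carrier (free_module R A)" using * by simp
  next
    assume N: "submodule N R (free_module R B) \<and> N \<subseteq> carrier (free_module R A)"
    then have N': "submodule N R (free_module R B)" by simp
    note * = B.submoduleE[OF N']
    show "submodule N R (free_module R A)"
    proof (rule A.submoduleI)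
      fix x assume x: "x \<in> N"
      then have "x \<in> carrier (free_module R A)" "x \<in> carrier (free_module R B)" using N *(1) by auto
      then show "\<ominus>\<^bsub>free_module R A\<^esub> x \<in> N" using *(3)[OF x] neg by simp
    qed (use * N z[OF N'] in \<open>auto simp: free_module_simps(2-4)\<close>)
  qed
qed

lemma free_submodule_finite_span:
  assumes "noetherian_ring R" "finite A" "submodule N R (free_module R A)"
  shows "\<exists>S. finite S \<and> S \<subseteq> N \<and> (\<forall>K. submodule K R (free_module R A) \<longrightarrow> S \<subseteq> K \<longrightarrow> N \<subseteq> K)"
  using assms(2,3)
proof (induction A arbitrary: N rule: finite_induct)
  case empty
  interpret F: module R "free_module R {}" by (rule module_free)
  have "N \<subseteq> K" if "submodule K R (free_module R {})" for K
  proof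
    fix x assume "x \<in> N"
    then have "x = \<zero>\<^bsub>free_module R {}\<^esub>"
      using F.submoduleE(1)[OF empty] by (auto simp: free_module_simps)
    then show "x \<in> K" using submodule_zero[OF that] by simp
  qed
  then show ?case by blast
next
  case (insert a A)
  interpret R: noetherian_ring R by fact
  let ?F = "free_module R (insert a A)"
  interpret F: module R ?F by (rule module_free)
  note N = F.submoduleE[OF insert(4)]
  have AB: "A \<subseteq> insert a A" by blast
  define N' where "N' = N \<inter> carrier (free_module R A)"
  have "submodule (carrier (free_module R A)) R (free_module R A)"
    by (rule module.carrier_is_submodule[OF module_free])
  then have "submodule (carrier (free_module R A)) R ?F" using submodule_free_iff[OF AB] by blast
  then have N': "submodule N' R (free_module R A)"
    unfolding submodule_free_iff[OF AB] N'_def using submodule_Int[OF module_free insert(4)] by blast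
  obtain S where S: "finite S" "S \<subseteq> N'"
    "\<forall>K. submodule K R (free_module R A) \<longrightarrow> S \<subseteq> K \<longrightarrow> N' \<subseteq> K"
    using insert.IH[OF N'] by blast
  obtain T where T: "T \<subseteq> carrier R" "finite T" "(\<lambda>x. x a) ` N = Idl T"
    using R.finetely_gen[OF ideal_leading_coeff[OF insert(4)]] by blast
  have "T \<subseteq> (\<lambda>x. x a) ` N" using T genideal_self by blast
  then obtain U where U: "U \<subseteq> N" "finite U" "T = (\<lambda>x. x a) ` U"
    using T(2) finite_subset_image by metis
  have "N \<subseteq> K" if K: "submodule K R ?F" "S \<union> U \<subseteq> K" for K
  proof
    fix x assume x: "x \<in> N"
    have NK: "submodule (N \<inter> K) R ?F" by (rule submodule_Int[OF module_free insert(4) K(1)])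
    have "Idl T \<subseteq> (\<lambda>x. x a) ` (N \<inter> K)"
      using ideal_leading_coeff[OF NK] U K(2) by (intro genideal_minimal) auto
    then obtain y where y: "y \<in> N" "y \<in> K" "x a = y a" using T(3) x by blast
    have xF: "x \<in> carrier ?F" "y \<in> carrier ?F" using x y N(1) by auto
    have d: "x \<ominus>\<^bsub>?F\<^esub> y \<in> N" using x y N(3,5) by (simp add: a_minus_def)
    then have dF: "x \<ominus>\<^bsub>?F\<^esub> y \<in> carrier ?F" using N(1) by auto
    have "(x \<ominus>\<^bsub>?F\<^esub> y) a = \<zero>"
    proof -
      have "(x \<ominus>\<^bsub>?F\<^esub> y) a = x a \<ominus>\<^bsub>self_module R\<^esub> y a"
        using lin_maps_minus[OF module_free self_module_is_module lin_maps_coord[of a] xF] .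
      then show ?thesis
        using module.minus_eq_zero_iff[OF self_module_is_module, of "x a" "y a"] y(3)
          free_coord_closed[OF xF(1)] free_coord_closed[OF xF(2)] by simp
    qed
    then have "x \<ominus>\<^bsub>?F\<^esub> y \<in> carrier (free_module R A)" using dF by (auto simp: free_module_simps(1))
    then have "x \<ominus>\<^bsub>?F\<^esub> y \<in> N'" using d N'_def by blast
    moreover have "N' \<subseteq> K"
    proof -
      have "submodule (N' \<inter> K) R ?F"
        using submodule_Int[OF module_free _ K(1)] N' submodule_free_iff[OF AB] by blast
      then have "submodule (N' \<inter> K) R (free_module R A)"
        unfolding submodule_free_iff[OF AB] N'_def by blast
      then show ?thesis using S K(2) by blast
    qed
    ultimately have "x \<ominus>\<^bsub>?F\<^esub> y \<in> K" by blast
    then have "(x \<ominus>\<^bsub>?F\<^esub> y) \<oplus>\<^bsub>?F\<^esub> y \<in> K" using F.submoduleE(5)[OF K(1)] y by blast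
    then show "x \<in> K" using F.minus_add_cancel[OF xF] by simp
  qed
  then show ?case using S U N'_def by (intro exI[of _ "S \<union> U"]) auto
qed

lemma ex_inj_on_infinite:
  assumes "finite A" "infinite (UNIV :: 'd set)"
  shows "\<exists>\<kappa> :: 'c \<Rightarrow> 'd. inj_on \<kappa> A"
proof -
  obtain B :: "'d set" where "finite B" "card B = card A"
    using infinite_arbitrarily_large[OF assms(2)] by blast
  then obtain \<kappa> where "bij_betw \<kappa> A B" using finite_same_card_bij[OF assms(1)] by metis
  then show ?thesis by (auto simp: bij_betw_def)
qed

lemma free_submodule_finite_cover:
  fixes A :: "'c set"
  assumes "noetherian_ring R" "finite A" "submodule N R (free_module R A)" "infinite (UNIV :: 'd set)"
  shows "\<exists>(B :: 'd set) d. finite B \<and> d \<in> lin_maps R (free_module R B) (free_module R A) \<and>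
    d ` carrier (free_module R B) = N"
proof -
  interpret F: module R "free_module R A" by (rule module_free)
  obtain S where S: "finite S" "S \<subseteq> N" "\<forall>K. submodule K R (free_module R A) \<longrightarrow> S \<subseteq> K \<longrightarrow> N \<subseteq> K"
    using free_submodule_finite_span[OF assms(1-3)] by blast
  obtain \<kappa> :: "('c \<Rightarrow> 'a) \<Rightarrow> 'd" where \<kappa>: "inj_on \<kappa> S"
    using ex_inj_on_infinite[OF S(1) assms(4)] by blast
  let ?B = "\<kappa> ` S" let ?b = "inv_into S \<kappa>" let ?d = "free_hom (free_module R A) ?B ?b"
  have b: "?b i \<in> N" if "i \<in> ?B" for i using subsetD[OF S(2) inv_into_into[OF that]] .
  then have b': "?b i \<in> carrier (free_module R A)" if "i \<in> ?B" for i
    using that F.submoduleE(1)[OF assms(3)] by blast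
  have d: "?d \<in> lin_maps R (free_module R ?B) (free_module R A)"
    by (rule lin_maps_free_hom[OF module_free _ b']) (simp_all add: S(1))
  have im: "submodule (?d ` carrier (free_module R ?B)) R (free_module R A)"
    by (rule submodule_image[OF module_free module_free d module.carrier_is_submodule[OF module_free]])
  have "S \<subseteq> ?d ` carrier (free_module R ?B)"
  proof
    fix s assume s: "s \<in> S"
    then have "?d (unit_vec R (\<kappa> s)) = s"
      using \<kappa> S(1) by (subst free_hom_unit_vec[OF module_free _ b']) simp_all
    then show "s \<in> ?d ` carrier (free_module R ?B)"
      using unit_vec_closed[of "\<kappa> s" ?B] s by (metis image_eqI)
  qed
  then have "N \<subseteq> ?d ` carrier (free_module R ?B)" using S(3) im by blast
  moreover have "?d x \<in> N" if x: "x \<in> carrier (free_module R ?B)" for x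
  proof -
    have h: "x i \<odot>\<^bsub>free_module R A\<^esub> ?b i \<in> N" if "i \<in> ?B" for i
      using F.submoduleE(4)[OF assms(3)] b[OF that] free_coord_closed[OF x] by blast
    have NF: "N \<subseteq> carrier (free_module R A)" using F.submoduleE(1)[OF assms(3)] .
    have "(\<Oplus>\<^bsub>free_module R A\<^esub>i\<in>T. x i \<odot>\<^bsub>free_module R A\<^esub> ?b i) \<in> N" if "finite T" "T \<subseteq> ?B" for T
      using that
    proof (induction T rule: finite_induct)
      case empty
      then show ?case using submodule_zero[OF assms(3)] by simp
    next
      case (insert t T)
      have "x i \<odot>\<^bsub>free_module R A\<^esub> ?b i \<in> carrier (free_module R A)" if "i \<in> insert t T" for i
        using h NF insert.prems that by blast
      then have "(\<Oplus>\<^bsub>free_module R A\<^esub>i\<in>insert t T. x i \<odot>\<^bsub>free_module R A\<^esub> ?b i) =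
          x t \<odot>\<^bsub>free_module R A\<^esub> ?b t \<oplus>\<^bsub>free_module R A\<^esub>
          (\<Oplus>\<^bsub>free_module R A\<^esub>i\<in>T. x i \<odot>\<^bsub>free_module R A\<^esub> ?b i)"
        using insert(1,2) by (intro F.finsum_insert) auto
      then show ?case
        using F.submoduleE(5)[OF assms(3)] insert.IH insert.prems h by simp
    qed
    then show ?thesis unfolding free_hom_def using S(1) by blast
  qed
  ultimately show ?thesis using d S(1) by blast
qed

end

section \<open>Finite free resolutions of cyclic modules\<close>

locale free_resolution = cring R for R :: "('a, 'r) ring_scheme" (structure) +
  fixes J :: "'a set" and e0 :: 'i and A :: "nat \<Rightarrow> 'i set" and d :: "nat \<Rightarrow> ('i \<Rightarrow> 'a) \<Rightarrow> 'i \<Rightarrow> 'a"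
  assumes J: "ideal J R"
    and A0: "A 0 = {e0}"
    and fin: "\<And>k. finite (A k)"
    and lin: "\<And>k. d k \<in> lin_maps R (free_module R (A (Suc k))) (free_module R (A k))"
    and exact0: "d 0 ` carrier (free_module R (A (Suc 0))) = {x \<in> carrier (free_module R (A 0)). x e0 \<in> J}"
    and exact: "\<And>k. d (Suc k) ` carrier (free_module R (A (Suc (Suc k)))) =
      {x \<in> carrier (free_module R (A (Suc k))). d k x = \<zero>\<^bsub>free_module R (A k)\<^esub>}"

lemma (in cring) ideal_coord_submodule:
  assumes "ideal J R"
  shows "submodule {x \<in> carrier (free_module R A). x e \<in> J} R (free_module R A)"
proof -
  interpret F: module R "free_module R A" by (rule module_free)
  interpret S: module R "self_module R" by (rule self_module_is_module)
  interpret J: ideal J R by fact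
  have neg: "(\<ominus>\<^bsub>free_module R A\<^esub> x) e = \<ominus>\<^bsub>self_module R\<^esub> (x e)" if "x \<in> carrier (free_module R A)" for x
    using lin_maps_uminus[OF module_free self_module_is_module lin_maps_coord that] .
  have sJ: "submodule J R (self_module R)" using assms submodule_self by blast
  show ?thesis
  proof (intro F.submoduleI)
    fix x assume "x \<in> {x \<in> carrier (free_module R A). x e \<in> J}"
    then show "\<ominus>\<^bsub>free_module R A\<^esub> x \<in> {x \<in> carrier (free_module R A). x e \<in> J}"
      using neg S.submoduleE(3)[OF sJ] by simp
  next
    fix a x assume a: "a \<in> carrier R" and x: "x \<in> {x \<in> carrier (free_module R A). x e \<in> J}"
    then have "a \<otimes> x e \<in> J" by (intro J.I_l_closed) auto
    then show "a \<odot>\<^bsub>free_module R A\<^esub> x \<in> {x \<in> carrier (free_module R A). x e \<in> J}"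
      using a x F.smult_closed[of a x] by (simp add: free_module_simps(4))
  next
    fix x y
    assume x: "x \<in> {x \<in> carrier (free_module R A). x e \<in> J}"
      and y: "y \<in> {x \<in> carrier (free_module R A). x e \<in> J}"
    then have "x e \<oplus> y e \<in> J" by simp
    then show "x \<oplus>\<^bsub>free_module R A\<^esub> y \<in> {x \<in> carrier (free_module R A). x e \<in> J}"
      using x y F.a_closed[of x y] by (simp add: free_module_simps(3))
  next
    show "\<zero>\<^bsub>free_module R A\<^esub> \<in> {x \<in> carrier (free_module R A). x e \<in> J}"
      using F.zero_closed by (simp add: free_module_simps(2))
  qed auto
qed

lemma (in cring) ex_free_resolution:
  assumes "noetherian_ring R" "ideal J R" "infinite (UNIV :: 'i set)"
  shows "\<exists>A d. free_resolution R J (e0 :: 'i) A d"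
proof -
  let ?F = "free_module R"
  define P where "P = (\<lambda>(n::nat) (A :: 'i set, B :: 'i set, d). finite A \<and> finite B \<and>
    d \<in> lin_maps R (?F B) (?F A) \<and>
    (n = 0 \<longrightarrow> A = {e0} \<and> d ` carrier (?F B) = {x \<in> carrier (?F A). x e0 \<in> J}))"
  define Q where "Q = (\<lambda>(n::nat) (A :: 'i set, B :: 'i set, d :: ('i \<Rightarrow> 'a) \<Rightarrow> 'i \<Rightarrow> 'a) (A' :: 'i set, B' :: 'i set, d').
    A' = B \<and> d' ` carrier (?F B') = {x \<in> carrier (?F B). d x = \<zero>\<^bsub>?F A\<^esub>})"
  have "\<exists>t. P 0 t"
  proof -
    obtain B :: "'i set" and d where "finite B" "d \<in> lin_maps R (?F B) (?F {e0})"
      "d ` carrier (?F B) = {x \<in> carrier (?F {e0}). x e0 \<in> J}"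
      using free_submodule_finite_cover[OF assms(1) _ ideal_coord_submodule[OF assms(2)] assms(3), of "{e0}" e0]
      by blast
    then show ?thesis by (intro exI[of _ "({e0}, B, d)"]) (simp add: P_def)
  qed
  moreover have "\<exists>u. P (Suc n) u \<and> Q n t u" if "P n t" for n t
  proof -
    obtain A B d where t: "t = (A, B, d)" by (cases t) auto
    have "finite B" and d: "d \<in> lin_maps R (?F B) (?F A)" using that by (auto simp: P_def t)
    then obtain B' :: "'i set" and d' where "finite B'" "d' \<in> lin_maps R (?F B') (?F B)"
      "d' ` carrier (?F B') = {x \<in> carrier (?F B). d x = \<zero>\<^bsub>?F A\<^esub>}"
      using free_submodule_finite_cover[OF assms(1) _ submodule_kernel[OF module_free module_free d] assms(3)]
      by blast
    then show ?thesis using \<open>finite B\<close> by (intro exI[of _ "(B, B', d')"]) (simp add: P_def Q_def t)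
  qed
  ultimately obtain f where f: "\<And>n. P n (f n)" "\<And>n. Q n (f n) (f (Suc n))"
    using dependent_nat_choice[of P Q] by metis
  define A where "A n = fst (f n)" for n
  define d where "d n = snd (snd (f n))" for n
  have B: "f n = (A n, A (Suc n), d n)" for n
    using f(2)[of n] by (auto simp: Q_def A_def d_def split: prod.splits)
  have "free_resolution R J e0 A d"
  proof (intro free_resolution.intro free_resolution_axioms.intro is_cring)
    show "ideal J R" by fact
    show "A 0 = {e0}" using f(1)[of 0] by (simp add: B P_def)
    show "finite (A k)" for k using f(1)[of k] by (simp add: B P_def)
    show "d k \<in> lin_maps R (?F (A (Suc k))) (?F (A k))" for k using f(1)[of k] by (simp add: B P_def)
    show "d 0 ` carrier (?F (A (Suc 0))) = {x \<in> carrier (?F (A 0)). x e0 \<in> J}"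
      using f(1)[of 0] by (simp add: B P_def)
    show "d (Suc k) ` carrier (?F (A (Suc (Suc k)))) = {x \<in> carrier (?F (A (Suc k))). d k x = \<zero>\<^bsub>?F (A k)\<^esub>}" for k
      using f(2)[of k] by (simp add: B Q_def)
  qed
  then show ?thesis by blast
qed

context free_resolution
begin

abbreviation F :: "nat \<Rightarrow> ('a, 'i \<Rightarrow> 'a) module" where
  "F k \<equiv> free_module R (A k)"

definition syz :: "nat \<Rightarrow> ('i \<Rightarrow> 'a) set" where
  "syz k = d k ` carrier (F (Suc k))"

lemma syz_0: "syz 0 = {x \<in> carrier (F 0). x e0 \<in> J}"
  by (simp add: syz_def exact0)

lemma syz_Suc: "syz (Suc k) = {x \<in> carrier (F (Suc k)). d k x = \<zero>\<^bsub>F k\<^esub>}"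
  by (simp add: syz_def exact)

lemma d_closed: "x \<in> carrier (F (Suc k)) \<Longrightarrow> d k x \<in> carrier (F k)"
  using lin_maps_closed[OF lin] .

lemma syz_closed: "x \<in> syz k \<Longrightarrow> x \<in> carrier (F k)"
  unfolding syz_def using d_closed by blast

lemma d_in_syz: "x \<in> carrier (F (Suc k)) \<Longrightarrow> d k x \<in> syz k"
  unfolding syz_def by blast

lemma d_d: "x \<in> carrier (F (Suc (Suc k))) \<Longrightarrow> d k (d (Suc k) x) = \<zero>\<^bsub>F k\<^esub>"
  using d_in_syz[of x "Suc k"] by (simp add: syz_Suc)

lemma syz_submodule: "submodule (syz k) R (F k)"
  unfolding syz_def
  using submodule_image[OF module_free module_free lin module.carrier_is_submodule[OF module_free]] .

text \<open>
  \<open>splits k\<close> says that \<open>syz k\<close> is a direct summand of \<open>F k\<close>, with projection \<open>d k \<circ> h\<close>;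
  \<open>dual_exact k\<close> says that \<open>Ext\<^sup>k\<^sup>+\<^sup>1(R/J, R)\<close>, computed from the resolution, is zero.
\<close>

definition splits :: "nat \<Rightarrow> bool" where
  "splits k \<longleftrightarrow> (\<exists>h \<in> lin_maps R (F k) (F (Suc k)). \<forall>x\<in>syz k. d k (h x) = x)"

definition dual_exact :: "nat \<Rightarrow> bool" where
  "dual_exact k \<longleftrightarrow> (\<forall>f \<in> lin_maps R (F (Suc k)) (self_module R). (\<forall>x\<in>syz (Suc k). f x = \<zero>) \<longrightarrow>
     (\<exists>g \<in> lin_maps R (F k) (self_module R). \<forall>x\<in>carrier (F (Suc k)). f x = g (d k x)))"

lemma eq_of_d_eq:
  assumes "module R N" "f \<in> lin_maps R (F (Suc k)) N" "\<forall>x\<in>syz (Suc k). f x = \<zero>\<^bsub>N\<^esub>"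
    and "x \<in> carrier (F (Suc k))" "y \<in> carrier (F (Suc k))" "d k x = d k y"
  shows "f x = f y"
proof -
  interpret N: module R N by fact
  interpret F: module R "F (Suc k)" by (rule module_free)
  interpret Fk: module R "F k" by (rule module_free)
  have "d k (x \<ominus>\<^bsub>F (Suc k)\<^esub> y) = \<zero>\<^bsub>F k\<^esub>"
    using assms(6) lin_maps_minus[OF module_free module_free lin assms(4,5)]
      Fk.minus_eq_zero_iff[OF d_closed[OF assms(4)] d_closed[OF assms(5)]] by simp
  then have "x \<ominus>\<^bsub>F (Suc k)\<^esub> y \<in> syz (Suc k)" using assms by (simp add: syz_Suc)
  then have "f x \<ominus>\<^bsub>N\<^esub> f y = \<zero>\<^bsub>N\<^esub>"
    using assms(3) lin_maps_minus[OF module_free assms(1,2,4,5)] by simp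
  then show ?thesis
    using N.minus_eq_zero_iff[OF lin_maps_closed[OF assms(2,4)] lin_maps_closed[OF assms(2,5)]] by simp
qed

lemma splits_imp_dual_exact:
  assumes "splits k" shows "dual_exact k"
  unfolding dual_exact_def
proof (intro ballI impI)
  fix f assume f: "f \<in> lin_maps R (F (Suc k)) (self_module R)" "\<forall>x\<in>syz (Suc k). f x = \<zero>"
  obtain h where h: "h \<in> lin_maps R (F k) (F (Suc k))" "\<forall>x\<in>syz k. d k (h x) = x"
    using assms splits_def by blast
  have "f x = f (h (d k x))" if "x \<in> carrier (F (Suc k))" for x
    using that h d_in_syz lin_maps_closed[OF h(1) d_closed[OF that]] f
    by (intro eq_of_d_eq[OF self_module_is_module]) auto
  then show "\<exists>g \<in> lin_maps R (F k) (self_module R). \<forall>x\<in>carrier (F (Suc k)). f x = g (d k x)"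
    by (intro bexI[OF _ lin_maps_comp[OF h(1) f(1)]]) blast
qed

lemma dual_exact_imp_splits:
  assumes "dual_exact k" "splits (Suc k)" shows "splits k"
proof -
  interpret F: module R "F (Suc k)" by (rule module_free)
  interpret Fk: module R "F k" by (rule module_free)
  obtain h where h: "h \<in> lin_maps R (F (Suc k)) (F (Suc (Suc k)))" "\<forall>x\<in>syz (Suc k). d (Suc k) (h x) = x"
    using assms(2) splits_def by blast
  define p where "p x = x \<ominus>\<^bsub>F (Suc k)\<^esub> d (Suc k) (h x)" for x
  have p: "p \<in> lin_maps R (F (Suc k)) (F (Suc k))"
    unfolding p_def
    by (rule lin_maps_minus_map[OF module_free module_free lin_maps_id[OF module_free] lin_maps_comp[OF h(1) lin]])
  have p0: "p x = \<zero>\<^bsub>F (Suc k)\<^esub>" if "x \<in> syz (Suc k)" for x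
    using h(2) that syz_closed[OF that] by (simp add: p_def F.minus_eq_zero_iff)
  have "\<exists>g\<in>lin_maps R (F k) (self_module R). \<forall>x\<in>carrier (F (Suc k)). p x i = g (d k x)" for i
  proof -
    have "(\<lambda>x. p x i) \<in> lin_maps R (F (Suc k)) (self_module R)"
      using lin_maps_comp[OF p lin_maps_coord] .
    moreover have "\<forall>x\<in>syz (Suc k). p x i = \<zero>" using p0 by (simp add: free_module_simps(2))
    ultimately show ?thesis
      using bspec[OF assms(1)[unfolded dual_exact_def], of "\<lambda>x. p x i"] by simp
  qed
  then obtain g where g: "\<And>i. g i \<in> lin_maps R (F k) (self_module R)"
    "\<And>i x. x \<in> carrier (F (Suc k)) \<Longrightarrow> p x i = g i (d k x)" by metis
  define G where "G x = (\<lambda>i. if i \<in> A (Suc k) then g i x else \<zero>)" for x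
  have G: "G \<in> lin_maps R (F k) (F (Suc k))"
    using lin_maps_closed[OF g(1)] lin_maps_add[OF g(1)] lin_maps_smult[OF g(1)]
    by (intro lin_mapsI) (auto simp: G_def free_module_simps(1) free_module_simps(3,4)[of R "A (Suc k)"] fun_eq_iff)
  have "d k (G x) = x" if x: "x \<in> syz k" for x
  proof -
    obtain y where y: "y \<in> carrier (F (Suc k))" "x = d k y" using x by (auto simp: syz_def)
    have "G x i = p y i" for i
      using lin_maps_closed[OF p y(1)] g(2)[OF y(1)]
      by (auto simp: G_def y(2) free_module_simps(1))
    then have "G x = p y" by blast
    have hy: "h y \<in> carrier (F (Suc (Suc k)))" using lin_maps_closed[OF h(1) y(1)] .
    have "d k (p y) = d k y \<ominus>\<^bsub>F k\<^esub> d k (d (Suc k) (h y))"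
      unfolding p_def by (rule lin_maps_minus[OF module_free module_free lin y(1) d_closed[OF hy]])
    also have "\<dots> = d k y" using d_closed[OF y(1)] by (simp add: d_d[OF hy] a_minus_def)
    finally show ?thesis using \<open>G x = p y\<close> y(2) by simp
  qed
  then show ?thesis using G splits_def by blast
qed

definition aug :: "('i \<Rightarrow> 'a) \<Rightarrow> 'a set" where
  "aug x = J +> x e0"

lemma aug_lin: "aug \<in> lin_maps R (F 0) (quot_by_ideal R J)"
  using free_coord_closed[of _ "A 0" e0]
  by (intro lin_mapsI)
    (auto simp: aug_def carrier_quot_by_ideal ideal.add_quot_by_ideal[OF J] ideal.smult_quot_by_ideal[OF J]
      free_module_simps(3,4))

lemma aug_onto: "aug ` carrier (F 0) = carrier (quot_by_ideal R J)"
proof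
  show "aug ` carrier (F 0) \<subseteq> carrier (quot_by_ideal R J)" using lin_maps_closed[OF aug_lin] by blast
  show "carrier (quot_by_ideal R J) \<subseteq> aug ` carrier (F 0)"
  proof
    fix X assume "X \<in> carrier (quot_by_ideal R J)"
    then obtain r where r: "r \<in> carrier R" "X = J +> r" by (auto simp: carrier_quot_by_ideal)
    then have "X = aug (\<lambda>i. if i = e0 then r else \<zero>)" by (simp add: aug_def)
    moreover have "(\<lambda>i. if i = e0 then r else \<zero>) \<in> carrier (F 0)"
      using r by (simp add: free_module_simps(1) A0)
    ultimately show "X \<in> aug ` carrier (F 0)" by blast
  qed
qed

lemma aug_eq_zero_iff: "x \<in> carrier (F 0) \<Longrightarrow> aug x = J \<longleftrightarrow> x \<in> syz 0"
  using ideal.coset_eq_self_iff[OF J free_coord_closed] by (simp add: aug_def syz_0)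

lemma lift_through_d:
  assumes "finite B" "f \<in> lin_maps R (free_module R B) (F k)"
    "\<And>x. x \<in> carrier (free_module R B) \<Longrightarrow> f x \<in> syz k"
  shows "\<exists>h \<in> lin_maps R (free_module R B) (F (Suc k)). \<forall>x\<in>carrier (free_module R B). d k (h x) = f x"
  using assms by (intro free_lift[OF _ module_free module_free lin]) (auto simp: syz_def)

text \<open>
  The invariant \<open>T\<close> is the part of the homotopy between the identity and \<open>v \<circ> u\<close> that only
  concerns cycles. Once \<open>P (k + 1) = 0\<close>, the map \<open>u\<close> vanishes on cycles and \<open>h\<close> is a splitting.
\<close>

lemma splits_of_projective_resolution:
  fixes P :: "nat \<Rightarrow> ('a, 'p) module"
  assumes res: "projective_resolution R (quot_by_ideal R J) \<epsilon> P \<delta>"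
    and z: "\<And>i. i > n \<Longrightarrow> zero_module (P i)"
    and \<sigma>: "\<And>k. \<exists>\<sigma> :: ('i \<Rightarrow> 'a) \<Rightarrow> 'p \<Rightarrow> 'a. inj_on \<sigma> (carrier (F k))"
    and \<tau>: "\<And>k. \<exists>\<tau> :: ('i \<Rightarrow> 'a) \<Rightarrow> 'p. inj_on \<tau> (carrier (F k))"
    and \<rho>: "inj_on (\<rho> :: 'a set \<Rightarrow> 'p) (carrier (quot_by_ideal R J))"
    and k: "k \<ge> n"
  shows "splits k"
proof -
  let ?Q = "quot_by_ideal R J"
  have Q: "module R ?Q" using module_quot[OF is_cring J] .
  have P: "projective_module R (P i)" and \<epsilon>: "\<epsilon> \<in> lin_maps R (P 0) ?Q"
    and \<delta>: "\<delta> i \<in> lin_maps R (P (Suc i)) (P i)" and onto: "\<epsilon> ` carrier (P 0) = carrier ?Q" for i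
    using res unfolding projective_resolution_def by auto
  have mP: "module R (P i)" for i using P projective_module_def by blast
  define Z where "Z k = \<delta> k ` carrier (P (Suc k))" for k
  have Z0: "Z 0 = {x \<in> carrier (P 0). \<epsilon> x = J}"
    using res unfolding projective_resolution_def Z_def by (simp add: a_kernel_eq)
  have ZS: "Z (Suc k) = {x \<in> carrier (P (Suc k)). \<delta> k x = \<zero>\<^bsub>P k\<^esub>}" for k
    using res unfolding projective_resolution_def Z_def by (simp add: a_kernel_eq)
  define T where "T k \<longleftrightarrow> (\<exists>u \<in> lin_maps R (F k) (P k). \<exists>v \<in> lin_maps R (P k) (F k). \<exists>h \<in> lin_maps R (F k) (F (Suc k)).
    (\<forall>x\<in>syz k. u x \<in> Z k) \<and> (\<forall>x\<in>Z k. v x \<in> syz k) \<and> (\<forall>x\<in>syz k. x \<ominus>\<^bsub>F k\<^esub> v (u x) = d k (h x)))" for k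
  have "T k" for k
  proof (induction k)
    case 0
    interpret F0: module R "F 0" by (rule module_free)
    interpret Q: module R ?Q by (rule Q)
    obtain \<sigma>0 :: "('i \<Rightarrow> 'a) \<Rightarrow> 'p \<Rightarrow> 'a" where \<sigma>0: "inj_on \<sigma>0 (carrier (F 0))" using \<sigma> by blast
    obtain u where u: "u \<in> lin_maps R (F 0) (P 0)" "\<forall>x\<in>carrier (F 0). \<epsilon> (u x) = aug x"
      using free_lift[OF fin mP Q \<epsilon> aug_lin] lin_maps_closed[OF aug_lin] onto by blast
    obtain v where v: "v \<in> lin_maps R (P 0) (F 0)" "\<forall>x\<in>carrier (P 0). aug (v x) = \<epsilon> x"
      using projective_lift[OF P module_free Q \<sigma>0 \<rho> aug_lin \<epsilon>] lin_maps_closed[OF \<epsilon>] aug_onto by blast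
    have f: "(\<lambda>x. x \<ominus>\<^bsub>F 0\<^esub> v (u x)) \<in> lin_maps R (F 0) (F 0)"
      by (rule lin_maps_minus_map[OF module_free module_free lin_maps_id[OF module_free] lin_maps_comp[OF u(1) v(1)]])
    have "x \<ominus>\<^bsub>F 0\<^esub> v (u x) \<in> syz 0" if x: "x \<in> carrier (F 0)" for x
    proof -
      have ux: "u x \<in> carrier (P 0)" using lin_maps_closed[OF u(1) x] .
      have vx: "v (u x) \<in> carrier (F 0)" using lin_maps_closed[OF v(1) ux] .
      have "aug (x \<ominus>\<^bsub>F 0\<^esub> v (u x)) = aug x \<ominus>\<^bsub>?Q\<^esub> aug (v (u x))"
        by (rule lin_maps_minus[OF module_free Q aug_lin x vx])
      also have "\<dots> = J"
        using u(2) v(2) x ux Q.minus_eq_zero_iff[of "aug x" "aug x"] lin_maps_closed[OF aug_lin x] by simp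
      finally show ?thesis using aug_eq_zero_iff lin_maps_closed[OF f x] by blast
    qed
    then obtain h where h: "h \<in> lin_maps R (F 0) (F (Suc 0))" "\<forall>x\<in>carrier (F 0). d 0 (h x) = x \<ominus>\<^bsub>F 0\<^esub> v (u x)"
      using lift_through_d[OF fin f] by blast
    have "\<forall>x\<in>syz 0. u x \<in> Z 0"
      using u lin_maps_closed[OF u(1)] syz_closed aug_eq_zero_iff by (auto simp: Z0)
    moreover have "\<forall>x\<in>Z 0. v x \<in> syz 0"
      using v lin_maps_closed[OF v(1)] aug_eq_zero_iff by (auto simp: Z0)
    moreover have "\<forall>x\<in>syz 0. x \<ominus>\<^bsub>F 0\<^esub> v (u x) = d 0 (h x)" using h(2) syz_closed by simp
    ultimately show ?case unfolding T_def using u(1) v(1) h(1) by blast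
  next
    case (Suc k)
    interpret Fk: module R "F k" by (rule module_free)
    interpret F1: module R "F (Suc k)" by (rule module_free)
    obtain u v h where u: "u \<in> lin_maps R (F k) (P k)" and v: "v \<in> lin_maps R (P k) (F k)"
      and h: "h \<in> lin_maps R (F k) (F (Suc k))" and uZ: "\<forall>x\<in>syz k. u x \<in> Z k" and vZ: "\<forall>x\<in>Z k. v x \<in> syz k"
      and uvh: "\<forall>x\<in>syz k. x \<ominus>\<^bsub>F k\<^esub> v (u x) = d k (h x)"
      using Suc unfolding T_def by blast
    obtain \<sigma>1 :: "('i \<Rightarrow> 'a) \<Rightarrow> 'p \<Rightarrow> 'a" where \<sigma>1: "inj_on \<sigma>1 (carrier (F (Suc k)))" using \<sigma> by blast
    obtain \<tau>k :: "('i \<Rightarrow> 'a) \<Rightarrow> 'p" where \<tau>k: "inj_on \<tau>k (carrier (F k))" using \<tau> by blast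
    obtain u' where u': "u' \<in> lin_maps R (F (Suc k)) (P (Suc k))" "\<forall>x\<in>carrier (F (Suc k)). \<delta> k (u' x) = u (d k x)"
      using free_lift[OF fin mP mP \<delta> lin_maps_comp[OF lin u]] uZ d_in_syz unfolding Z_def by blast
    have \<delta>Z: "\<delta> k x \<in> Z k" if "x \<in> carrier (P (Suc k))" for x using that by (auto simp: Z_def)
    obtain v' where v': "v' \<in> lin_maps R (P (Suc k)) (F (Suc k))" "\<forall>x\<in>carrier (P (Suc k)). d k (v' x) = v (\<delta> k x)"
      using projective_lift[OF P module_free module_free \<sigma>1 \<tau>k lin lin_maps_comp[OF \<delta> v]] vZ \<delta>Z
      unfolding syz_def by blast
    let ?w = "\<lambda>x. x \<ominus>\<^bsub>F (Suc k)\<^esub> v' (u' x)"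
    have w: "?w \<in> lin_maps R (F (Suc k)) (F (Suc k))"
      by (rule lin_maps_minus_map[OF module_free module_free lin_maps_id[OF module_free] lin_maps_comp[OF u'(1) v'(1)]])
    let ?f = "\<lambda>x. ?w x \<ominus>\<^bsub>F (Suc k)\<^esub> h (d k x)"
    have f: "?f \<in> lin_maps R (F (Suc k)) (F (Suc k))"
      by (rule lin_maps_minus_map[OF module_free module_free w lin_maps_comp[OF lin h]])
    have "?f x \<in> syz (Suc k)" if x: "x \<in> carrier (F (Suc k))" for x
    proof -
      have dx: "d k x \<in> carrier (F k)" "d k x \<in> syz k" using d_closed d_in_syz x by auto
      have ux: "u' x \<in> carrier (P (Suc k))" using lin_maps_closed[OF u'(1) x] .
      have vx: "v' (u' x) \<in> carrier (F (Suc k))" using lin_maps_closed[OF v'(1) ux] .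
      have hx: "h (d k x) \<in> carrier (F (Suc k))" using lin_maps_closed[OF h dx(1)] .
      have "d k (?f x) = d k (?w x) \<ominus>\<^bsub>F k\<^esub> d k (h (d k x))"
        by (rule lin_maps_minus[OF module_free module_free lin lin_maps_closed[OF w x] hx])
      also have "d k (?w x) = d k x \<ominus>\<^bsub>F k\<^esub> d k (v' (u' x))"
        by (rule lin_maps_minus[OF module_free module_free lin x vx])
      also have "d k (v' (u' x)) = v (u (d k x))" using v'(2) u'(2) ux x by simp
      also have "d k x \<ominus>\<^bsub>F k\<^esub> v (u (d k x)) = d k (h (d k x))" using uvh dx(2) by blast
      also have "d k (h (d k x)) \<ominus>\<^bsub>F k\<^esub> d k (h (d k x)) = \<zero>\<^bsub>F k\<^esub>"
        using d_closed[OF hx] Fk.minus_eq_zero_iff by blast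
      finally show ?thesis using lin_maps_closed[OF f x] by (simp add: syz_Suc)
    qed
    then obtain h' where h': "h' \<in> lin_maps R (F (Suc k)) (F (Suc (Suc k)))"
      "\<forall>x\<in>carrier (F (Suc k)). d (Suc k) (h' x) = ?f x"
      using lift_through_d[OF fin f] by blast
    have "\<forall>x\<in>syz (Suc k). u' x \<in> Z (Suc k)"
      using u' lin_maps_closed[OF u'(1)] lin_maps_zero[OF module_free mP u] by (simp add: ZS syz_Suc)
    moreover have "\<forall>x\<in>Z (Suc k). v' x \<in> syz (Suc k)"
      using v' lin_maps_closed[OF v'(1)] lin_maps_zero[OF mP module_free v] by (simp add: ZS syz_Suc)
    moreover have "?w x = d (Suc k) (h' x)" if x: "x \<in> syz (Suc k)" for x
    proof -
      have xF: "x \<in> carrier (F (Suc k))" and "d k x = \<zero>\<^bsub>F k\<^esub>" using x by (simp_all add: syz_Suc)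
      then have "d (Suc k) (h' x) = ?w x \<ominus>\<^bsub>F (Suc k)\<^esub> \<zero>\<^bsub>F (Suc k)\<^esub>"
        using h'(2) lin_maps_zero[OF module_free module_free h] by simp
      then show ?thesis using lin_maps_closed[OF w xF] by (simp add: a_minus_def)
    qed
    ultimately show ?case unfolding T_def using u'(1) v'(1) h'(1) by blast
  qed
  then obtain u v h where u: "u \<in> lin_maps R (F k) (P k)" and v: "v \<in> lin_maps R (P k) (F k)"
    and h: "h \<in> lin_maps R (F k) (F (Suc k))" and uZ: "\<forall>x\<in>syz k. u x \<in> Z k"
    and uvh: "\<forall>x\<in>syz k. x \<ominus>\<^bsub>F k\<^esub> v (u x) = d k (h x)"
    unfolding T_def by blast
  interpret Fk: module R "F k" by (rule module_free)
  have "carrier (P (Suc k)) = {\<zero>\<^bsub>P (Suc k)\<^esub>}" using z[of "Suc k"] k by (simp add: zero_module_def)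
  then have Zk: "Z k = {\<zero>\<^bsub>P k\<^esub>}" using lin_maps_zero[OF mP mP \<delta>] by (simp add: Z_def)
  then have "d k (h x) = x" if x: "x \<in> syz k" for x
  proof -
    have "v (u x) = \<zero>\<^bsub>F k\<^esub>"
      using uZ x Zk lin_maps_zero[OF mP module_free v] by auto
    then show ?thesis using bspec[OF uvh x] syz_closed[OF x] by simp
  qed
  then show ?thesis using h splits_def by blast
qed

lemma projective_resolution_of_splits:
  assumes "splits c"
  shows "\<exists>\<epsilon> (P :: nat \<Rightarrow> ('a, 'i \<Rightarrow> 'a) module) \<delta>.
    projective_resolution R (quot_by_ideal R J) \<epsilon> P \<delta> \<and> (\<forall>i>c. zero_module (P i))"
proof -
  let ?Q = "quot_by_ideal R J"
  have Q: "module R ?Q" using module_quot[OF is_cring J] .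
  interpret Fc: module R "F c" by (rule module_free)
  obtain h where h: "h \<in> lin_maps R (F c) (F (Suc c))" "\<forall>x\<in>syz c. d c (h x) = x"
    using assms splits_def by blast
  have dh: "(\<lambda>x. d c (h x)) \<in> lin_maps R (F c) (F c)" by (rule lin_maps_comp[OF h(1) lin])
  define N where "N = {x \<in> carrier (F c). d c (h x) = \<zero>\<^bsub>F c\<^esub>}"
  have N: "submodule N R (F c)" unfolding N_def by (rule submodule_kernel[OF module_free module_free dh])
  define p where "p x = x \<ominus>\<^bsub>F c\<^esub> d c (h x)" for x
  have p: "p \<in> lin_maps R (F c) (F c)"
    unfolding p_def by (rule lin_maps_minus_map[OF module_free module_free lin_maps_id[OF module_free] dh])
  have dhs: "d c (h x) \<in> syz c" if "x \<in> carrier (F c)" for x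
    using d_in_syz[OF lin_maps_closed[OF h(1) that]] .
  have pN: "p x \<in> N" if x: "x \<in> carrier (F c)" for x
  proof -
    have "d c (h (p x)) = d c (h x) \<ominus>\<^bsub>F c\<^esub> d c (h (d c (h x)))"
      unfolding p_def
      using lin_maps_minus[OF module_free module_free dh x lin_maps_closed[OF dh x]] .
    also have "\<dots> = \<zero>\<^bsub>F c\<^esub>"
      using h(2) dhs[OF x] lin_maps_closed[OF dh x] Fc.minus_eq_zero_iff by simp
    finally show ?thesis using lin_maps_closed[OF p x] by (simp add: N_def)
  qed
  have p_id: "p x = x" if "x \<in> N" for x
    using that by (simp add: N_def p_def a_minus_def)
  define P where "P i = (if i < c then F i else if i = c then (F c)\<lparr>carrier := N\<rparr> else free_module R {})" for i
  define \<delta> where "\<delta> i = (if i < c then d i else (\<lambda>_. \<lambda>_. \<zero>))" for i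
  have zero_P: "zero (P i) = (\<lambda>_. \<zero>)" for i by (simp add: P_def free_module_simps)
  have carrier_P: "carrier (P i) = (if i < c then carrier (F i) else if i = c then N else {\<lambda>_. \<zero>})" for i
    by (auto simp: P_def free_module_simps(1))
  have P_sub: "carrier (P i) \<subseteq> carrier (F i)" for i
    by (auto simp: carrier_P N_def free_module_simps(1))
  have mP: "module R (P i)" for i
    by (simp add: P_def module_free module_submodule[OF module_free N])
  have P_ops: "add (P i) = (\<lambda>x y k. x k \<oplus> y k)" "smult (P i) = (\<lambda>a x k. a \<otimes> x k)" for i
    by (simp_all add: P_def free_module_simps)
  have lin_sub: "f \<in> lin_maps R (P i) M" if "f \<in> lin_maps R (F i) M" for f i and M :: "('a, 'm, 'n) module_scheme"
    using that P_sub[of i] by (auto simp: lin_maps_def P_ops free_module_simps(3,4) Pi_iff subset_iff)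
  have \<delta>: "\<delta> i \<in> lin_maps R (P (Suc i)) (P i)" for i
  proof (cases "i < c")
    case True
    then have "P i = F i" by (simp add: P_def)
    then show ?thesis using True lin_sub[OF lin] by (simp add: \<delta>_def)
  next
    case False
    then show ?thesis
      using lin_maps_zero_map[OF mP, of i "P (Suc i)"] by (simp add: \<delta>_def zero_P)
  qed
  have proj: "projective_module R (P i)" for i
  proof -
    consider "i < c" | "i = c" | "i > c" by linarith
    then show ?thesis
    proof cases
      case 1
      have "projective_module R (F i)"
        by (rule projective_retract[OF fin module_free lin_maps_id lin_maps_id]) (simp_all add: module_free)
      then show ?thesis using 1 by (simp add: P_def)
    next
      case 2
      have "projective_module R ((F c)\<lparr>carrier := N\<rparr>)"
      proof (rule projective_retract[OF fin module_submodule[OF module_free N]])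
        show "(\<lambda>x. x) \<in> lin_maps R ((F c)\<lparr>carrier := N\<rparr>) (F c)"
          by (auto simp: lin_maps_def N_def)
        show "p \<in> lin_maps R (F c) ((F c)\<lparr>carrier := N\<rparr>)"
          using p pN by (auto simp: lin_maps_def)
      qed (simp add: p_id)
      then show ?thesis using 2 by (simp add: P_def)
    next
      case 3
      have "projective_module R (free_module R ({} :: 'i set))"
        by (rule projective_retract[OF finite.emptyI module_free lin_maps_id lin_maps_id]) (simp_all add: module_free)
      then show ?thesis using 3 by (simp add: P_def)
    qed
  qed
  have z_syz: "(\<lambda>_. \<zero>) \<in> syz k" for k
    using submodule_zero[OF syz_submodule[of k]] by (simp add: free_module_simps)
  define W where "W k = {x \<in> carrier (P k). x \<in> syz k}" for k
  have image: "\<delta> k ` carrier (P (Suc k)) = W k" for k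
  proof -
    consider "Suc k < c" | "Suc k = c" | "k = c" | "k > c" by linarith
    then show ?thesis
    proof cases
      case 1
      then show ?thesis using syz_closed by (auto simp: \<delta>_def W_def carrier_P syz_def)
    next
      case 2
      have "d k ` N = syz k"
      proof
        show "d k ` N \<subseteq> syz k" using 2 d_in_syz by (auto simp: N_def)
        show "syz k \<subseteq> d k ` N"
        proof
          fix x assume "x \<in> syz k"
          then obtain y where y: "y \<in> carrier (F c)" "x = d k y" unfolding syz_def 2 by blast
          interpret Fk: module R "F k" by (rule module_free)
          have l: "d k \<in> lin_maps R (F c) (F k)" using lin[of k] 2 by simp
          have "d k (d c (h y)) = \<zero>\<^bsub>F k\<^esub>" using dhs[OF y(1)] 2 by (auto simp: syz_Suc)
          then have "d k (p y) = x \<ominus>\<^bsub>F k\<^esub> \<zero>\<^bsub>F k\<^esub>"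
            using lin_maps_minus[OF module_free module_free l y(1) lin_maps_closed[OF dh y(1)]] y(2)
            by (simp add: p_def)
          then have "d k (p y) = x" using lin_maps_closed[OF l y(1)] y(2) by (simp add: a_minus_def)
          then show "x \<in> d k ` N" using pN[OF y(1)] by blast
        qed
      qed
      then show ?thesis using 2 syz_closed by (auto simp: \<delta>_def W_def carrier_P)
    next
      case 3
      have "W k = {\<lambda>_. \<zero>}"
      proof -
        have "x = (\<lambda>_. \<zero>)" if "x \<in> N" "x \<in> syz c" for x
          using that h(2) by (simp add: N_def free_module_simps(2))
        moreover have "(\<lambda>_. \<zero>) \<in> N"
          using submodule_zero[OF N] by (simp add: free_module_simps)
        ultimately have "{x \<in> N. x \<in> syz c} = {\<lambda>_. \<zero>}" using z_syz[of c] by blast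
        then show ?thesis using 3 by (simp add: W_def carrier_P)
      qed
      then show ?thesis using 3 by (simp add: \<delta>_def carrier_P)
    next
      case 4
      then show ?thesis using z_syz by (auto simp: \<delta>_def carrier_P W_def)
    qed
  qed
  have kernel: "a_kernel (P (Suc k)) (P k) (\<delta> k) = W (Suc k)" for k
  proof (cases "k < c")
    case True
    then show ?thesis using P_sub[of "Suc k"]
      by (auto simp: a_kernel_eq W_def \<delta>_def syz_Suc zero_P free_module_simps(2))
  next
    case False
    then show ?thesis using z_syz by (auto simp: a_kernel_eq W_def \<delta>_def carrier_P zero_P)
  qed
  have kernel0: "a_kernel (P 0) ?Q aug = W 0"
    using P_sub[of 0] aug_eq_zero_iff by (auto simp: a_kernel_eq W_def)
  have onto: "aug ` carrier (P 0) = carrier ?Q"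
  proof (cases "c = 0")
    case False
    then show ?thesis using aug_onto by (simp add: carrier_P)
  next
    case True
    interpret Q: module R ?Q by (rule Q)
    have "aug (p x) = aug x" if x: "x \<in> carrier (F 0)" for x
    proof -
      have x': "x \<in> carrier (F c)" using x True by simp
      have ac: "aug \<in> lin_maps R (F c) ?Q" using aug_lin True by simp
      have "aug (p x) = aug x \<ominus>\<^bsub>?Q\<^esub> aug (d c (h x))"
        unfolding p_def by (rule lin_maps_minus[OF module_free Q ac x' lin_maps_closed[OF dh x']])
      also have "aug (d c (h x)) = \<zero>\<^bsub>?Q\<^esub>"
        using aug_eq_zero_iff dhs[OF x'] syz_closed True by simp
      also have "aug x \<ominus>\<^bsub>?Q\<^esub> \<zero>\<^bsub>?Q\<^esub> = aug x"
        using lin_maps_closed[OF aug_lin x] by (rule Q.minus_zero_right)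
      finally show ?thesis .
    qed
    then have "aug x \<in> aug ` N" if "x \<in> carrier (F 0)" for x
      using that imageI[OF pN[of x], of aug] True by simp
    then have "carrier ?Q \<subseteq> aug ` N" unfolding aug_onto[symmetric] by (rule image_subsetI)
    then show ?thesis using True lin_maps_closed[OF aug_lin] by (auto simp: carrier_P N_def)
  qed
  have "projective_resolution R ?Q aug P \<delta>"
    unfolding projective_resolution_def
    using proj lin_sub[OF aug_lin] \<delta> onto image kernel kernel0 by simp
  moreover have "\<forall>i>c. zero_module (P i)" by (simp add: zero_module_def carrier_P zero_P)
  ultimately show ?thesis by blast
qed

end

section \<open>Ext of cyclic modules\<close>

text \<open>
  A map from \<open>R/J\<close> to \<open>E\<close> is determined by its value at the class of one, an element of
  \<open>E\<close> annihilated by \<open>J\<close>. Hence \<open>Ext\<^sup>i(R/J, R)\<close> is the cohomology of the subcomplex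
  \<open>ann i J\<close> of an injective resolution of \<open>R\<close>.
\<close>

locale injective_res = cring R for R :: "('a, 'r) ring_scheme" (structure) +
  fixes \<epsilon> :: "'a \<Rightarrow> 'e" and E :: "nat \<Rightarrow> ('a, 'e) module" and \<delta> :: "nat \<Rightarrow> 'e \<Rightarrow> 'e"
  assumes res: "injective_resolution R (self_module R) \<epsilon> E \<delta>"
begin

lemma inj_E: "injective_module R (E i)"
  using res unfolding injective_resolution_def by blast

lemma mod_E: "module R (E i)"
  using inj_E unfolding injective_module_def by blast

lemma lin_\<epsilon>: "\<epsilon> \<in> lin_maps R (self_module R) (E 0)"
  using res unfolding injective_resolution_def by blast

lemma lin_\<delta>: "\<delta> i \<in> lin_maps R (E i) (E (Suc i))"
  using res unfolding injective_resolution_def by blast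

lemma \<epsilon>_inj: "inj_on \<epsilon> (carrier R)"
  using res unfolding injective_resolution_def by simp

lemma \<epsilon>_image: "\<epsilon> ` carrier R = {x \<in> carrier (E 0). \<delta> 0 x = \<zero>\<^bsub>E (Suc 0)\<^esub>}"
  using res unfolding injective_resolution_def by (simp add: a_kernel_eq)

lemma \<delta>_image: "\<delta> i ` carrier (E i) = {x \<in> carrier (E (Suc i)). \<delta> (Suc i) x = \<zero>\<^bsub>E (Suc (Suc i))\<^esub>}"
  using res unfolding injective_resolution_def by (simp add: a_kernel_eq)

lemma \<delta>_closed: "x \<in> carrier (E i) \<Longrightarrow> \<delta> i x \<in> carrier (E (Suc i))"
  using lin_maps_closed[OF lin_\<delta>] .

lemma \<delta>_\<delta>: "x \<in> carrier (E i) \<Longrightarrow> \<delta> (Suc i) (\<delta> i x) = \<zero>\<^bsub>E (Suc (Suc i))\<^esub>"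
  using \<delta>_image by blast

lemma \<delta>_\<epsilon>: "r \<in> carrier R \<Longrightarrow> \<delta> 0 (\<epsilon> r) = \<zero>\<^bsub>E (Suc 0)\<^esub>"
  using \<epsilon>_image by blast

lemma \<delta>_zero: "\<delta> i \<zero>\<^bsub>E i\<^esub> = \<zero>\<^bsub>E (Suc i)\<^esub>"
  by (rule lin_maps_zero[OF mod_E mod_E lin_\<delta>])

lemma \<delta>_minus: "x \<in> carrier (E i) \<Longrightarrow> y \<in> carrier (E i) \<Longrightarrow> \<delta> i (x \<ominus>\<^bsub>E i\<^esub> y) = \<delta> i x \<ominus>\<^bsub>E (Suc i)\<^esub> \<delta> i y"
  by (rule lin_maps_minus[OF mod_E mod_E lin_\<delta>])

lemma \<delta>_add: "x \<in> carrier (E i) \<Longrightarrow> y \<in> carrier (E i) \<Longrightarrow> \<delta> i (x \<oplus>\<^bsub>E i\<^esub> y) = \<delta> i x \<oplus>\<^bsub>E (Suc i)\<^esub> \<delta> i y"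
  by (rule lin_maps_add[OF lin_\<delta>])

lemma \<delta>_smult: "a \<in> carrier R \<Longrightarrow> x \<in> carrier (E i) \<Longrightarrow> \<delta> i (a \<odot>\<^bsub>E i\<^esub> x) = a \<odot>\<^bsub>E (Suc i)\<^esub> \<delta> i x"
  by (rule lin_maps_smult[OF lin_\<delta>])

definition ann :: "nat \<Rightarrow> 'a set \<Rightarrow> 'e set" where
  "ann i J = {x \<in> carrier (E i). \<forall>a\<in>J. a \<odot>\<^bsub>E i\<^esub> x = \<zero>\<^bsub>E i\<^esub>}"

definition cocycles :: "nat \<Rightarrow> 'a set \<Rightarrow> 'e set" where
  "cocycles i J = {x \<in> ann i J. \<delta> i x = \<zero>\<^bsub>E (Suc i)\<^esub>}"

definition cobounds :: "nat \<Rightarrow> 'a set \<Rightarrow> 'e set" where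
  "cobounds i J = (case i of 0 \<Rightarrow> {\<zero>\<^bsub>E 0\<^esub>} | Suc k \<Rightarrow> \<delta> k ` ann k J)"

definition ext_vanishes :: "nat \<Rightarrow> 'a set \<Rightarrow> bool" where
  "ext_vanishes i J \<longleftrightarrow> cocycles i J \<subseteq> cobounds i J"

lemma ann_closed: "x \<in> ann i J \<Longrightarrow> x \<in> carrier (E i)"
  by (simp add: ann_def)

end

locale injective_free_res = free_resolution R J e0 A d + injective_res R \<epsilon> E \<delta>
  for R :: "('a, 'r) ring_scheme" (structure) and J and e0 :: 'i and A d
    and \<epsilon> :: "'a \<Rightarrow> 'e" and E \<delta> +
  assumes emb: "\<And>k. \<exists>\<sigma> :: ('i \<Rightarrow> 'a) \<Rightarrow> 'a + 'e. inj_on \<sigma> (carrier (free_module R (A k)))"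
begin

lemma factor_through_d:
  assumes f: "f \<in> lin_maps R (F (Suc k)) (E i)" and f0: "\<forall>x\<in>syz (Suc k). f x = \<zero>\<^bsub>E i\<^esub>"
  shows "\<exists>g \<in> lin_maps R (F k) (E i). \<forall>x\<in>carrier (F (Suc k)). f x = g (d k x)"
proof -
  interpret F: module R "F (Suc k)" by (rule module_free)
  let ?S = "(F k)\<lparr>carrier := syz k\<rparr>"
  define s where "s y = (SOME x. x \<in> carrier (F (Suc k)) \<and> d k x = y)" for y
  have s: "s y \<in> carrier (F (Suc k))" "d k (s y) = y" if "y \<in> syz k" for y
  proof -
    have "\<exists>x. x \<in> carrier (F (Suc k)) \<and> d k x = y" using that by (auto simp: syz_def)
    then have "s y \<in> carrier (F (Suc k)) \<and> d k (s y) = y" unfolding s_def by (rule someI_ex)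
    then show "s y \<in> carrier (F (Suc k))" "d k (s y) = y" by auto
  qed
  have fs: "f (s y) = f x" if "x \<in> carrier (F (Suc k))" "d k x = y" for x y
    using that s[of y] d_in_syz[OF that(1)] by (intro eq_of_d_eq[OF mod_E f f0]) auto
  note sub = module.submoduleE[OF module_free syz_submodule[of k]]
  have "(\<lambda>y. f (s y)) \<in> lin_maps R ?S (E i)"
  proof (rule lin_mapsI)
    fix y assume "y \<in> carrier ?S"
    then show "f (s y) \<in> carrier (E i)" using s lin_maps_closed[OF f] by simp
  next
    fix y z assume "y \<in> carrier ?S" "z \<in> carrier ?S"
    then have yz: "y \<in> syz k" "z \<in> syz k" by simp_all
    have "d k (s y \<oplus>\<^bsub>F (Suc k)\<^esub> s z) = y \<oplus>\<^bsub>F k\<^esub> z"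
      using lin_maps_add[OF lin s(1)[OF yz(1)] s(1)[OF yz(2)]] s(2)[OF yz(1)] s(2)[OF yz(2)] by simp
    then have "f (s (y \<oplus>\<^bsub>F k\<^esub> z)) = f (s y \<oplus>\<^bsub>F (Suc k)\<^esub> s z)"
      using s(1)[OF yz(1)] s(1)[OF yz(2)] by (intro fs) simp_all
    then show "f (s (y \<oplus>\<^bsub>?S\<^esub> z)) = f (s y) \<oplus>\<^bsub>E i\<^esub> f (s z)"
      using lin_maps_add[OF f s(1)[OF yz(1)] s(1)[OF yz(2)]] by simp
  next
    fix a y assume a: "a \<in> carrier R" and "y \<in> carrier ?S"
    then have y: "y \<in> syz k" by simp
    have "d k (a \<odot>\<^bsub>F (Suc k)\<^esub> s y) = a \<odot>\<^bsub>F k\<^esub> y"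
      using lin_maps_smult[OF lin a s(1)[OF y]] s(2)[OF y] by simp
    then have "f (s (a \<odot>\<^bsub>F k\<^esub> y)) = f (a \<odot>\<^bsub>F (Suc k)\<^esub> s y)"
      using s(1)[OF y] a by (intro fs) simp_all
    then show "f (s (a \<odot>\<^bsub>?S\<^esub> y)) = a \<odot>\<^bsub>E i\<^esub> f (s y)"
      using lin_maps_smult[OF f a s(1)[OF y]] by simp
  qed
  moreover obtain \<sigma> :: "('i \<Rightarrow> 'a) \<Rightarrow> 'a + 'e" where \<sigma>: "inj_on \<sigma> (carrier (F k))" using emb by blast
  ultimately obtain g where g: "g \<in> lin_maps R (F k) (E i)" "\<forall>y\<in>syz k. g y = f (s y)"
    using injective_extend[OF inj_E module_free \<sigma> syz_submodule] by blast
  have "f x = g (d k x)" if "x \<in> carrier (F (Suc k))" for x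
    using g(2) fs[OF that refl] d_in_syz[OF that] by simp
  then show ?thesis using g(1) by blast
qed

lemma lift_through_\<delta>:
  assumes "f \<in> lin_maps R (F k) (E (Suc i))" "\<And>x. x \<in> carrier (F k) \<Longrightarrow> \<delta> (Suc i) (f x) = \<zero>\<^bsub>E (Suc (Suc i))\<^esub>"
  shows "\<exists>g \<in> lin_maps R (F k) (E i). \<forall>x\<in>carrier (F k). \<delta> i (g x) = f x"
  using lin_maps_closed[OF assms(1)] assms(2) \<delta>_image
  by (intro free_lift[OF fin mod_E mod_E lin_\<delta> assms(1)]) simp

lemma lift_through_\<epsilon>:
  assumes "f \<in> lin_maps R (F k) (E 0)" "\<And>x. x \<in> carrier (F k) \<Longrightarrow> \<delta> 0 (f x) = \<zero>\<^bsub>E (Suc 0)\<^esub>"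
  shows "\<exists>g \<in> lin_maps R (F k) (self_module R). \<forall>x\<in>carrier (F k). \<epsilon> (g x) = f x"
  using lin_maps_closed[OF assms(1)] assms(2) \<epsilon>_image
  by (intro free_lift[OF fin self_module_is_module mod_E lin_\<epsilon> assms(1)]) simp

text \<open>The vanishing of \<open>Ext\<^sup>i\<^sup>+\<^sup>1\<close> of the image of \<open>d (k - 1)\<close>, or of \<open>R/J\<close> if \<open>k = 0\<close>.\<close>

definition shifted :: "nat \<Rightarrow> nat \<Rightarrow> bool" where
  "shifted k i \<longleftrightarrow> (\<forall>f \<in> lin_maps R (F k) (E (Suc i)).
     (\<forall>x\<in>syz k. f x = \<zero>\<^bsub>E (Suc i)\<^esub>) \<longrightarrow> (\<forall>x\<in>carrier (F k). \<delta> (Suc i) (f x) = \<zero>\<^bsub>E (Suc (Suc i))\<^esub>) \<longrightarrow>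
     (\<exists>g \<in> lin_maps R (F k) (E i). (\<forall>x\<in>syz k. g x = \<zero>\<^bsub>E i\<^esub>) \<and> (\<forall>x\<in>carrier (F k). \<delta> i (g x) = f x)))"

lemma shiftedD:
  assumes "shifted k i" "f \<in> lin_maps R (F k) (E (Suc i))" "\<And>x. x \<in> syz k \<Longrightarrow> f x = \<zero>\<^bsub>E (Suc i)\<^esub>"
    "\<And>x. x \<in> carrier (F k) \<Longrightarrow> \<delta> (Suc i) (f x) = \<zero>\<^bsub>E (Suc (Suc i))\<^esub>"
  obtains g where "g \<in> lin_maps R (F k) (E i)" "\<And>x. x \<in> syz k \<Longrightarrow> g x = \<zero>\<^bsub>E i\<^esub>"
    "\<And>x. x \<in> carrier (F k) \<Longrightarrow> \<delta> i (g x) = f x"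
  using assms unfolding shifted_def by blast

lemma shifted_down:
  assumes "shifted (Suc k) i" shows "shifted k (Suc i)"
  unfolding shifted_def
proof (intro ballI impI)
  fix f assume f: "f \<in> lin_maps R (F k) (E (Suc (Suc i)))" "\<forall>x\<in>syz k. f x = \<zero>\<^bsub>E (Suc (Suc i))\<^esub>"
    "\<forall>x\<in>carrier (F k). \<delta> (Suc (Suc i)) (f x) = \<zero>\<^bsub>E (Suc (Suc (Suc i)))\<^esub>"
  interpret E: module R "E (Suc i)" by (rule mod_E)
  interpret E2: module R "E (Suc (Suc i))" by (rule mod_E)
  obtain g where g: "g \<in> lin_maps R (F k) (E (Suc i))" "\<forall>x\<in>carrier (F k). \<delta> (Suc i) (g x) = f x"
    using lift_through_\<delta>[OF f(1)] f(3) by blast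
  have g0: "g \<zero>\<^bsub>F k\<^esub> = \<zero>\<^bsub>E (Suc i)\<^esub>" by (rule lin_maps_zero[OF module_free mod_E g(1)])
  obtain h where h: "h \<in> lin_maps R (F (Suc k)) (E i)" "\<And>x. x \<in> syz (Suc k) \<Longrightarrow> h x = \<zero>\<^bsub>E i\<^esub>"
    "\<And>x. x \<in> carrier (F (Suc k)) \<Longrightarrow> \<delta> i (h x) = g (d k x)"
  proof (rule shiftedD[OF assms lin_maps_comp[OF lin g(1)]])
    show "g (d k x) = \<zero>\<^bsub>E (Suc i)\<^esub>" if "x \<in> syz (Suc k)" for x
      using that g0 by (simp add: syz_Suc)
    show "\<delta> (Suc i) (g (d k x)) = \<zero>\<^bsub>E (Suc (Suc i))\<^esub>" if "x \<in> carrier (F (Suc k))" for x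
      using g(2) f(2) d_closed[OF that] d_in_syz[OF that] by simp
  qed blast
  obtain h' where h': "h' \<in> lin_maps R (F k) (E i)" "\<forall>x\<in>carrier (F (Suc k)). h x = h' (d k x)"
    using factor_through_d[OF h(1)] h(2) by blast
  let ?g = "\<lambda>x. g x \<ominus>\<^bsub>E (Suc i)\<^esub> \<delta> i (h' x)"
  have "?g \<in> lin_maps R (F k) (E (Suc i))"
    by (rule lin_maps_minus_map[OF module_free mod_E g(1) lin_maps_comp[OF h'(1) lin_\<delta>]])
  moreover have "?g x = \<zero>\<^bsub>E (Suc i)\<^esub>" if "x \<in> syz k" for x
  proof -
    obtain y where y: "y \<in> carrier (F (Suc k))" "x = d k y" using \<open>x \<in> syz k\<close> by (auto simp: syz_def)
    then show ?thesis
      using h(3)[OF y(1)] h'(2) lin_maps_closed[OF g(1) d_closed[OF y(1)]] E.minus_eq_zero_iff by simp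
  qed
  moreover have "\<delta> (Suc i) (?g x) = f x" if x: "x \<in> carrier (F k)" for x
    using \<delta>_minus[OF lin_maps_closed[OF g(1) x] \<delta>_closed[OF lin_maps_closed[OF h'(1) x]]]
      \<delta>_\<delta>[OF lin_maps_closed[OF h'(1) x]] g(2) x lin_maps_closed[OF f(1) x] by simp
  ultimately show "\<exists>g \<in> lin_maps R (F k) (E (Suc i)). (\<forall>x\<in>syz k. g x = \<zero>\<^bsub>E (Suc i)\<^esub>) \<and>
      (\<forall>x\<in>carrier (F k). \<delta> (Suc i) (g x) = f x)" by (intro bexI[of _ ?g]) blast+
qed

lemma shifted_up:
  assumes "shifted k (Suc i)" shows "shifted (Suc k) i"
  unfolding shifted_def
proof (intro ballI impI)
  fix f assume f: "f \<in> lin_maps R (F (Suc k)) (E (Suc i))" "\<forall>x\<in>syz (Suc k). f x = \<zero>\<^bsub>E (Suc i)\<^esub>"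
    "\<forall>x\<in>carrier (F (Suc k)). \<delta> (Suc i) (f x) = \<zero>\<^bsub>E (Suc (Suc i))\<^esub>"
  interpret E: module R "E (Suc i)" by (rule mod_E)
  interpret E2: module R "E (Suc (Suc i))" by (rule mod_E)
  obtain f' where f': "f' \<in> lin_maps R (F k) (E (Suc i))" "\<forall>x\<in>carrier (F (Suc k)). f x = f' (d k x)"
    using factor_through_d[OF f(1,2)] by blast
  obtain g where g: "g \<in> lin_maps R (F k) (E (Suc i))" "\<And>x. x \<in> syz k \<Longrightarrow> g x = \<zero>\<^bsub>E (Suc i)\<^esub>"
    "\<And>x. x \<in> carrier (F k) \<Longrightarrow> \<delta> (Suc i) (g x) = \<delta> (Suc i) (f' x)"
  proof (rule shiftedD[OF assms lin_maps_comp[OF f'(1) lin_\<delta>]])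
    show "\<delta> (Suc i) (f' x) = \<zero>\<^bsub>E (Suc (Suc i))\<^esub>" if "x \<in> syz k" for x
    proof -
      obtain y where "y \<in> carrier (F (Suc k))" "x = d k y" using \<open>x \<in> syz k\<close> by (auto simp: syz_def)
      then show ?thesis using f'(2) f(3) by simp
    qed
    show "\<delta> (Suc (Suc i)) (\<delta> (Suc i) (f' x)) = \<zero>\<^bsub>E (Suc (Suc (Suc i)))\<^esub>" if "x \<in> carrier (F k)" for x
      using \<delta>_\<delta>[OF lin_maps_closed[OF f'(1) that]] .
  qed blast
  have fg: "(\<lambda>x. f' x \<ominus>\<^bsub>E (Suc i)\<^esub> g x) \<in> lin_maps R (F k) (E (Suc i))"
    by (rule lin_maps_minus_map[OF module_free mod_E f'(1) g(1)])
  have "\<delta> (Suc i) (f' x \<ominus>\<^bsub>E (Suc i)\<^esub> g x) = \<zero>\<^bsub>E (Suc (Suc i))\<^esub>" if x: "x \<in> carrier (F k)" for x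
    using \<delta>_minus[OF lin_maps_closed[OF f'(1) x] lin_maps_closed[OF g(1) x]] g(3)[OF x]
      \<delta>_closed[OF lin_maps_closed[OF f'(1) x]] E2.minus_eq_zero_iff by simp
  then obtain h where h: "h \<in> lin_maps R (F k) (E i)" "\<forall>x\<in>carrier (F k). \<delta> i (h x) = f' x \<ominus>\<^bsub>E (Suc i)\<^esub> g x"
    using lift_through_\<delta>[OF fg] by blast
  show "\<exists>g \<in> lin_maps R (F (Suc k)) (E i). (\<forall>x\<in>syz (Suc k). g x = \<zero>\<^bsub>E i\<^esub>) \<and>
      (\<forall>x\<in>carrier (F (Suc k)). \<delta> i (g x) = f x)"
  proof (intro bexI[of _ "\<lambda>x. h (d k x)"] conjI ballI)
    show "(\<lambda>x. h (d k x)) \<in> lin_maps R (F (Suc k)) (E i)" by (rule lin_maps_comp[OF lin h(1)])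
    show "h (d k x) = \<zero>\<^bsub>E i\<^esub>" if "x \<in> syz (Suc k)" for x
      using that lin_maps_zero[OF module_free mod_E h(1)] by (simp add: syz_Suc)
    show "\<delta> i (h (d k x)) = f x" if x: "x \<in> carrier (F (Suc k))" for x
      using h(2) d_closed[OF x] f'(2) x g(2)[OF d_in_syz[OF x]] lin_maps_closed[OF f'(1) d_closed[OF x]] by simp
  qed
qed

lemma shifted_0_imp_dual_exact:
  assumes "shifted k 0" shows "dual_exact k"
  unfolding dual_exact_def
proof (intro ballI impI)
  fix f assume f: "f \<in> lin_maps R (F (Suc k)) (self_module R)" "\<forall>x\<in>syz (Suc k). f x = \<zero>"
  interpret E: module R "E 0" by (rule mod_E)
  interpret E1: module R "E (Suc 0)" by (rule mod_E)
  have f_closed: "f x \<in> carrier R" if "x \<in> carrier (F (Suc k))" for x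
    using lin_maps_closed[OF f(1) that] by simp
  have "\<forall>x\<in>syz (Suc k). \<epsilon> (f x) = \<zero>\<^bsub>E 0\<^esub>"
    using f(2) lin_maps_zero[OF self_module_is_module mod_E lin_\<epsilon>] by simp
  then obtain f' where f': "f' \<in> lin_maps R (F k) (E 0)" "\<forall>x\<in>carrier (F (Suc k)). \<epsilon> (f x) = f' (d k x)"
    using factor_through_d[OF lin_maps_comp[OF f(1) lin_\<epsilon>]] by blast
  obtain g where g: "g \<in> lin_maps R (F k) (E 0)" "\<And>x. x \<in> syz k \<Longrightarrow> g x = \<zero>\<^bsub>E 0\<^esub>"
    "\<And>x. x \<in> carrier (F k) \<Longrightarrow> \<delta> 0 (g x) = \<delta> 0 (f' x)"
  proof (rule shiftedD[OF assms lin_maps_comp[OF f'(1) lin_\<delta>]])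
    show "\<delta> 0 (f' x) = \<zero>\<^bsub>E (Suc 0)\<^esub>" if "x \<in> syz k" for x
    proof -
      obtain y where "y \<in> carrier (F (Suc k))" "x = d k y" using \<open>x \<in> syz k\<close> by (auto simp: syz_def)
      then show ?thesis using f'(2) \<delta>_\<epsilon>[OF f_closed] by metis
    qed
    show "\<delta> (Suc 0) (\<delta> 0 (f' x)) = \<zero>\<^bsub>E (Suc (Suc 0))\<^esub>" if "x \<in> carrier (F k)" for x
      using \<delta>_\<delta>[OF lin_maps_closed[OF f'(1) that]] .
  qed blast
  have fg: "(\<lambda>x. f' x \<ominus>\<^bsub>E 0\<^esub> g x) \<in> lin_maps R (F k) (E 0)"
    by (rule lin_maps_minus_map[OF module_free mod_E f'(1) g(1)])
  have "\<delta> 0 (f' x \<ominus>\<^bsub>E 0\<^esub> g x) = \<zero>\<^bsub>E (Suc 0)\<^esub>" if x: "x \<in> carrier (F k)" for x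
    using \<delta>_minus[OF lin_maps_closed[OF f'(1) x] lin_maps_closed[OF g(1) x]] g(3)[OF x]
      \<delta>_closed[OF lin_maps_closed[OF f'(1) x]] E1.minus_eq_zero_iff by simp
  then obtain h where h: "h \<in> lin_maps R (F k) (self_module R)" "\<forall>x\<in>carrier (F k). \<epsilon> (h x) = f' x \<ominus>\<^bsub>E 0\<^esub> g x"
    using lift_through_\<epsilon>[OF fg] by blast
  have "f x = h (d k x)" if x: "x \<in> carrier (F (Suc k))" for x
  proof -
    have "\<epsilon> (h (d k x)) = \<epsilon> (f x)"
      using h(2) d_closed[OF x] f'(2) x g(2)[OF d_in_syz[OF x]] lin_maps_closed[OF f'(1) d_closed[OF x]] by simp
    then show ?thesis
      using inj_onD[OF \<epsilon>_inj] f_closed[OF x] lin_maps_closed[OF h(1) d_closed[OF x]] by simp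
  qed
  then show "\<exists>g \<in> lin_maps R (F k) (self_module R). \<forall>x\<in>carrier (F (Suc k)). f x = g (d k x)"
    using h(1) by blast
qed

lemma dual_exact_imp_shifted_0:
  assumes "dual_exact k" shows "shifted k 0"
  unfolding shifted_def
proof (intro ballI impI)
  fix f assume f: "f \<in> lin_maps R (F k) (E (Suc 0))" "\<forall>x\<in>syz k. f x = \<zero>\<^bsub>E (Suc 0)\<^esub>"
    "\<forall>x\<in>carrier (F k). \<delta> (Suc 0) (f x) = \<zero>\<^bsub>E (Suc (Suc 0))\<^esub>"
  interpret E: module R "E 0" by (rule mod_E)
  interpret E1: module R "E (Suc 0)" by (rule mod_E)
  obtain g where g: "g \<in> lin_maps R (F k) (E 0)" "\<forall>x\<in>carrier (F k). \<delta> 0 (g x) = f x"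
    using lift_through_\<delta>[OF f(1)] f(3) by blast
  have gd: "(\<lambda>x. g (d k x)) \<in> lin_maps R (F (Suc k)) (E 0)" by (rule lin_maps_comp[OF lin g(1)])
  have "\<delta> 0 (g (d k x)) = \<zero>\<^bsub>E (Suc 0)\<^esub>" if "x \<in> carrier (F (Suc k))" for x
    using g(2) f(2) d_closed[OF that] d_in_syz[OF that] by simp
  then obtain p where p: "p \<in> lin_maps R (F (Suc k)) (self_module R)"
    "\<forall>x\<in>carrier (F (Suc k)). \<epsilon> (p x) = g (d k x)"
    using lift_through_\<epsilon>[OF gd] by blast
  have "p x = \<zero>" if x: "x \<in> syz (Suc k)" for x
  proof -
    have "\<epsilon> (p x) = \<epsilon> \<zero>"
      using x p(2) lin_maps_zero[OF module_free mod_E g(1)]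
        lin_maps_zero[OF self_module_is_module mod_E lin_\<epsilon>] by (simp add: syz_Suc)
    then show ?thesis using inj_onD[OF \<epsilon>_inj] lin_maps_closed[OF p(1) syz_closed[OF x]] by simp
  qed
  then obtain q where q: "q \<in> lin_maps R (F k) (self_module R)" "\<forall>x\<in>carrier (F (Suc k)). p x = q (d k x)"
    using assms p(1) unfolding dual_exact_def by blast
  have q_closed: "q x \<in> carrier R" if "x \<in> carrier (F k)" for x
    using lin_maps_closed[OF q(1) that] by simp
  have \<epsilon>_closed: "\<epsilon> r \<in> carrier (E 0)" if "r \<in> carrier R" for r
    using lin_maps_closed[OF lin_\<epsilon>] that by simp
  let ?g = "\<lambda>x. g x \<ominus>\<^bsub>E 0\<^esub> \<epsilon> (q x)"
  have "?g \<in> lin_maps R (F k) (E 0)"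
    by (rule lin_maps_minus_map[OF module_free mod_E g(1) lin_maps_comp[OF q(1) lin_\<epsilon>]])
  moreover have "?g x = \<zero>\<^bsub>E 0\<^esub>" if x: "x \<in> syz k" for x
  proof -
    obtain y where y: "y \<in> carrier (F (Suc k))" "x = d k y" using x by (auto simp: syz_def)
    then have "\<epsilon> (q x) = g x" using p(2) q(2) by simp
    then show ?thesis using lin_maps_closed[OF g(1) syz_closed[OF x]] E.minus_eq_zero_iff by simp
  qed
  moreover have "\<delta> 0 (?g x) = f x" if x: "x \<in> carrier (F k)" for x
    using \<delta>_minus[OF lin_maps_closed[OF g(1) x] \<epsilon>_closed[OF q_closed[OF x]]]
      \<delta>_\<epsilon>[OF q_closed[OF x]] g(2) x lin_maps_closed[OF f(1) x] by simp
  ultimately show "\<exists>g \<in> lin_maps R (F k) (E 0). (\<forall>x\<in>syz k. g x = \<zero>\<^bsub>E 0\<^esub>) \<and>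
      (\<forall>x\<in>carrier (F k). \<delta> 0 (g x) = f x)" by (intro bexI[of _ ?g]) blast+
qed

lemma shifted_iff_dual_exact: "shifted k i \<longleftrightarrow> dual_exact (k + i)"
proof (induction i arbitrary: k)
  case 0 then show ?case using shifted_0_imp_dual_exact dual_exact_imp_shifted_0 by auto
next
  case (Suc i)
  have "shifted k (Suc i) \<longleftrightarrow> shifted (Suc k) i" using shifted_up shifted_down by blast
  then show ?case using Suc[of "Suc k"] by simp
qed

lemma shifted_iff_ext_vanishes: "shifted 0 i \<longleftrightarrow> ext_vanishes (Suc i) J"
proof
  interpret F: module R "F 0" by (rule module_free)
  let ?e = "unit_vec R e0"
  have e: "?e \<in> carrier (F 0)" by (rule unit_vec_closed) (simp add: A0)
  have mult_lin: "(\<lambda>x. x e0 \<odot>\<^bsub>E j\<^esub> z) \<in> lin_maps R (F 0) (E j)" if "z \<in> carrier (E j)" for z j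
  proof -
    interpret E: module R "E j" by (rule mod_E)
    have "(\<lambda>r. r \<odot>\<^bsub>E j\<^esub> z) \<in> lin_maps R (self_module R) (E j)"
      using that by (intro lin_mapsI) (simp_all add: E.smult_l_distr E.smult_assoc1)
    then show ?thesis by (rule lin_maps_comp[OF lin_maps_coord])
  qed
  have expand: "x = x e0 \<odot>\<^bsub>F 0\<^esub> ?e" if "x \<in> carrier (F 0)" for x
    using that by (auto simp: free_module_simps(1,4) unit_vec_def A0 fun_eq_iff)
  {
    assume S: "shifted 0 i"
    show "ext_vanishes (Suc i) J"
      unfolding ext_vanishes_def
    proof
      fix z assume "z \<in> cocycles (Suc i) J"
      then have z: "z \<in> carrier (E (Suc i))" "\<And>a. a \<in> J \<Longrightarrow> a \<odot>\<^bsub>E (Suc i)\<^esub> z = \<zero>\<^bsub>E (Suc i)\<^esub>"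
        "\<delta> (Suc i) z = \<zero>\<^bsub>E (Suc (Suc i))\<^esub>" by (auto simp: cocycles_def ann_def)
      interpret E: module R "E (Suc i)" by (rule mod_E)
      interpret E2: module R "E (Suc (Suc i))" by (rule mod_E)
      obtain g where g: "g \<in> lin_maps R (F 0) (E i)" "\<And>x. x \<in> syz 0 \<Longrightarrow> g x = \<zero>\<^bsub>E i\<^esub>"
        "\<And>x. x \<in> carrier (F 0) \<Longrightarrow> \<delta> i (g x) = x e0 \<odot>\<^bsub>E (Suc i)\<^esub> z"
      proof (rule shiftedD[OF S mult_lin[OF z(1)]])
        show "x e0 \<odot>\<^bsub>E (Suc i)\<^esub> z = \<zero>\<^bsub>E (Suc i)\<^esub>" if "x \<in> syz 0" for x
          using that z(2) by (simp add: syz_0)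
        show "\<delta> (Suc i) (x e0 \<odot>\<^bsub>E (Suc i)\<^esub> z) = \<zero>\<^bsub>E (Suc (Suc i))\<^esub>" if "x \<in> carrier (F 0)" for x
          using \<delta>_smult[OF free_coord_closed[OF that] z(1)] z(3) free_coord_closed[OF that] by simp
      qed blast
      have ge: "g ?e \<in> carrier (E i)" using lin_maps_closed[OF g(1) e] .
      have "a \<odot>\<^bsub>E i\<^esub> g ?e = \<zero>\<^bsub>E i\<^esub>" if a: "a \<in> J" for a
      proof -
        have aR: "a \<in> carrier R" using ideal.Icarr[OF J a] .
        have "a \<odot>\<^bsub>F 0\<^esub> ?e \<in> syz 0"
          using a aR F.smult_closed[OF aR e] by (simp add: syz_0 free_module_simps(4) unit_vec_def)
        then show ?thesis using g(2) lin_maps_smult[OF g(1) aR e] by simp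
      qed
      moreover have "\<delta> i (g ?e) = z" using g(3)[OF e] z(1) by (simp add: unit_vec_def)
      ultimately show "z \<in> cobounds (Suc i) J" using ge by (auto simp: cobounds_def ann_def)
    qed
  }
  assume V: "ext_vanishes (Suc i) J"
  show "shifted 0 i"
    unfolding shifted_def
  proof (intro ballI impI)
    fix f assume f: "f \<in> lin_maps R (F 0) (E (Suc i))" "\<forall>x\<in>syz 0. f x = \<zero>\<^bsub>E (Suc i)\<^esub>"
      "\<forall>x\<in>carrier (F 0). \<delta> (Suc i) (f x) = \<zero>\<^bsub>E (Suc (Suc i))\<^esub>"
    interpret E: module R "E i" by (rule mod_E)
    have "a \<odot>\<^bsub>E (Suc i)\<^esub> f ?e = \<zero>\<^bsub>E (Suc i)\<^esub>" if a: "a \<in> J" for a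
    proof -
      have aR: "a \<in> carrier R" using ideal.Icarr[OF J a] .
      have "a \<odot>\<^bsub>F 0\<^esub> ?e \<in> syz 0"
        using a aR F.smult_closed[OF aR e] by (simp add: syz_0 free_module_simps(4) unit_vec_def)
      then show ?thesis using f(2) lin_maps_smult[OF f(1) aR e] by simp
    qed
    then have "f ?e \<in> cocycles (Suc i) J"
      using f(3) e lin_maps_closed[OF f(1) e] by (simp add: cocycles_def ann_def)
    then obtain w where w: "w \<in> ann i J" "\<delta> i w = f ?e"
      using V by (auto simp: ext_vanishes_def cobounds_def)
    then have wE: "w \<in> carrier (E i)" by (simp add: ann_def)
    show "\<exists>g \<in> lin_maps R (F 0) (E i). (\<forall>x\<in>syz 0. g x = \<zero>\<^bsub>E i\<^esub>) \<and> (\<forall>x\<in>carrier (F 0). \<delta> i (g x) = f x)"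
    proof (intro bexI[OF _ mult_lin[OF wE]] conjI ballI)
      show "x e0 \<odot>\<^bsub>E i\<^esub> w = \<zero>\<^bsub>E i\<^esub>" if "x \<in> syz 0" for x
        using that w(1) by (simp add: syz_0 ann_def)
      show "\<delta> i (x e0 \<odot>\<^bsub>E i\<^esub> w) = f x" if x: "x \<in> carrier (F 0)" for x
        using \<delta>_smult[OF free_coord_closed[OF x] wE] w(2) lin_maps_smult[OF f(1) free_coord_closed[OF x] e]
          expand[OF x] by metis
    qed
  qed
qed

lemma dual_exact_iff_ext_vanishes: "dual_exact i \<longleftrightarrow> ext_vanishes (Suc i) J"
  using shifted_iff_dual_exact[of 0 i] shifted_iff_ext_vanishes by simp

end

section \<open>The long exact sequence of multiplication by a ring element\<close>

context injective_res
begin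

lemma E_simps [simp]:
  "\<zero>\<^bsub>E i\<^esub> \<in> carrier (E i)"
  "x \<in> carrier (E i) \<Longrightarrow> x \<ominus>\<^bsub>E i\<^esub> \<zero>\<^bsub>E i\<^esub> = x"
  "a \<in> carrier R \<Longrightarrow> a \<odot>\<^bsub>E i\<^esub> \<zero>\<^bsub>E i\<^esub> = \<zero>\<^bsub>E i\<^esub>"
proof -
  interpret E: module R "E i" by (rule mod_E)
  show "\<zero>\<^bsub>E i\<^esub> \<in> carrier (E i)" "x \<in> carrier (E i) \<Longrightarrow> x \<ominus>\<^bsub>E i\<^esub> \<zero>\<^bsub>E i\<^esub> = x"
    "a \<in> carrier R \<Longrightarrow> a \<odot>\<^bsub>E i\<^esub> \<zero>\<^bsub>E i\<^esub> = \<zero>\<^bsub>E i\<^esub>" by simp_all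
qed

lemma ann_add: "x \<in> ann i J \<Longrightarrow> y \<in> ann i J \<Longrightarrow> J \<subseteq> carrier R \<Longrightarrow> x \<oplus>\<^bsub>E i\<^esub> y \<in> ann i J"
proof -
  interpret E: module R "E i" by (rule mod_E)
  show "x \<in> ann i J \<Longrightarrow> y \<in> ann i J \<Longrightarrow> J \<subseteq> carrier R \<Longrightarrow> x \<oplus>\<^bsub>E i\<^esub> y \<in> ann i J"
    by (auto simp: ann_def E.smult_r_distr subset_iff)
qed

lemma ann_minus: "x \<in> ann i J \<Longrightarrow> y \<in> ann i J \<Longrightarrow> J \<subseteq> carrier R \<Longrightarrow> x \<ominus>\<^bsub>E i\<^esub> y \<in> ann i J"
proof -
  interpret E: module R "E i" by (rule mod_E)
  show "x \<in> ann i J \<Longrightarrow> y \<in> ann i J \<Longrightarrow> J \<subseteq> carrier R \<Longrightarrow> x \<ominus>\<^bsub>E i\<^esub> y \<in> ann i J"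
    by (auto simp: ann_def E.smult_minus_distr subset_iff)
qed

lemma ann_smult: "r \<in> carrier R \<Longrightarrow> x \<in> ann i J \<Longrightarrow> J \<subseteq> carrier R \<Longrightarrow> r \<odot>\<^bsub>E i\<^esub> x \<in> ann i J"
proof -
  interpret E: module R "E i" by (rule mod_E)
  assume r: "r \<in> carrier R" and x: "x \<in> ann i J" and J: "J \<subseteq> carrier R"
  have "a \<odot>\<^bsub>E i\<^esub> (r \<odot>\<^bsub>E i\<^esub> x) = \<zero>\<^bsub>E i\<^esub>" if "a \<in> J" for a
    using E.smult_comm[of a r x] that r x J by (auto simp: ann_def)
  then show ?thesis using r x by (simp add: ann_def)
qed

lemma ann_zero: "J \<subseteq> carrier R \<Longrightarrow> \<zero>\<^bsub>E i\<^esub> \<in> ann i J"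
proof -
  interpret E: module R "E i" by (rule mod_E)
  show "J \<subseteq> carrier R \<Longrightarrow> \<zero>\<^bsub>E i\<^esub> \<in> ann i J" by (auto simp: ann_def)
qed

lemma ann_antimono: "J \<subseteq> K \<Longrightarrow> ann i K \<subseteq> ann i J"
  by (auto simp: ann_def)

lemma ann_submodule: "J \<subseteq> carrier R \<Longrightarrow> submodule (ann i J) R (E i)"
proof -
  interpret E: module R "E i" by (rule mod_E)
  assume J: "J \<subseteq> carrier R"
  show ?thesis
  proof (rule E.submoduleI)
    fix x assume x: "x \<in> ann i J"
    have "\<zero>\<^bsub>E i\<^esub> \<ominus>\<^bsub>E i\<^esub> x \<in> ann i J" by (rule ann_minus[OF ann_zero[OF J] x J])
    then show "\<ominus>\<^bsub>E i\<^esub> x \<in> ann i J" using ann_closed[OF x] by (simp add: a_minus_def)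
  qed (use J ann_closed ann_zero ann_add ann_smult in auto)
qed

lemma ann_\<delta>: "x \<in> ann i J \<Longrightarrow> J \<subseteq> carrier R \<Longrightarrow> \<delta> i x \<in> ann (Suc i) J"
proof -
  assume x: "x \<in> ann i J" and J: "J \<subseteq> carrier R"
  have "a \<odot>\<^bsub>E (Suc i)\<^esub> \<delta> i x = \<zero>\<^bsub>E (Suc i)\<^esub>" if a: "a \<in> J" for a
  proof -
    have "a \<odot>\<^bsub>E (Suc i)\<^esub> \<delta> i x = \<delta> i (a \<odot>\<^bsub>E i\<^esub> x)"
      using \<delta>_smult[of a x i] a J ann_closed[OF x] by auto
    then show ?thesis using x a \<delta>_zero by (simp add: ann_def)
  qed
  then show ?thesis using \<delta>_closed[OF ann_closed[OF x]] by (simp add: ann_def)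
qed

lemma ann_plus_gen_iff:
  assumes "ideal J R" "a \<in> carrier R"
  shows "x \<in> ann i (plus_gen R J a) \<longleftrightarrow> x \<in> ann i J \<and> a \<odot>\<^bsub>E i\<^esub> x = \<zero>\<^bsub>E i\<^esub>"
proof
  interpret E: module R "E i" by (rule mod_E)
  interpret J: ideal J R by fact
  show "x \<in> ann i (plus_gen R J a) \<Longrightarrow> x \<in> ann i J \<and> a \<odot>\<^bsub>E i\<^esub> x = \<zero>\<^bsub>E i\<^esub>"
    using plus_gen_incl[OF assms] by (auto simp: ann_def)
  assume x: "x \<in> ann i J \<and> a \<odot>\<^bsub>E i\<^esub> x = \<zero>\<^bsub>E i\<^esub>"
  then have xE: "x \<in> carrier (E i)" by (simp add: ann_def)
  have "(j \<oplus> r \<otimes> a) \<odot>\<^bsub>E i\<^esub> x = \<zero>\<^bsub>E i\<^esub>" if "j \<in> J" "r \<in> carrier R" for j r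
    using x xE that assms(2) J.Icarr[OF that(1)]
    by (simp add: E.smult_l_distr E.smult_assoc1 ann_def)
  then show "x \<in> ann i (plus_gen R J a)" using xE by (auto simp: ann_def plus_gen_def)
qed

lemma smult_ann_colon:
  assumes "ideal J R" "a \<in> carrier R" "x \<in> ann i J"
  shows "a \<odot>\<^bsub>E i\<^esub> x \<in> ann i (colon R J a)"
proof -
  interpret E: module R "E i" by (rule mod_E)
  have "r \<odot>\<^bsub>E i\<^esub> (a \<odot>\<^bsub>E i\<^esub> x) = \<zero>\<^bsub>E i\<^esub>" if r: "r \<in> carrier R" "r \<otimes> a \<in> J" for r
    using E.smult_assoc1[OF r(1) assms(2) ann_closed[OF assms(3)], symmetric] assms(3) r(2)
    by (simp add: ann_def)
  then show ?thesis using assms by (simp add: ann_def colon_def)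
qed

lemma ann_colon_lift:
  assumes J: "ideal J R" and a: "a \<in> carrier R" and x: "x \<in> ann i (colon R J a)"
  shows "\<exists>y\<in>ann i J. a \<odot>\<^bsub>E i\<^esub> y = x"
proof -
  interpret E: module R "E i" by (rule mod_E)
  interpret J: ideal J R by fact
  let ?N = "plus_gen R J a"
  interpret N: ideal ?N R by (rule ideal_plus_gen[OF J a])
  have xE: "x \<in> carrier (E i)" using ann_closed[OF x] .
  define s where "s n = (SOME r. r \<in> carrier R \<and> (\<exists>j\<in>J. n = j \<oplus> r \<otimes> a))" for n
  have f: "s n \<odot>\<^bsub>E i\<^esub> x = r \<odot>\<^bsub>E i\<^esub> x" if n: "n = j \<oplus> r \<otimes> a" and j: "j \<in> J" and r: "r \<in> carrier R" for n j r
  proof -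
    have "s n \<in> carrier R \<and> (\<exists>j\<in>J. n = j \<oplus> s n \<otimes> a)"
      unfolding s_def by (rule someI[of _ r]) (use n j r in auto)
    then obtain j' where s: "s n \<in> carrier R" "j' \<in> J" "j \<oplus> r \<otimes> a = j' \<oplus> s n \<otimes> a" using n by metis
    have jR: "j \<in> carrier R" "j' \<in> carrier R" using j s J.Icarr by auto
    have "(s n \<ominus> r) \<otimes> a = j \<ominus> j'"
    proof -
      have "(s n \<ominus> r) \<otimes> a = (j' \<oplus> s n \<otimes> a) \<ominus> j' \<ominus> r \<otimes> a"
        using s(1) r a jR by algebra
      also have "\<dots> = (j \<oplus> r \<otimes> a) \<ominus> j' \<ominus> r \<otimes> a" using s(3) by simp
      also have "\<dots> = j \<ominus> j'" using r a jR by algebra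
      finally show ?thesis .
    qed
    then have "s n \<ominus> r \<in> colon R J a"
      using s(1) r ideal_minus[OF J j s(2)] by (simp add: colon_def)
    then have "(s n \<ominus> r) \<odot>\<^bsub>E i\<^esub> x = \<zero>\<^bsub>E i\<^esub>" using x by (simp add: ann_def)
    then have "s n \<odot>\<^bsub>E i\<^esub> x \<ominus>\<^bsub>E i\<^esub> r \<odot>\<^bsub>E i\<^esub> x = \<zero>\<^bsub>E i\<^esub>"
      using s(1) r xE by (simp add: a_minus_def E.smult_l_distr E.smult_l_minus)
    then show ?thesis using E.minus_eq_zero_iff s(1) r xE by simp
  qed
  let ?NM = "(self_module R)\<lparr>carrier := ?N\<rparr>"
  have lin: "(\<lambda>n. s n \<odot>\<^bsub>E i\<^esub> x) \<in> lin_maps R ?NM (E i)"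
  proof (rule lin_mapsI)
    fix n assume "n \<in> carrier ?NM"
    then have "n \<in> ?N" by simp
    then obtain j r where n: "n = j \<oplus> r \<otimes> a" "j \<in> J" "r \<in> carrier R" by (rule plus_genE)
    then show "s n \<odot>\<^bsub>E i\<^esub> x \<in> carrier (E i)" using f[OF n] xE by simp
  next
    fix n n' assume "n \<in> carrier ?NM" "n' \<in> carrier ?NM"
    then have nn: "n \<in> ?N" "n' \<in> ?N" by simp_all
    obtain j r where n: "n = j \<oplus> r \<otimes> a" "j \<in> J" "r \<in> carrier R" using nn(1) by (rule plus_genE)
    obtain j' r' where n': "n' = j' \<oplus> r' \<otimes> a" "j' \<in> J" "r' \<in> carrier R" using nn(2) by (rule plus_genE)
    have "j \<in> carrier R" "j' \<in> carrier R" using n n' J.Icarr by auto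
    then have "n \<oplus> n' = (j \<oplus> j') \<oplus> (r \<oplus> r') \<otimes> a" using n n' a by algebra
    then have "s (n \<oplus> n') \<odot>\<^bsub>E i\<^esub> x = (r \<oplus> r') \<odot>\<^bsub>E i\<^esub> x"
      using f[of "n \<oplus> n'" "j \<oplus> j'" "r \<oplus> r'"] n(2,3) n'(2,3) by simp
    then show "s (n \<oplus>\<^bsub>?NM\<^esub> n') \<odot>\<^bsub>E i\<^esub> x = s n \<odot>\<^bsub>E i\<^esub> x \<oplus>\<^bsub>E i\<^esub> s n' \<odot>\<^bsub>E i\<^esub> x"
      using f[OF n] f[OF n'] n n' xE by (simp add: E.smult_l_distr)
  next
    fix b n assume b: "b \<in> carrier R" and "n \<in> carrier ?NM"
    then have "n \<in> ?N" by simp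
    then obtain j r where n: "n = j \<oplus> r \<otimes> a" "j \<in> J" "r \<in> carrier R" by (rule plus_genE)
    have "j \<in> carrier R" using n J.Icarr by auto
    then have "b \<otimes> n = b \<otimes> j \<oplus> (b \<otimes> r) \<otimes> a" using n a b by algebra
    then have "s (b \<otimes> n) \<odot>\<^bsub>E i\<^esub> x = (b \<otimes> r) \<odot>\<^bsub>E i\<^esub> x"
      using f[of "b \<otimes> n" "b \<otimes> j" "b \<otimes> r"] n(2,3) b J.I_l_closed by simp
    then show "s (b \<odot>\<^bsub>?NM\<^esub> n) \<odot>\<^bsub>E i\<^esub> x = b \<odot>\<^bsub>E i\<^esub> (s n \<odot>\<^bsub>E i\<^esub> x)"
      using f[OF n] n b xE by (simp add: E.smult_assoc1)
  qed
  have "submodule ?N R (self_module R)" using submodule_self N.is_ideal by blast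
  then obtain g where g: "g \<in> lin_maps R (self_module R) (E i)" "\<forall>n\<in>?N. g n = s n \<odot>\<^bsub>E i\<^esub> x"
    using injective_extend[OF inj_E self_module_is_module inj_on_subset[OF inj_Inl subset_UNIV] _ lin] by blast
  have g1: "g \<one> \<in> carrier (E i)" using lin_maps_closed[OF g(1), of \<one>] by simp
  have gr: "r \<odot>\<^bsub>E i\<^esub> g \<one> = g r" if "r \<in> carrier R" for r
    using lin_maps_smult[OF g(1) that, of \<one>] that by simp
  have "j \<odot>\<^bsub>E i\<^esub> g \<one> = \<zero>\<^bsub>E i\<^esub>" if j: "j \<in> J" for j
  proof -
    have "j = j \<oplus> \<zero> \<otimes> a" using a J.Icarr[OF j] by simp
    then have "s j \<odot>\<^bsub>E i\<^esub> x = \<zero> \<odot>\<^bsub>E i\<^esub> x" using j by (rule f) simp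
    then show ?thesis using g(2) gr[OF J.Icarr[OF j]] plus_gen_incl(1)[OF J a] j xE by auto
  qed
  moreover have "a \<odot>\<^bsub>E i\<^esub> g \<one> = x"
  proof -
    have "a = \<zero> \<oplus> \<one> \<otimes> a" using a by simp
    then have "s a \<odot>\<^bsub>E i\<^esub> x = \<one> \<odot>\<^bsub>E i\<^esub> x" by (rule f) (auto simp: J.additive_subgroup_axioms additive_subgroup.zero_closed)
    then show ?thesis using g(2) gr[OF a] plus_gen_incl(2)[OF J a] xE by auto
  qed
  ultimately show ?thesis using g1 by (intro bexI[of _ "g \<one>"]) (simp_all add: ann_def)
qed

lemma cocycles_ann: "x \<in> cocycles i J \<Longrightarrow> x \<in> ann i J"
  by (simp add: cocycles_def)

lemma cocycles_closed: "x \<in> cocycles i J \<Longrightarrow> x \<in> carrier (E i)"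
  by (simp add: cocycles_def ann_def)

lemma cocycles_zero: "x \<in> cocycles i J \<Longrightarrow> \<delta> i x = \<zero>\<^bsub>E (Suc i)\<^esub>"
  by (simp add: cocycles_def)

lemma ext_vanishesD_0: "ext_vanishes 0 J \<Longrightarrow> x \<in> cocycles 0 J \<Longrightarrow> x = \<zero>\<^bsub>E 0\<^esub>"
  by (auto simp: ext_vanishes_def cobounds_def)

lemma ext_vanishesD_Suc: "ext_vanishes (Suc k) J \<Longrightarrow> x \<in> cocycles (Suc k) J \<Longrightarrow> \<exists>w\<in>ann k J. \<delta> k w = x"
  by (auto simp: ext_vanishes_def cobounds_def)

lemma ideal_carr: "ideal J R \<Longrightarrow> J \<subseteq> carrier R"
  using ideal.Icarr[of J R] by blast

lemma ext_vanishes_middle: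
  assumes J: "ideal J R" and a: "a \<in> carrier R"
    and V1: "ext_vanishes n (plus_gen R J a)" and V2: "ext_vanishes n (colon R J a)"
  shows "ext_vanishes n J"
  unfolding ext_vanishes_def
proof
  interpret E: module R "E n" by (rule mod_E)
  interpret E1: module R "E (Suc n)" by (rule mod_E)
  note JR = ideal_carr[OF J]
  fix z assume z: "z \<in> cocycles n J"
  have az: "a \<odot>\<^bsub>E n\<^esub> z \<in> cocycles n (colon R J a)"
    using smult_ann_colon[OF J a cocycles_ann[OF z]] \<delta>_smult[OF a cocycles_closed[OF z]] cocycles_zero[OF z] a
    by (simp add: cocycles_def)
  show "z \<in> cobounds n J"
  proof (cases n)
    case 0
    have "a \<odot>\<^bsub>E n\<^esub> z = \<zero>\<^bsub>E n\<^esub>" using ext_vanishesD_0 V2 az 0 by blast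
    then have "z \<in> cocycles n (plus_gen R J a)"
      using z ann_plus_gen_iff[OF J a] by (simp add: cocycles_def)
    then show ?thesis using ext_vanishesD_0 V1 0 by (simp add: cobounds_def)
  next
    case (Suc k)
    obtain v where v: "v \<in> ann k (colon R J a)" "\<delta> k v = a \<odot>\<^bsub>E n\<^esub> z"
      using ext_vanishesD_Suc V2 az Suc by blast
    obtain w where w: "w \<in> ann k J" "a \<odot>\<^bsub>E k\<^esub> w = v" using ann_colon_lift[OF J a v(1)] by blast
    have wE: "w \<in> carrier (E k)" using ann_closed[OF w(1)] .
    have \<delta>w: "\<delta> k w \<in> ann n J" using ann_\<delta>[OF w(1) JR] Suc by simp
    have "a \<odot>\<^bsub>E n\<^esub> \<delta> k w = a \<odot>\<^bsub>E n\<^esub> z" using \<delta>_smult[OF a wE] w v Suc by simp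
    then have "a \<odot>\<^bsub>E n\<^esub> (z \<ominus>\<^bsub>E n\<^esub> \<delta> k w) = \<zero>\<^bsub>E n\<^esub>"
      using E.smult_minus_distr[OF a cocycles_closed[OF z] ann_closed[OF \<delta>w]]
        E.minus_eq_zero_iff a cocycles_closed[OF z] by simp
    moreover have "\<delta> n (z \<ominus>\<^bsub>E n\<^esub> \<delta> k w) = \<zero>\<^bsub>E (Suc n)\<^esub>"
      using \<delta>_minus[OF cocycles_closed[OF z] ann_closed[OF \<delta>w]] cocycles_zero[OF z] \<delta>_\<delta>[OF wE] Suc by simp
    ultimately have "z \<ominus>\<^bsub>E n\<^esub> \<delta> k w \<in> cocycles n (plus_gen R J a)"
      using ann_minus[OF cocycles_ann[OF z] \<delta>w JR] ann_plus_gen_iff[OF J a] by (simp add: cocycles_def)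
    then obtain u where u: "u \<in> ann k (plus_gen R J a)" "\<delta> k u = z \<ominus>\<^bsub>E n\<^esub> \<delta> k w"
      using ext_vanishesD_Suc V1 Suc by blast
    have uJ: "u \<in> ann k J" using u(1) ann_plus_gen_iff[OF J a] by blast
    have "\<delta> k (u \<oplus>\<^bsub>E k\<^esub> w) = z"
      using \<delta>_add[OF ann_closed[OF uJ] wE] u(2) E.minus_add_cancel[OF cocycles_closed[OF z] ann_closed[OF \<delta>w]] Suc
      by simp
    then show ?thesis using ann_add[OF uJ w(1) JR] Suc by (auto simp: cobounds_def)
  qed
qed

lemma cocycle_colon_lift:
  assumes J: "ideal J R" and a: "a \<in> carrier R" and V: "ext_vanishes (Suc n) (plus_gen R J a)"
    and z: "z \<in> cocycles n (colon R J a)"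
  shows "\<exists>y\<in>cocycles n J. a \<odot>\<^bsub>E n\<^esub> y = z"
proof -
  interpret E: module R "E n" by (rule mod_E)
  interpret E1: module R "E (Suc n)" by (rule mod_E)
  note JR = ideal_carr[OF J]
  obtain e where e: "e \<in> ann n J" "a \<odot>\<^bsub>E n\<^esub> e = z" using ann_colon_lift[OF J a cocycles_ann[OF z]] by blast
  have eE: "e \<in> carrier (E n)" using ann_closed[OF e(1)] .
  have "a \<odot>\<^bsub>E (Suc n)\<^esub> \<delta> n e = \<zero>\<^bsub>E (Suc n)\<^esub>" using \<delta>_smult[OF a eE] e(2) cocycles_zero[OF z] by simp
  then have "\<delta> n e \<in> cocycles (Suc n) (plus_gen R J a)"
    using ann_\<delta>[OF e(1) JR] \<delta>_\<delta>[OF eE] ann_plus_gen_iff[OF J a] by (simp add: cocycles_def)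
  then obtain e' where e': "e' \<in> ann n (plus_gen R J a)" "\<delta> n e' = \<delta> n e"
    using ext_vanishesD_Suc[OF V] by blast
  have e'J: "e' \<in> ann n J" "a \<odot>\<^bsub>E n\<^esub> e' = \<zero>\<^bsub>E n\<^esub>" using e'(1) ann_plus_gen_iff[OF J a] by auto
  have e'E: "e' \<in> carrier (E n)" using ann_closed[OF e'(1)] .
  have "\<delta> n (e \<ominus>\<^bsub>E n\<^esub> e') = \<zero>\<^bsub>E (Suc n)\<^esub>"
    using \<delta>_minus[OF eE e'E] e'(2) \<delta>_closed[OF eE] E1.minus_eq_zero_iff by simp
  then have "e \<ominus>\<^bsub>E n\<^esub> e' \<in> cocycles n J" using ann_minus[OF e(1) e'J(1) JR] by (simp add: cocycles_def)
  moreover have "a \<odot>\<^bsub>E n\<^esub> (e \<ominus>\<^bsub>E n\<^esub> e') = z"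
    using E.smult_minus_distr[OF a eE e'E] e'J(2) e(2) cocycles_closed[OF z] by simp
  ultimately show ?thesis by blast
qed

lemma ext_vanishes_colon:
  assumes J: "ideal J R" and a: "a \<in> carrier R"
    and V1: "ext_vanishes n J" and V2: "ext_vanishes (Suc n) (plus_gen R J a)"
  shows "ext_vanishes n (colon R J a)"
  unfolding ext_vanishes_def
proof
  interpret E: module R "E n" by (rule mod_E)
  fix z assume "z \<in> cocycles n (colon R J a)"
  then obtain y where y: "y \<in> cocycles n J" "a \<odot>\<^bsub>E n\<^esub> y = z" using cocycle_colon_lift[OF J a V2] by blast
  show "z \<in> cobounds n (colon R J a)"
  proof (cases n)
    case 0
    then have "y = \<zero>\<^bsub>E n\<^esub>" using ext_vanishesD_0 V1 y(1) by blast
    then show ?thesis using y(2) a 0 by (auto simp: cobounds_def)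
  next
    case (Suc k)
    then obtain u where u: "u \<in> ann k J" "\<delta> k u = y" using ext_vanishesD_Suc V1 y(1) by blast
    then have "\<delta> k (a \<odot>\<^bsub>E k\<^esub> u) = z" using \<delta>_smult[OF a ann_closed[OF u(1)]] y(2) Suc by simp
    then show ?thesis using smult_ann_colon[OF J a u(1)] Suc by (auto simp: cobounds_def)
  qed
qed

lemma ext_vanishes_plus_gen:
  assumes J: "ideal J R" and a: "a \<in> carrier R"
    and V1: "ext_vanishes n (colon R J a)" and V2: "ext_vanishes (Suc n) J"
  shows "ext_vanishes (Suc n) (plus_gen R J a)"
  unfolding ext_vanishes_def
proof
  interpret E: module R "E n" by (rule mod_E)
  interpret E1: module R "E (Suc n)" by (rule mod_E)
  note JR = ideal_carr[OF J]
  fix z assume z: "z \<in> cocycles (Suc n) (plus_gen R J a)"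
  then have zJ: "z \<in> cocycles (Suc n) J" and az: "a \<odot>\<^bsub>E (Suc n)\<^esub> z = \<zero>\<^bsub>E (Suc n)\<^esub>"
    using ann_plus_gen_iff[OF J a] by (auto simp: cocycles_def)
  obtain w where w: "w \<in> ann n J" "\<delta> n w = z" using ext_vanishesD_Suc[OF V2 zJ] by blast
  have wE: "w \<in> carrier (E n)" using ann_closed[OF w(1)] .
  have aw: "a \<odot>\<^bsub>E n\<^esub> w \<in> cocycles n (colon R J a)"
    using smult_ann_colon[OF J a w(1)] \<delta>_smult[OF a wE] w(2) az by (simp add: cocycles_def)
  show "z \<in> cobounds (Suc n) (plus_gen R J a)"
  proof (cases n)
    case 0
    then have "a \<odot>\<^bsub>E n\<^esub> w = \<zero>\<^bsub>E n\<^esub>" using ext_vanishesD_0 V1 aw by blast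
    then have "w \<in> ann n (plus_gen R J a)" using w(1) ann_plus_gen_iff[OF J a] by blast
    then show ?thesis using w(2) by (auto simp: cobounds_def)
  next
    case (Suc k)
    then obtain v where v: "v \<in> ann k (colon R J a)" "\<delta> k v = a \<odot>\<^bsub>E n\<^esub> w"
      using ext_vanishesD_Suc V1 aw by blast
    obtain u where u: "u \<in> ann k J" "a \<odot>\<^bsub>E k\<^esub> u = v" using ann_colon_lift[OF J a v(1)] by blast
    have uE: "u \<in> carrier (E k)" using ann_closed[OF u(1)] .
    have \<delta>u: "\<delta> k u \<in> ann n J" using ann_\<delta>[OF u(1) JR] Suc by simp
    have "a \<odot>\<^bsub>E n\<^esub> \<delta> k u = a \<odot>\<^bsub>E n\<^esub> w" using \<delta>_smult[OF a uE] u(2) v(2) Suc by simp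
    then have "a \<odot>\<^bsub>E n\<^esub> (w \<ominus>\<^bsub>E n\<^esub> \<delta> k u) = \<zero>\<^bsub>E n\<^esub>"
      using E.smult_minus_distr[OF a wE ann_closed[OF \<delta>u]] E.minus_eq_zero_iff a wE by simp
    then have "w \<ominus>\<^bsub>E n\<^esub> \<delta> k u \<in> ann n (plus_gen R J a)"
      using ann_minus[OF w(1) \<delta>u JR] ann_plus_gen_iff[OF J a] by blast
    moreover have "\<delta> n (w \<ominus>\<^bsub>E n\<^esub> \<delta> k u) = z"
      using \<delta>_minus[OF wE ann_closed[OF \<delta>u]] w(2) \<delta>_\<delta>[OF uE] cocycles_closed[OF z] Suc by simp
    ultimately show ?thesis by (auto simp: cobounds_def)
  qed
qed

section \<open>Finiteness of Ext\<close>

text \<open>The submodules of \<open>Ext\<^sup>n(R/J, R)\<close> are those between coboundaries and cocycles.\<close>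

definition ext_acc :: "nat \<Rightarrow> 'a set \<Rightarrow> bool" where
  "ext_acc n J \<longleftrightarrow> (\<forall>N :: nat \<Rightarrow> 'e set.
     (\<forall>i. submodule (N i) R (E n) \<and> cobounds n J \<subseteq> N i \<and> N i \<subseteq> cocycles n J \<and> N i \<subseteq> N (Suc i)) \<longrightarrow>
     (\<exists>k. \<forall>i\<ge>k. N i = N k))"

lemma cocycles_submodule: "J \<subseteq> carrier R \<Longrightarrow> submodule (cocycles n J) R (E n)"
proof -
  assume J: "J \<subseteq> carrier R"
  have "cocycles n J = ann n J \<inter> {x \<in> carrier (E n). \<delta> n x = \<zero>\<^bsub>E (Suc n)\<^esub>}"
    by (auto simp: cocycles_def ann_def)
  then show ?thesis
    using submodule_Int[OF mod_E ann_submodule[OF J] submodule_kernel[OF mod_E mod_E lin_\<delta>]] by simp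
qed

lemma cobounds_submodule: "J \<subseteq> carrier R \<Longrightarrow> submodule (cobounds n J) R (E n)"
proof (cases n)
  case 0
  interpret E: module R "E 0" by (rule mod_E)
  show ?thesis unfolding 0 by (intro E.submoduleI) (auto simp: cobounds_def intro: E.minus_equality)
next
  case (Suc k)
  assume "J \<subseteq> carrier R"
  then show ?thesis
    using submodule_image[OF mod_E mod_E lin_\<delta> ann_submodule] Suc by (simp add: cobounds_def)
qed

lemma cobounds_cocycles: "J \<subseteq> carrier R \<Longrightarrow> cobounds n J \<subseteq> cocycles n J"
proof (cases n)
  case 0
  then show "J \<subseteq> carrier R \<Longrightarrow> ?thesis" using ann_zero \<delta>_zero by (auto simp: cobounds_def cocycles_def)
next
  case (Suc k)
  then show "J \<subseteq> carrier R \<Longrightarrow> ?thesis"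
    using ann_\<delta> \<delta>_\<delta> ann_closed by (auto simp: cobounds_def cocycles_def)
qed

lemma submodule_sum:
  assumes N: "submodule N R (E n)" and K: "submodule K R (E n)"
  shows "submodule {x \<oplus>\<^bsub>E n\<^esub> y | x y. x \<in> N \<and> y \<in> K} R (E n)" (is "submodule ?S R _")
    and "N \<subseteq> {x \<oplus>\<^bsub>E n\<^esub> y | x y. x \<in> N \<and> y \<in> K}"
    and "K \<subseteq> {x \<oplus>\<^bsub>E n\<^esub> y | x y. x \<in> N \<and> y \<in> K}"
proof -
  interpret E: module R "E n" by (rule mod_E)
  note n = E.submoduleE[OF N] and k = E.submoduleE[OF K]
  have c: "x \<in> carrier (E n)" if "x \<in> N \<or> x \<in> K" for x using that n(1) k(1) by blast
  show "N \<subseteq> ?S"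
  proof
    fix x assume x: "x \<in> N"
    have "x = x \<oplus>\<^bsub>E n\<^esub> \<zero>\<^bsub>E n\<^esub>" using c x by simp
    then show "x \<in> ?S" using x submodule_zero[OF K] by blast
  qed
  show "K \<subseteq> ?S"
  proof
    fix x assume x: "x \<in> K"
    have "x = \<zero>\<^bsub>E n\<^esub> \<oplus>\<^bsub>E n\<^esub> x" using c x by simp
    then show "x \<in> ?S" using x submodule_zero[OF N] by blast
  qed
  show "submodule ?S R (E n)"
  proof (rule E.submoduleI)
    show "?S \<subseteq> carrier (E n)" using c by auto
    show "\<zero>\<^bsub>E n\<^esub> \<in> ?S" using \<open>N \<subseteq> ?S\<close> submodule_zero[OF N] by blast
  next
    fix s assume "s \<in> ?S"
    then obtain x y where s: "s = x \<oplus>\<^bsub>E n\<^esub> y" "x \<in> N" "y \<in> K" by blast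
    have "\<ominus>\<^bsub>E n\<^esub> s = \<ominus>\<^bsub>E n\<^esub> x \<oplus>\<^bsub>E n\<^esub> \<ominus>\<^bsub>E n\<^esub> y" using s c by (simp add: E.minus_add)
    then show "\<ominus>\<^bsub>E n\<^esub> s \<in> ?S" using s(2,3) n(3) k(3) by blast
  next
    fix s t assume "s \<in> ?S" "t \<in> ?S"
    then obtain x y x' y' where s: "s = x \<oplus>\<^bsub>E n\<^esub> y" "x \<in> N" "y \<in> K"
      and t: "t = x' \<oplus>\<^bsub>E n\<^esub> y'" "x' \<in> N" "y' \<in> K" by blast
    have "s \<oplus>\<^bsub>E n\<^esub> t = (x \<oplus>\<^bsub>E n\<^esub> x') \<oplus>\<^bsub>E n\<^esub> (y \<oplus>\<^bsub>E n\<^esub> y')" using s t c by (simp add: E.a_ac)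
    then show "s \<oplus>\<^bsub>E n\<^esub> t \<in> ?S" using s(2,3) t(2,3) n(5) k(5) by blast
  next
    fix r s assume r: "r \<in> carrier R" and "s \<in> ?S"
    then obtain x y where s: "s = x \<oplus>\<^bsub>E n\<^esub> y" "x \<in> N" "y \<in> K" by blast
    have "r \<odot>\<^bsub>E n\<^esub> s = r \<odot>\<^bsub>E n\<^esub> x \<oplus>\<^bsub>E n\<^esub> r \<odot>\<^bsub>E n\<^esub> y" using r s c by (simp add: E.smult_r_distr)
    then show "r \<odot>\<^bsub>E n\<^esub> s \<in> ?S" using s(2,3) n(4) k(4) r by blast
  qed
qed

lemma noetherian_chain_stable:
  assumes "noetherian_ring R" "\<And>i. ideal (L i) R" "\<And>i j :: nat. i \<le> j \<Longrightarrow> L i \<subseteq> L j"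
  shows "\<exists>k. \<forall>i\<ge>k. L i = L k"
proof -
  have "subset.chain {I. ideal I R} (range L)"
    unfolding subset_chain_def
  proof (intro conjI ballI)
    show "range L \<subseteq> {I. ideal I R}" using assms(2) by auto
    fix X Y assume "X \<in> range L" "Y \<in> range L"
    then obtain i j where "X = L i" "Y = L j" by blast
    then show "X \<subseteq> Y \<or> Y \<subseteq> X" using assms(3)[of i j] assms(3)[of j i] by (cases "i \<le> j") auto
  qed
  then have "\<Union>(range L) \<in> range L"
    using noetherian_ring.ideal_chain_is_trivial[OF assms(1), of "range L"] by simp
  then obtain k where k: "\<Union>(range L) = L k" by blast
  have "L i = L k" if "i \<ge> k" for i using assms(3)[OF that] k by blast
  then show ?thesis by blast
qed

lemma ext_acc_0:
  assumes "noetherian_ring R" shows "ext_acc 0 J"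
  unfolding ext_acc_def
proof (intro allI impI)
  fix N :: "nat \<Rightarrow> 'e set"
  assume N: "\<forall>i. submodule (N i) R (E 0) \<and> cobounds 0 J \<subseteq> N i \<and> N i \<subseteq> cocycles 0 J \<and> N i \<subseteq> N (Suc i)"
  interpret E: module R "E 0" by (rule mod_E)
  define L where "L i = {r \<in> carrier R. \<epsilon> r \<in> N i}" for i
  have step: "N i \<subseteq> N (Suc i)" for i using N by blast
  have mono: "N i \<subseteq> N j" if "i \<le> j" for i j using lift_Suc_mono_le[of N, OF step that] .
  have "ideal (L i) R" for i
  proof (rule idealI')
    have s: "submodule (N i) R (E 0)" using N by blast
    note * = E.submoduleE[OF s]
    show "L i \<subseteq> carrier R" by (auto simp: L_def)
    show "\<zero> \<in> L i"
      using lin_maps_zero[OF self_module_is_module mod_E lin_\<epsilon>] submodule_zero[OF s] by (simp add: L_def)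
    show "x \<oplus> y \<in> L i" if "x \<in> L i" "y \<in> L i" for x y
      using that *(5) lin_maps_add[OF lin_\<epsilon>, of x y] by (simp add: L_def)
    show "a \<otimes> x \<in> L i" if "a \<in> carrier R" "x \<in> L i" for a x
      using that *(4) lin_maps_smult[OF lin_\<epsilon>, of a x] by (simp add: L_def)
  qed
  moreover have "L i \<subseteq> L j" if "i \<le> j" for i j using mono[OF that] by (auto simp: L_def)
  ultimately obtain k where k: "\<And>i. i \<ge> k \<Longrightarrow> L i = L k"
    using noetherian_chain_stable[OF assms, of L] by metis
  have "N i = N k" if "i \<ge> k" for i
  proof
    show "N k \<subseteq> N i" using mono that by blast
    have Li: "L i = L k" using k that by blast
    show "N i \<subseteq> N k"
    proof
      fix x assume x: "x \<in> N i"
      then have "x \<in> cocycles 0 J" using N by blast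
      then have "x \<in> \<epsilon> ` carrier R" unfolding \<epsilon>_image by (auto simp: cocycles_def ann_def)
      then obtain r where "r \<in> carrier R" "x = \<epsilon> r" by blast
      then have "r \<in> L i" using x by (simp add: L_def)
      then have "r \<in> L k" using Li by simp
      then show "x \<in> N k" using \<open>x = \<epsilon> r\<close> by (simp add: L_def)
    qed
  qed
  then show "\<exists>k. \<forall>i\<ge>k. N i = N k" by blast
qed

lemma ext_acc_zero_ideal: "ext_acc (Suc n) {\<zero>}"
proof -
  interpret E: module R "E (Suc n)" by (rule mod_E)
  interpret En: module R "E n" by (rule mod_E)
  have ann0: "ann k {\<zero>} = carrier (E k)" for k
  proof -
    interpret Ek: module R "E k" by (rule mod_E)
    show ?thesis by (auto simp: ann_def)
  qed
  have "cocycles (Suc n) {\<zero>} = cobounds (Suc n) {\<zero>}"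
    using \<delta>_image[of n] by (simp add: cocycles_def cobounds_def ann0)
  then have "N i = cobounds (Suc n) {\<zero>}"
    if "cobounds (Suc n) {\<zero>} \<subseteq> N i \<and> N i \<subseteq> cocycles (Suc n) {\<zero>}" for N :: "nat \<Rightarrow> 'e set" and i
    using that by blast
  then show ?thesis unfolding ext_acc_def by (intro allI impI exI[of _ 0]) metis
qed

text \<open>
  A chain of submodules of \<open>Ext\<^sup>n\<^sup>+\<^sup>1(R/(J + aR), R)\<close> is stationary as soon as its images in
  \<open>Ext\<^sup>n\<^sup>+\<^sup>1(R/J, R)\<close> and its preimages in \<open>Ext\<^sup>n(R/(J : a), R)\<close> are.
\<close>

lemma ext_acc_plus_gen:
  assumes J: "ideal J R" and a: "a \<in> carrier R"
    and A1: "ext_acc n (colon R J a)" and A2: "ext_acc (Suc n) J"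
  shows "ext_acc (Suc n) (plus_gen R J a)"
  unfolding ext_acc_def
proof (intro allI impI)
  fix N :: "nat \<Rightarrow> 'e set"
  let ?K = "plus_gen R J a"
  assume N: "\<forall>i. submodule (N i) R (E (Suc n)) \<and> cobounds (Suc n) ?K \<subseteq> N i \<and> N i \<subseteq> cocycles (Suc n) ?K \<and> N i \<subseteq> N (Suc i)"
  interpret E: module R "E n" by (rule mod_E)
  interpret E1: module R "E (Suc n)" by (rule mod_E)
  note JR = ideal_carr[OF J]
  have CR: "colon R J a \<subseteq> carrier R" by (auto simp: colon_def)
  have sN: "submodule (N i) R (E (Suc n))" for i using N by blast
  note n = E1.submoduleE[OF sN]
  have step: "N i \<subseteq> N (Suc i)" for i using N by blast
  have mono: "N i \<subseteq> N j" if "i \<le> j" for i j using lift_Suc_mono_le[of N, OF step that] .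
  define S where "S i = {x \<oplus>\<^bsub>E (Suc n)\<^esub> y | x y. x \<in> N i \<and> y \<in> cobounds (Suc n) J}" for i
  define M where "M i = {z \<in> cocycles n (colon R J a). \<exists>w\<in>ann n J. a \<odot>\<^bsub>E n\<^esub> w = z \<and> \<delta> n w \<in> N i}" for i
  have cK: "cocycles (Suc n) ?K \<subseteq> cocycles (Suc n) J"
    using ann_plus_gen_iff[OF J a] by (auto simp: cocycles_def)
  have S: "submodule (S i) R (E (Suc n)) \<and> cobounds (Suc n) J \<subseteq> S i \<and> S i \<subseteq> cocycles (Suc n) J \<and> S i \<subseteq> S (Suc i)" for i
  proof (intro conjI)
    show "submodule (S i) R (E (Suc n))" "cobounds (Suc n) J \<subseteq> S i"
      unfolding S_def using submodule_sum[OF sN cobounds_submodule[OF JR]] by auto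
    have "N i \<subseteq> cocycles (Suc n) J" using N cK by blast
    then show "S i \<subseteq> cocycles (Suc n) J"
      using E1.submoduleE(5)[OF cocycles_submodule[OF JR, of "Suc n"]] cobounds_cocycles[OF JR, of "Suc n"]
      by (auto simp: S_def)
    show "S i \<subseteq> S (Suc i)" using N unfolding S_def by blast
  qed
  have M: "submodule (M i) R (E n) \<and> cobounds n (colon R J a) \<subseteq> M i \<and> M i \<subseteq> cocycles n (colon R J a) \<and> M i \<subseteq> M (Suc i)" for i
  proof (intro conjI)
    have "M i = cocycles n (colon R J a) \<inter> (\<lambda>w. a \<odot>\<^bsub>E n\<^esub> w) ` (ann n J \<inter> {w \<in> carrier (E n). \<delta> n w \<in> N i})"
      by (auto simp: M_def ann_closed)
    moreover have "submodule {w \<in> carrier (E n). \<delta> n w \<in> N i} R (E n)"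
    proof (rule E.submoduleI)
      fix w assume "w \<in> {w \<in> carrier (E n). \<delta> n w \<in> N i}"
      then show "\<ominus>\<^bsub>E n\<^esub> w \<in> {w \<in> carrier (E n). \<delta> n w \<in> N i}"
        using n(3) lin_maps_uminus[OF mod_E mod_E lin_\<delta>] by simp
    qed (use n \<delta>_zero submodule_zero[OF sN] \<delta>_add \<delta>_smult in auto)
    moreover have "(\<lambda>w. a \<odot>\<^bsub>E n\<^esub> w) \<in> lin_maps R (E n) (E n)"
      using a by (intro lin_mapsI) (simp_all add: E.smult_r_distr E.smult_comm)
    ultimately show "submodule (M i) R (E n)"
      using submodule_Int[OF mod_E cocycles_submodule[OF CR]
          submodule_image[OF mod_E mod_E _ submodule_Int[OF mod_E ann_submodule[OF JR]]]] by simp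
    show "M i \<subseteq> cocycles n (colon R J a)" by (auto simp: M_def)
    show "M i \<subseteq> M (Suc i)" using N unfolding M_def by blast
    show "cobounds n (colon R J a) \<subseteq> M i"
    proof
      fix z assume z: "z \<in> cobounds n (colon R J a)"
      have zc: "z \<in> cocycles n (colon R J a)" using z cobounds_cocycles[OF CR] by blast
      show "z \<in> M i"
      proof (cases n)
        case 0
        then have "z = \<zero>\<^bsub>E n\<^esub>" using z by (simp add: cobounds_def)
        then have "a \<odot>\<^bsub>E n\<^esub> \<zero>\<^bsub>E n\<^esub> = z" "\<delta> n \<zero>\<^bsub>E n\<^esub> \<in> N i"
          using a \<delta>_zero submodule_zero[OF sN] by simp_all
        then show ?thesis using zc ann_zero[OF JR] unfolding M_def by blast
      next
        case (Suc k)
        then obtain v where v: "v \<in> ann k (colon R J a)" "z = \<delta> k v" using z by (auto simp: cobounds_def)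
        obtain w where w: "w \<in> ann k J" "a \<odot>\<^bsub>E k\<^esub> w = v" using ann_colon_lift[OF J a v(1)] by blast
        have "a \<odot>\<^bsub>E n\<^esub> \<delta> k w = z" using \<delta>_smult[OF a ann_closed[OF w(1)]] w(2) v(2) Suc by simp
        moreover have "\<delta> k w \<in> ann n J" using ann_\<delta>[OF w(1) JR] Suc by simp
        moreover have "\<delta> n (\<delta> k w) \<in> N i"
          using \<delta>_\<delta>[OF ann_closed[OF w(1)]] submodule_zero[OF sN] Suc by simp
        ultimately show ?thesis using zc unfolding M_def by blast
      qed
    qed
  qed
  obtain k1 where k1: "\<forall>i\<ge>k1. S i = S k1" using A2 S unfolding ext_acc_def by blast
  obtain k2 where k2: "\<forall>i\<ge>k2. M i = M k2" using A1 M unfolding ext_acc_def by blast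
  define k where "k = max k1 k2"
  have "N i = N k" if ik: "i \<ge> k" for i
  proof
    show "N k \<subseteq> N i" using mono ik by blast
    have "k1 \<le> k" "k2 \<le> k" "k1 \<le> i" "k2 \<le> i" using ik by (simp_all add: k_def)
    then have Si: "S i = S k" and Mi: "M i = M k"
      using spec[OF k1, of i] spec[OF k1, of k] spec[OF k2, of i] spec[OF k2, of k] by simp_all
    show "N i \<subseteq> N k"
    proof
      fix x assume x: "x \<in> N i"
      have "N i \<subseteq> S i" unfolding S_def by (rule submodule_sum(2)[OF sN cobounds_submodule[OF JR]])
      then have "x \<in> S k" using x Si by blast
      then obtain y w where y: "y \<in> N k" and w: "w \<in> ann n J" and xy: "x = y \<oplus>\<^bsub>E (Suc n)\<^esub> \<delta> n w"
        by (auto simp: S_def cobounds_def)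
      have wE: "w \<in> carrier (E n)" using ann_closed[OF w] .
      have yE: "y \<in> carrier (E (Suc n))" and xE: "x \<in> carrier (E (Suc n))" using y x n(1) by blast+
      have "\<delta> n w = x \<ominus>\<^bsub>E (Suc n)\<^esub> y"
        unfolding xy E1.M.a_comm[OF yE \<delta>_closed[OF wE]]
        using yE \<delta>_closed[OF wE] by (simp add: a_minus_def E1.M.a_assoc E1.M.r_neg)
      moreover have "x \<ominus>\<^bsub>E (Suc n)\<^esub> y \<in> N i"
        using n(3,5) x y mono[OF ik] by (auto simp: a_minus_def)
      ultimately have dw: "\<delta> n w \<in> N i" by simp
      then have "\<delta> n w \<in> cocycles (Suc n) ?K" using N by blast
      then have "a \<odot>\<^bsub>E (Suc n)\<^esub> \<delta> n w = \<zero>\<^bsub>E (Suc n)\<^esub>"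
        using ann_plus_gen_iff[OF J a] by (auto simp: cocycles_def)
      then have "a \<odot>\<^bsub>E n\<^esub> w \<in> cocycles n (colon R J a)"
        using smult_ann_colon[OF J a w] \<delta>_smult[OF a wE] by (simp add: cocycles_def)
      then have "a \<odot>\<^bsub>E n\<^esub> w \<in> M i" using w dw by (auto simp: M_def)
      then have "a \<odot>\<^bsub>E n\<^esub> w \<in> M k" using Mi by simp
      then obtain w2 where w2: "w2 \<in> ann n J" "a \<odot>\<^bsub>E n\<^esub> w2 = a \<odot>\<^bsub>E n\<^esub> w" "\<delta> n w2 \<in> N k"
        by (auto simp: M_def)
      have w2E: "w2 \<in> carrier (E n)" using ann_closed[OF w2(1)] .
      have "a \<odot>\<^bsub>E n\<^esub> (w \<ominus>\<^bsub>E n\<^esub> w2) = \<zero>\<^bsub>E n\<^esub>"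
        using E.smult_minus_distr[OF a wE w2E] w2(2) E.minus_eq_zero_iff a wE by simp
      then have "w \<ominus>\<^bsub>E n\<^esub> w2 \<in> ann n ?K" using ann_minus[OF w w2(1) JR] ann_plus_gen_iff[OF J a] by blast
      then have "\<delta> n (w \<ominus>\<^bsub>E n\<^esub> w2) \<in> cobounds (Suc n) ?K" by (simp add: cobounds_def)
      then have "\<delta> n (w \<ominus>\<^bsub>E n\<^esub> w2) \<in> N k" using N by blast
      then have "\<delta> n (w \<ominus>\<^bsub>E n\<^esub> w2) \<oplus>\<^bsub>E (Suc n)\<^esub> \<delta> n w2 \<in> N k" using w2(3) n(5) by blast
      then have "\<delta> n w \<in> N k"
        using \<delta>_minus[OF wE w2E] E1.minus_add_cancel[OF \<delta>_closed[OF wE] \<delta>_closed[OF w2E]] by simp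
      then show "x \<in> N k" using xy y n(5) by blast
    qed
  qed
  then show "\<exists>k. \<forall>i\<ge>k. N i = N k" by blast
qed

lemma ext_acc:
  assumes "noetherian_ring R" "ideal J R" shows "ext_acc n J"
  using assms(2)
proof (induction n arbitrary: J)
  case 0 then show ?case using ext_acc_0[OF assms(1)] by simp
next
  case (Suc n)
  define S where "S = {K. ideal K R \<and> K \<subseteq> J \<and> ext_acc (Suc n) K}"
  have z: "{\<zero>} \<in> S"
    using zeroideal ext_acc_zero_ideal ideal_zero[OF Suc.prems]
    by (simp add: S_def)
  have idS: "ideal K R" if "K \<in> S" for K using that by (simp add: S_def)
  obtain K where "K \<in> S" "{\<zero>} \<subseteq> K" and K: "\<And>L. L \<in> S \<Longrightarrow> K \<subseteq> L \<Longrightarrow> L = K"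
    using noetherian_maximal[OF assms(1) idS z] by metis
  then have KI: "ideal K R" and KJ: "K \<subseteq> J" and KA: "ext_acc (Suc n) K" by (simp_all add: S_def)
  have "J \<subseteq> K"
  proof
    fix a assume a: "a \<in> J"
    have aR: "a \<in> carrier R" using ideal_carr[OF Suc.prems] a by blast
    have "plus_gen R K a \<in> S"
      using ideal_plus_gen[OF KI aR] plus_gen_minimal[OF Suc.prems KJ a]
        ext_acc_plus_gen[OF KI aR Suc.IH[OF ideal_colon[OF KI aR]] KA] by (simp add: S_def)
    then have "plus_gen R K a = K" using K plus_gen_incl(1)[OF KI aR] by blast
    then show "a \<in> K" using plus_gen_incl(2)[OF KI aR] by blast
  qed
  then have "J = K" using KJ by blast
  then show ?case using KA by simp
qed

end

section \<open>Zero divisors modulo an ideal\<close>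

fun regular_on :: "('a, 'r) ring_scheme \<Rightarrow> 'a set \<Rightarrow> 'a list \<Rightarrow> bool" where
  "regular_on R J [] \<longleftrightarrow> J \<noteq> carrier R"
| "regular_on R J (x # xs) \<longleftrightarrow> colon R J x \<subseteq> J \<and> regular_on R (plus_gen R J x) xs"

definition adjoin :: "('a, 'r) ring_scheme \<Rightarrow> 'a set \<Rightarrow> 'a list \<Rightarrow> 'a set" where
  "adjoin R J xs = foldl (plus_gen R) J xs"

lemma adjoin_simps [simp]:
  "adjoin R J [] = J" "adjoin R J (x # xs) = adjoin R (plus_gen R J x) xs"
  "adjoin R J (xs @ [x]) = plus_gen R (adjoin R J xs) x"
  by (simp_all add: adjoin_def)

lemma regular_on_adjoin: "regular_on R J xs \<Longrightarrow> adjoin R J xs \<noteq> carrier R"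
  by (induction xs arbitrary: J) auto

lemma regular_on_append:
  "regular_on R J xs \<Longrightarrow> colon R (adjoin R J xs) x \<subseteq> adjoin R J xs \<Longrightarrow>
    plus_gen R (adjoin R J xs) x \<noteq> carrier R \<Longrightarrow> regular_on R J (xs @ [x])"
  by (induction xs arbitrary: J) auto

context cring
begin

lemma ideal_adjoin: "ideal J R \<Longrightarrow> set xs \<subseteq> carrier R \<Longrightarrow> ideal (adjoin R J xs) R"
  by (induction xs arbitrary: J) (auto simp: ideal_plus_gen)

lemma adjoin_incl: "ideal J R \<Longrightarrow> set xs \<subseteq> carrier R \<Longrightarrow> J \<union> set xs \<subseteq> adjoin R J xs"
proof (induction xs arbitrary: J)
  case (Cons x xs)
  then have x: "x \<in> carrier R" by simp
  have "plus_gen R J x \<union> set xs \<subseteq> adjoin R J (x # xs)"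
    using Cons.IH[OF ideal_plus_gen[OF Cons.prems(1) x]] Cons.prems(2) by simp
  then show ?case using plus_gen_incl[OF Cons.prems(1) x] by auto
qed simp

lemma adjoin_minimal: "ideal K R \<Longrightarrow> J \<subseteq> K \<Longrightarrow> set xs \<subseteq> K \<Longrightarrow> adjoin R J xs \<subseteq> K"
  by (induction xs arbitrary: J) (auto simp: plus_gen_minimal)

lemma prime_not_supset_Inter:
  assumes "finite Q" "primeideal P R" "ideal I R" "\<not> I \<subseteq> P" "\<And>K. K \<in> Q \<Longrightarrow> ideal K R \<and> \<not> K \<subseteq> P"
  shows "\<exists>r\<in>I. r \<notin> P \<and> (\<forall>K\<in>Q. r \<in> K)"
  using assms(1,5)
proof (induction Q rule: finite_induct)
  case empty then show ?case using assms(4) by blast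
next
  case (insert K Q)
  then obtain r where r: "r \<in> I" "r \<notin> P" "\<forall>K\<in>Q. r \<in> K" by blast
  obtain s where s: "s \<in> K" "s \<notin> P" using insert.prems[of K] by blast
  have K: "ideal K R" using insert.prems by blast
  have c: "r \<in> carrier R" "s \<in> carrier R" using r s ideal.Icarr assms(3) K by metis+
  have "r \<otimes> s \<notin> P" using primeideal.I_prime[OF assms(2) c] r s by blast
  moreover have "r \<otimes> s \<in> I" using ideal.I_r_closed[OF assms(3) r(1) c(2)] .
  moreover have "r \<otimes> s \<in> K" using ideal.I_l_closed[OF K s(1) c(1)] .
  moreover have "r \<otimes> s \<in> L" if "L \<in> Q" for L
    using ideal.I_r_closed[of L R r s] insert.prems[of L] that r(3) c(2) by blast
  ultimately show ?case by blast
qed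

lemma prime_avoidance:
  assumes "finite Q" "ideal I R" "\<And>P. P \<in> Q \<Longrightarrow> primeideal P R \<and> \<not> I \<subseteq> P"
    and "\<And>P P'. P \<in> Q \<Longrightarrow> P' \<in> Q \<Longrightarrow> P \<subseteq> P' \<Longrightarrow> P = P'"
  shows "\<exists>x\<in>I. \<forall>P\<in>Q. x \<notin> P"
  using assms(1,3,4)
proof (induction Q rule: finite_induct)
  case empty
  then show ?case using ideal_zero[OF assms(2)] by blast
next
  case (insert P Q)
  have "\<exists>x\<in>I. \<forall>P\<in>Q. x \<notin> P"
    by (rule insert.IH) (use insert.prems in auto)
  then obtain x where x: "x \<in> I" "\<forall>P\<in>Q. x \<notin> P" by blast
  show ?case
  proof (cases "x \<in> P")
    case False then show ?thesis using x by blast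
  next
    case True
    have P: "primeideal P R" "\<not> I \<subseteq> P" using insert.prems(1)[of P] by auto
    have "ideal K R \<and> \<not> K \<subseteq> P" if K: "K \<in> Q" for K
    proof
      show "ideal K R" using insert.prems(1)[of K] K primeideal.axioms(1) by blast
      show "\<not> K \<subseteq> P" using insert.prems(2)[of K P] K insert.hyps(2) by blast
    qed
    then obtain r where r: "r \<in> I" "r \<notin> P" "\<forall>K\<in>Q. r \<in> K"
      using prime_not_supset_Inter[OF insert.hyps(1) P(1) assms(2) P(2)] by blast
    have c: "x \<in> carrier R" "r \<in> carrier R" using x(1) r(1) ideal.Icarr[OF assms(2)] by auto
    have sum: "x \<oplus> r \<in> I" using x(1) r(1) additive_subgroup.a_closed[OF ideal.axioms(1)[OF assms(2)]] by blast
    have diff: "y \<in> K" if "ideal K R" "z \<in> K" "z \<oplus> y \<in> K" "y \<in> carrier R" for K y z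
    proof -
      have z: "z \<in> carrier R" using ideal.Icarr[OF that(1,2)] .
      have "y = (z \<oplus> y) \<ominus> z" using z that(4) by algebra
      then show ?thesis using ideal_minus[OF that(1,3,2)] by simp
    qed
    have "x \<oplus> r \<notin> P" using diff[of P x r] P(1) primeideal.axioms(1) True c r(2) by blast
    moreover have "x \<oplus> r \<notin> K" if K: "K \<in> Q" for K
    proof
      assume "x \<oplus> r \<in> K"
      then have "r \<oplus> x \<in> K" using c by (simp add: a_comm)
      moreover have "ideal K R" using insert.prems(1)[of K] K primeideal.axioms(1) by blast
      ultimately have "x \<in> K" using diff[of K r x] r(3) K c by blast
      then show False using x(2) K by blast
    qed
    ultimately show ?thesis using sum by blast
  qed
qed

end

context
  fixes R :: "('a, 'r) ring_scheme" (structure) and \<mm> :: "'a set"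
  assumes loc: "noetherian_local R \<mm>"
begin

lemma local_cring: "cring R" using loc by (simp add: noetherian_local_def)
lemma local_noetherian: "noetherian_ring R" using loc by (simp add: noetherian_local_def)
lemma local_max: "maximalideal \<mm> R" using loc by (simp add: noetherian_local_def)
lemma local_max_ideal: "ideal \<mm> R" using local_max maximalideal.axioms(1) by blast
lemma local_max_proper: "\<mm> \<noteq> carrier R" using maximalideal.I_notcarr[OF local_max] by simp

lemma proper_subset_max:
  assumes J: "ideal J R" "J \<noteq> carrier R" shows "J \<subseteq> \<mm>"
proof -
  interpret cring R by (rule local_cring)
  define S where "S = {K. ideal K R \<and> K \<noteq> carrier R}"
  have JS: "J \<in> S" and idS: "\<And>K. K \<in> S \<Longrightarrow> ideal K R" using J by (simp_all add: S_def)
  obtain K where K: "K \<in> S" "J \<subseteq> K" "\<And>L. L \<in> S \<Longrightarrow> K \<subseteq> L \<Longrightarrow> L = K"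
    using noetherian_maximal[OF local_noetherian idS JS] by metis
  have "maximalideal K R"
  proof (rule maximalidealI)
    show "ideal K R" "carrier R \<noteq> K" using K(1) by (auto simp: S_def)
    fix L assume "ideal L R" "K \<subseteq> L" "L \<subseteq> carrier R"
    then show "L = K \<or> L = carrier R" using K(3)[of L] by (auto simp: S_def)
  qed
  then have "K = \<mm>" using loc by (simp add: noetherian_local_def)
  then show ?thesis using K(2) by simp
qed

lemma unit_of_not_in_max:
  assumes "x \<in> carrier R" "x \<notin> \<mm>" shows "\<exists>y\<in>carrier R. y \<otimes> x = \<one>"
proof -
  interpret cring R by (rule local_cring)
  have "\<not> PIdl x \<subseteq> \<mm>" using cgenideal_self[OF assms(1)] assms(2) by blast
  then have "PIdl x = carrier R" using proper_subset_max[OF cgenideal_ideal[OF assms(1)]] by blast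
  then have "\<one> \<in> PIdl x" by simp
  then show ?thesis unfolding cgenideal_def by force
qed

text \<open>
  Kaplansky's argument: the maximal annihilators \<open>(J : y)\<close> are prime and only finitely many,
  and their union consists of the zero divisors modulo \<open>J\<close>.
\<close>

lemma max_eq_colon:
  assumes J: "ideal J R"
    and zd: "\<And>x. x \<in> \<mm> \<Longrightarrow> \<exists>y\<in>carrier R. y \<notin> J \<and> y \<otimes> x \<in> J"
  shows "\<exists>w\<in>carrier R. w \<notin> J \<and> colon R J w = \<mm>"
proof -
  interpret cring R by (rule local_cring)
  interpret J: ideal J R by fact
  define T where "T = {y \<in> carrier R. y \<notin> J}"
  define M where "M = {y \<in> T. \<forall>z\<in>T. colon R J y \<subseteq> colon R J z \<longrightarrow> colon R J z = colon R J y}"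
  have TR: "y \<in> carrier R" if "y \<in> T" for y using that by (simp add: T_def)
  have MT: "y \<in> T" if "y \<in> M" for y using that by (simp add: M_def)
  have Mmax: "colon R J z = colon R J y" if "y \<in> M" "z \<in> T" "colon R J y \<subseteq> colon R J z" for y z
    using that by (simp add: M_def)
  have idc: "ideal (colon R J y) R" if "y \<in> T" for y using ideal_colon[OF J TR[OF that]] .
  have proper: "colon R J y \<noteq> carrier R" if "y \<in> T" for y
  proof
    assume "colon R J y = carrier R"
    then have "\<one> \<in> colon R J y" by simp
    then show False using that by (simp add: colon_def T_def)
  qed
  have prime: "primeideal (colon R J y) R" if y: "y \<in> M" for y
  proof (rule primeidealI[OF idc[OF MT[OF y]] is_cring])
    show "carrier R \<noteq> colon R J y" using proper[OF MT[OF y]] by simp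
    fix a b assume a: "a \<in> carrier R" and b: "b \<in> carrier R" and ab: "a \<otimes> b \<in> colon R J y"
    have yR: "y \<in> carrier R" using TR[OF MT[OF y]] .
    show "a \<in> colon R J y \<or> b \<in> colon R J y"
    proof (cases "b \<in> colon R J y")
      case False
      then have by_T: "b \<otimes> y \<in> T" using b yR by (simp add: T_def colon_def)
      have "colon R J y \<subseteq> colon R J (b \<otimes> y)"
      proof
        fix x assume "x \<in> colon R J y"
        then have x: "x \<in> carrier R" "b \<otimes> (x \<otimes> y) \<in> J" using J.I_l_closed b by (auto simp: colon_def)
        then show "x \<in> colon R J (b \<otimes> y)" using b yR by (simp add: colon_def m_lcomm)
      qed
      then have "colon R J (b \<otimes> y) = colon R J y" using Mmax[OF y by_T] by blast
      moreover have "a \<in> colon R J (b \<otimes> y)" using ab a b yR by (simp add: colon_def m_assoc)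
      ultimately show ?thesis by blast
    qed simp
  qed
  define S where "S = {adjoin R J ys | ys. set ys \<subseteq> M}"
  have MR: "set ys \<subseteq> carrier R" if "set ys \<subseteq> M" for ys using that TR MT by blast
  have idS: "ideal K R" if "K \<in> S" for K using that ideal_adjoin[OF J MR] by (auto simp: S_def)
  have JS: "J \<in> S" unfolding S_def by (rule CollectI, rule exI[of _ "[]"]) simp
  obtain K where K: "K \<in> S" "\<And>L. L \<in> S \<Longrightarrow> K \<subseteq> L \<Longrightarrow> L = K"
    using noetherian_maximal[OF local_noetherian idS JS] by metis
  then obtain ys where ys: "K = adjoin R J ys" "set ys \<subseteq> M" by (auto simp: S_def)
  have MK: "y \<in> K" if y: "y \<in> M" for y
  proof -
    have KI: "ideal K R" and yR: "y \<in> carrier R" using idS[OF K(1)] TR[OF MT[OF y]] by auto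
    have "plus_gen R K y \<in> S"
      unfolding S_def using ys y by (intro CollectI exI[of _ "ys @ [y]"]) simp
    then have "plus_gen R K y = K" using K(2) plus_gen_incl(1)[OF KI yR] by blast
    then show ?thesis using plus_gen_incl(2)[OF KI yR] by blast
  qed
  define Q where "Q = colon R J ` set ys"
  have "finite Q" by (simp add: Q_def)
  have inQ: "colon R J y \<in> Q" if y: "y \<in> M" for y
  proof (rule ccontr)
    assume n: "colon R J y \<notin> Q"
    have "ideal L R \<and> \<not> L \<subseteq> colon R J y" if "L \<in> Q" for L
    proof -
      obtain z where z: "z \<in> M" "L = colon R J z" using \<open>L \<in> Q\<close> ys(2) by (auto simp: Q_def)
      then show ?thesis using Mmax[OF z(1) MT[OF y]] n \<open>L \<in> Q\<close> idc[OF MT[OF z(1)]] by metis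
    qed
    moreover have "\<not> carrier R \<subseteq> colon R J y" using proper[OF MT[OF y]] by (auto simp: colon_def)
    ultimately obtain r where r: "r \<in> carrier R" "r \<notin> colon R J y" "\<forall>L\<in>Q. r \<in> L"
      using prime_not_supset_Inter[OF \<open>finite Q\<close> prime[OF y] oneideal] by blast
    have "set ys \<subseteq> colon R J r"
    proof
      fix z assume z: "z \<in> set ys"
      then have "r \<in> colon R J z" using r(3) by (simp add: Q_def)
      moreover have "z \<in> carrier R" using z MR[OF ys(2)] by blast
      ultimately show "z \<in> colon R J r" using r(1) by (simp add: colon_def m_comm)
    qed
    then have "K \<subseteq> colon R J r"
      unfolding ys(1) by (rule adjoin_minimal[OF ideal_colon[OF J r(1)] colon_incl[OF J r(1)]])
    then have "y \<in> colon R J r" using MK[OF y] by blast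
    then have "r \<otimes> y \<in> J" "y \<in> carrier R" using r(1) by (auto simp: colon_def m_comm)
    then show False using r(1,2) by (simp add: colon_def)
  qed
  have cover: "\<exists>L\<in>Q. x \<in> L" if x: "x \<in> \<mm>" for x
  proof -
    have xR: "x \<in> carrier R" using x ideal.Icarr[OF local_max_ideal] by blast
    obtain y0 where y0: "y0 \<in> carrier R" "y0 \<notin> J" "y0 \<otimes> x \<in> J" using zd[OF x] by blast
    define C where "C = colon R J ` T"
    have y0C: "colon R J y0 \<in> C" and idC: "\<And>K. K \<in> C \<Longrightarrow> ideal K R"
      using y0 idc by (auto simp: C_def T_def)
    obtain L where L: "L \<in> C" "colon R J y0 \<subseteq> L" "\<And>K. K \<in> C \<Longrightarrow> L \<subseteq> K \<Longrightarrow> K = L"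
      using noetherian_maximal[OF local_noetherian idC y0C] by metis
    then obtain y where y: "y \<in> T" "L = colon R J y" by (auto simp: C_def)
    then have "y \<in> M" using L(3) by (auto simp: M_def C_def)
    moreover have "x \<in> L" using L(2) y0 xR by (auto simp: colon_def m_comm)
    ultimately show ?thesis using inQ y(2) by blast
  qed
  have Qprime: "primeideal L R" if "L \<in> Q" for L using that prime ys(2) by (auto simp: Q_def)
  have Qanti: "P = P'" if "P \<in> Q" "P' \<in> Q" "P \<subseteq> P'" for P P'
  proof -
    obtain y z where "y \<in> M" "P = colon R J y" "z \<in> M" "P' = colon R J z"
      using \<open>P \<in> Q\<close> \<open>P' \<in> Q\<close> ys(2) by (auto simp: Q_def)
    then show ?thesis using Mmax[of y z] MT that(3) by simp
  qed
  have "\<exists>L\<in>Q. \<mm> \<subseteq> L"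
  proof (rule ccontr)
    assume "\<not> (\<exists>L\<in>Q. \<mm> \<subseteq> L)"
    then have "\<exists>x\<in>\<mm>. \<forall>L\<in>Q. x \<notin> L"
      using Qprime by (intro prime_avoidance[OF \<open>finite Q\<close> local_max_ideal _ Qanti]) auto
    then show False using cover by blast
  qed
  then obtain w where w: "w \<in> M" "\<mm> \<subseteq> colon R J w" using ys(2) by (auto simp: Q_def)
  then have "colon R J w = \<mm>"
    using proper_subset_max[OF idc[OF MT[OF w(1)]] proper[OF MT[OF w(1)]]] by blast
  then show ?thesis using MT[OF w(1)] by (auto simp: T_def)
qed

end

section \<open>Regular sequences and the vanishing of Ext\<close>

locale local_injective_res = injective_res R \<epsilon> E \<delta>
  for R :: "('a, 'r) ring_scheme" (structure) and \<epsilon> :: "'a \<Rightarrow> 'e" and E \<delta> +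
  fixes \<mm> :: "'a set"
  assumes loc: "noetherian_local R \<mm>"
begin

lemma max_carr: "x \<in> \<mm> \<Longrightarrow> x \<in> carrier R"
  using ideal_carr[OF local_max_ideal[OF loc]] by blast

lemma nakayama:
  assumes J: "ideal J R" and a: "a \<in> \<mm>"
    and onto: "\<And>z. z \<in> cocycles n J \<Longrightarrow> \<exists>y\<in>cocycles n J. a \<odot>\<^bsub>E n\<^esub> y = z"
  shows "ext_vanishes n J"
proof (rule ccontr)
  interpret E: module R "E n" by (rule mod_E)
  note JR = ideal_carr[OF J]
  have aR: "a \<in> carrier R" using max_carr[OF a] .
  define S where "S = {N. submodule N R (E n) \<and> cobounds n J \<subseteq> N \<and> N \<subset> cocycles n J}"
  assume "\<not> ext_vanishes n J"
  then have S0: "cobounds n J \<in> S"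
    using cobounds_submodule[OF JR] cobounds_cocycles[OF JR] by (auto simp: S_def ext_vanishes_def)
  have "\<exists>N\<in>S. \<forall>N'\<in>S. \<not> N \<subset> N'"
  proof (rule ccontr)
    assume "\<not> (\<exists>N\<in>S. \<forall>N'\<in>S. \<not> N \<subset> N')"
    then have step: "\<exists>N'. N' \<in> S \<and> N \<subset> N'" if "N \<in> S" for N using that by blast
    obtain f where f: "\<And>i. f i \<in> S" "\<And>i. f i \<subset> f (Suc i)"
      using dependent_nat_choice[of "\<lambda>_ N. N \<in> S" "\<lambda>_ N N'. N \<subset> N'"] S0 step by metis
    have "\<exists>k. \<forall>i\<ge>k. f i = f k"
      using ext_acc[OF local_noetherian[OF loc] J, of n, unfolded ext_acc_def, THEN spec, of f] f(1)
        psubset_imp_subset[OF f(2)] by (auto simp: S_def)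
    then obtain k where "f (Suc k) = f k" by (meson le_SucI order_refl)
    then show False using f(2)[of k] by blast
  qed
  then obtain N where N: "N \<in> S" "\<And>N'. N' \<in> S \<Longrightarrow> \<not> N \<subset> N'" by blast
  then have sN: "submodule N R (E n)" and cN: "cobounds n J \<subseteq> N" and Nc: "N \<subset> cocycles n J" by (simp_all add: S_def)
  note n = E.submoduleE[OF sN] and c = E.submoduleE[OF cocycles_submodule[OF JR, of n]]
  have aN: "a \<odot>\<^bsub>E n\<^esub> z \<in> N" if z: "z \<in> cocycles n J" for z
  proof (rule ccontr)
    assume az: "a \<odot>\<^bsub>E n\<^esub> z \<notin> N"
    have zE: "z \<in> carrier (E n)" using cocycles_closed[OF z] .
    have azc: "a \<odot>\<^bsub>E n\<^esub> z \<in> cocycles n J" using c(4) aR z by blast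
    define L where "L = (\<lambda>r. r \<odot>\<^bsub>E n\<^esub> (a \<odot>\<^bsub>E n\<^esub> z)) ` carrier R"
    have "(\<lambda>r. r \<odot>\<^bsub>E n\<^esub> (a \<odot>\<^bsub>E n\<^esub> z)) \<in> lin_maps R (self_module R) (E n)"
      using zE aR by (intro lin_mapsI) (simp_all add: E.smult_l_distr E.smult_assoc1)
    then have sL: "submodule L R (E n)"
      unfolding L_def
      using submodule_image[OF self_module_is_module mod_E _ module.carrier_is_submodule[OF self_module_is_module]]
      by simp
    have "\<one> \<odot>\<^bsub>E n\<^esub> (a \<odot>\<^bsub>E n\<^esub> z) = a \<odot>\<^bsub>E n\<^esub> z" using zE aR by simp
    then have azL: "a \<odot>\<^bsub>E n\<^esub> z \<in> L" unfolding L_def by (metis imageI one_closed)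
    have Lc: "L \<subseteq> cocycles n J" unfolding L_def using c(4) azc by blast
    define N' where "N' = {x \<oplus>\<^bsub>E n\<^esub> y | x y. x \<in> N \<and> y \<in> L}"
    note s = submodule_sum[OF sN sL, folded N'_def]
    have "N' \<subseteq> cocycles n J" unfolding N'_def using Nc Lc c(5) by blast
    moreover have "N \<subset> N'" using s(2,3) azL az by blast
    ultimately have "N' = cocycles n J" using N(2)[of N'] s(1) cN by (auto simp: S_def)
    then obtain x r where x: "x \<in> N" and r: "r \<in> carrier R" and zx: "z = x \<oplus>\<^bsub>E n\<^esub> r \<odot>\<^bsub>E n\<^esub> (a \<odot>\<^bsub>E n\<^esub> z)"
      using z unfolding N'_def L_def by blast
    have ra: "r \<otimes> a \<in> \<mm>" using ideal.I_l_closed[OF local_max_ideal[OF loc] a r] .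
    then have raR: "r \<otimes> a \<in> carrier R" by (rule max_carr)
    have "\<one> \<ominus> r \<otimes> a \<notin> \<mm>"
    proof
      assume "\<one> \<ominus> r \<otimes> a \<in> \<mm>"
      then have "(\<one> \<ominus> r \<otimes> a) \<oplus> r \<otimes> a \<in> \<mm>"
        using ra additive_subgroup.a_closed[OF ideal.axioms(1)[OF local_max_ideal[OF loc]]] by blast
      moreover have "(\<one> \<ominus> r \<otimes> a) \<oplus> r \<otimes> a = \<one>" using raR by (simp add: a_minus_def a_assoc l_neg)
      ultimately show False
        using ideal.one_imp_carrier[OF local_max_ideal[OF loc]] local_max_proper[OF loc] by simp
    qed
    then obtain y where y: "y \<in> carrier R" "y \<otimes> (\<one> \<ominus> r \<otimes> a) = \<one>"
      using unit_of_not_in_max[OF loc, of "\<one> \<ominus> r \<otimes> a"] raR by auto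
    have xE: "x \<in> carrier (E n)" using x n(1) by blast
    have razE: "r \<odot>\<^bsub>E n\<^esub> (a \<odot>\<^bsub>E n\<^esub> z) \<in> carrier (E n)" using r aR zE by simp
    have "(\<one> \<ominus> r \<otimes> a) \<odot>\<^bsub>E n\<^esub> z = z \<ominus>\<^bsub>E n\<^esub> r \<odot>\<^bsub>E n\<^esub> (a \<odot>\<^bsub>E n\<^esub> z)"
      using zE r aR by (simp add: a_minus_def E.smult_l_distr E.smult_l_minus E.smult_assoc1)
    also have "\<dots> = (x \<oplus>\<^bsub>E n\<^esub> r \<odot>\<^bsub>E n\<^esub> (a \<odot>\<^bsub>E n\<^esub> z)) \<ominus>\<^bsub>E n\<^esub> r \<odot>\<^bsub>E n\<^esub> (a \<odot>\<^bsub>E n\<^esub> z)"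
      using zx by simp
    also have "\<dots> = x" using xE razE by (simp add: a_minus_def E.M.a_assoc E.M.r_neg)
    finally have "(\<one> \<ominus> r \<otimes> a) \<odot>\<^bsub>E n\<^esub> z = x" .
    then have "z = y \<odot>\<^bsub>E n\<^esub> x"
      using E.smult_assoc1[OF y(1) _ zE, of "\<one> \<ominus> r \<otimes> a"] y(2) raR zE by simp
    then have "z \<in> N" using n(4) y(1) x by simp
    then show False using az n(4) aR by blast
  qed
  have "cocycles n J \<subseteq> N" using onto aN by blast
  then show False using Nc by blast
qed

lemma ext_vanishes_of_regular_elem:
  assumes J: "ideal J R" and a: "a \<in> \<mm>" and reg: "colon R J a \<subseteq> J"
    and V: "ext_vanishes (Suc n) (plus_gen R J a)"
  shows "ext_vanishes n J"
proof (rule nakayama[OF J a])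
  have aR: "a \<in> carrier R" using max_carr[OF a] .
  have "colon R J a = J" using reg colon_incl[OF J aR] by blast
  then show "\<exists>y\<in>cocycles n J. a \<odot>\<^bsub>E n\<^esub> y = z" if "z \<in> cocycles n J" for z
    using cocycle_colon_lift[OF J aR V] that by simp
qed

lemma ext_vanishes_of_regular_seq:
  assumes top: "\<And>n K. n > D \<Longrightarrow> ideal K R \<Longrightarrow> ext_vanishes n K"
    and "ideal J R" "set xs \<subseteq> \<mm>" "regular_on R J xs" "n + length xs > D"
  shows "ext_vanishes n J"
  using assms(2-)
proof (induction xs arbitrary: J n)
  case Nil then show ?case using top by simp
next
  case (Cons x xs)
  then have x: "x \<in> \<mm>" "x \<in> carrier R" using max_carr by auto
  show ?case
    using Cons.prems x Cons.IH[OF ideal_plus_gen[OF Cons.prems(1) x(2)], of "Suc n"]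
    by (intro ext_vanishes_of_regular_elem[OF Cons.prems(1) x(1)]) auto
qed

lemma ext_vanishes_adjoin:
  assumes "ideal J R" "set xs \<subseteq> \<mm>" "regular_on R J xs" "\<And>n. n > p \<Longrightarrow> ext_vanishes n J"
    and "n > p + length xs"
  shows "ext_vanishes n (adjoin R J xs)"
  using assms
proof (induction xs arbitrary: J p)
  case (Cons x xs)
  then have x: "x \<in> \<mm>" "x \<in> carrier R" using max_carr by auto
  have "ext_vanishes m (plus_gen R J x)" if m: "m > Suc p" for m
  proof -
    obtain k where k: "m = Suc k" "k > p" using m by (cases m) auto
    have "colon R J x = J" using Cons.prems(3) colon_incl[OF Cons.prems(1) x(2)] by auto
    then show ?thesis
      using ext_vanishes_plus_gen[OF Cons.prems(1) x(2), of k] Cons.prems(4) k by simp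
  qed
  then show ?case
    using Cons.IH[OF ideal_plus_gen[OF Cons.prems(1) x(2)], of "Suc p"] Cons.prems by simp
qed simp

lemma ext_vanishes_carrier: "ext_vanishes n (carrier R)"
proof -
  interpret E: module R "E n" by (rule mod_E)
  have "x = \<zero>\<^bsub>E n\<^esub>" if "x \<in> cocycles n (carrier R)" for x
    using that E.smult_one[of x] one_closed by (auto simp: cocycles_def ann_def)
  then show ?thesis
    using submodule_zero[OF cobounds_submodule[OF subset_refl]] by (auto simp: ext_vanishes_def)
qed

lemma ext_vanishes_of_residue_field:
  assumes top: "\<And>K. ideal K R \<Longrightarrow> ext_vanishes (Suc n) K" and V: "ext_vanishes n \<mm>"
    and I: "ideal I R"
  shows "ext_vanishes n I"
proof (rule ccontr)
  assume nI: "\<not> ext_vanishes n I"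
  define S where "S = {K. ideal K R \<and> \<not> ext_vanishes n K}"
  have IS: "I \<in> S" and idS: "\<And>K. K \<in> S \<Longrightarrow> ideal K R" using nI I by (simp_all add: S_def)
  obtain J where J: "J \<in> S" "\<And>L. L \<in> S \<Longrightarrow> J \<subseteq> L \<Longrightarrow> L = J"
    using noetherian_maximal[OF local_noetherian[OF loc] idS IS] by metis
  have JI: "ideal J R" and nJ: "\<not> ext_vanishes n J" using J(1) by (simp_all add: S_def)
  have "J \<noteq> carrier R" using nJ ext_vanishes_carrier by auto
  then have "J \<subseteq> \<mm>" by (rule proper_subset_max[OF loc JI])
  moreover have "J \<noteq> \<mm>" using nJ V by auto
  ultimately obtain x where x: "x \<in> \<mm>" "x \<notin> J" by blast
  have xR: "x \<in> carrier R" using max_carr[OF x(1)] .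
  have big: "ext_vanishes n K" if "ideal K R" "J \<subseteq> K" "K \<noteq> J" for K
    using J(2)[of K] that by (auto simp: S_def)
  have V1: "ext_vanishes n (plus_gen R J x)"
    using big[OF ideal_plus_gen[OF JI xR]] plus_gen_incl[OF JI xR] x(2) by blast
  show False
  proof (cases "colon R J x \<subseteq> J")
    case True
    then show False using ext_vanishes_of_regular_elem[OF JI x(1) True top[OF ideal_plus_gen[OF JI xR]]] nJ by blast
  next
    case False
    then have "ext_vanishes n (colon R J x)"
      using big[OF ideal_colon[OF JI xR] colon_incl[OF JI xR]] by blast
    then show False using ext_vanishes_middle[OF JI xR V1] nJ by blast
  qed
qed

lemma ex_long_regular_seq:
  assumes top: "\<And>n K. n > D \<Longrightarrow> ideal K R \<Longrightarrow> ext_vanishes n K"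
    and least: "D = 0 \<or> (\<exists>K. ideal K R \<and> \<not> ext_vanishes D K)"
    and J: "ideal J R" "J \<noteq> carrier R" and p: "\<And>n. n > p \<Longrightarrow> ext_vanishes n J"
  shows "\<exists>xs. set xs \<subseteq> \<mm> \<and> regular_on R J xs \<and> D \<le> p + length xs"
proof -
  define S where "S = {adjoin R J xs | xs. set xs \<subseteq> \<mm> \<and> regular_on R J xs}"
  have mR: "set xs \<subseteq> carrier R" if "set xs \<subseteq> \<mm>" for xs using that max_carr by blast
  have idS: "ideal K R" if "K \<in> S" for K using that ideal_adjoin[OF J(1) mR] by (auto simp: S_def)
  have JS: "J \<in> S" unfolding S_def using J(2) by (intro CollectI exI[of _ "[]"]) simp
  obtain K where K: "K \<in> S" "\<And>L. L \<in> S \<Longrightarrow> K \<subseteq> L \<Longrightarrow> L = K"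
    using noetherian_maximal[OF local_noetherian[OF loc] idS JS] by metis
  then obtain xs where xs: "set xs \<subseteq> \<mm>" "regular_on R J xs" "K = adjoin R J xs" by (auto simp: S_def)
  have KI: "ideal K R" using idS[OF K(1)] .
  have Kc: "K \<noteq> carrier R" using regular_on_adjoin[OF xs(2)] xs(3) by simp
  have zd: "\<exists>y\<in>carrier R. y \<notin> K \<and> y \<otimes> x \<in> K" if x: "x \<in> \<mm>" for x
  proof (rule ccontr)
    assume "\<not> (\<exists>y\<in>carrier R. y \<notin> K \<and> y \<otimes> x \<in> K)"
    then have reg: "colon R K x \<subseteq> K" by (auto simp: colon_def)
    have xR: "x \<in> carrier R" using max_carr[OF x] .
    have "plus_gen R K x \<subseteq> \<mm>"
      by (rule plus_gen_minimal[OF local_max_ideal[OF loc] proper_subset_max[OF loc KI Kc] x])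
    then have "plus_gen R K x \<noteq> carrier R"
      using local_max_proper[OF loc] ideal_carr[OF local_max_ideal[OF loc]] by blast
    then have "regular_on R J (xs @ [x])" using regular_on_append[OF xs(2)] reg xs(3) by simp
    then have "plus_gen R K x \<in> S"
      unfolding S_def using xs x by (intro CollectI exI[of _ "xs @ [x]"]) simp
    then have "plus_gen R K x = K" using K(2) plus_gen_incl(1)[OF KI xR] by blast
    then have "x \<in> K" using plus_gen_incl(2)[OF KI xR] by blast
    then have "\<one> \<in> colon R K x" using xR by (simp add: colon_def)
    then have "\<one> \<in> K" using reg by blast
    then show False using ideal.one_imp_carrier[OF KI] Kc by blast
  qed
  have "D \<le> p + length xs"
  proof (rule ccontr)
    assume n: "\<not> D \<le> p + length xs"
    obtain w where w: "w \<in> carrier R" "colon R K w = \<mm>" using max_eq_colon[OF loc KI zd] by blast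
    have "ext_vanishes D K"
      unfolding xs(3) using n p by (intro ext_vanishes_adjoin[OF J(1) xs(1,2)]) auto
    moreover have "ext_vanishes (Suc D) (plus_gen R K w)" using top ideal_plus_gen[OF KI w(1)] by simp
    ultimately have "ext_vanishes D \<mm>" using ext_vanishes_colon[OF KI w(1)] w(2) by simp
    then have "ext_vanishes D I" if "ideal I R" for I
      using ext_vanishes_of_residue_field[OF _ _ that, of D] top by simp
    then show False using least n by auto
  qed
  then show ?thesis using xs by blast
qed

end

section \<open>Depth of cyclic modules\<close>

lemma mem_a_r_coset: "y \<in> A +>\<^bsub>M\<^esub> x \<longleftrightarrow> (\<exists>b\<in>A. y = b \<oplus>\<^bsub>M\<^esub> x)"
  by (auto simp: a_r_coset_def')

lemma regular_on_iff:
  "regular_on R J xs \<longleftrightarrow> adjoin R J xs \<noteq> carrier R \<and>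
    (\<forall>i<length xs. colon R (adjoin R J (take i xs)) (xs ! i) \<subseteq> adjoin R J (take i xs))"
proof (induction xs arbitrary: J)
  case (Cons x xs)
  show ?case by (simp add: Cons.IH All_less_Suc2) blast
qed simp

context cring
begin

lemma coset_lin:
  assumes "ideal J R" shows "(\<lambda>r. J +> r) \<in> lin_maps R (self_module R) (quot_by_ideal R J)"
  using ideal.add_quot_by_ideal[OF assms] ideal.smult_quot_by_ideal[OF assms]
  by (intro lin_mapsI) (auto simp: carrier_quot_by_ideal)

lemma mem_coset_image_iff:
  assumes "ideal J R" "ideal K R" "J \<subseteq> K" "r \<in> carrier R"
  shows "J +> r \<in> (\<lambda>r. J +> r) ` K \<longleftrightarrow> r \<in> K"
proof
  assume "J +> r \<in> (\<lambda>r. J +> r) ` K"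
  then obtain s where s: "s \<in> K" "J +> r = J +> s" by blast
  have sR: "s \<in> carrier R" using s(1) ideal.Icarr[OF assms(2)] by blast
  have "r \<ominus> s \<in> K" using s(2) ideal.coset_eq_iff[OF assms(1,4) sR] assms(3) by blast
  then have "(r \<ominus> s) \<oplus> s \<in> K"
    using s(1) additive_subgroup.a_closed[OF ideal.axioms(1)[OF assms(2)]] by blast
  moreover have "(r \<ominus> s) \<oplus> s = r" using assms(4) sR by (simp add: a_minus_def a_assoc l_neg)
  ultimately show "r \<in> K" by simp
qed blast

lemma seq_submodule_quot:
  assumes J: "ideal J R" and xs: "set xs \<subseteq> carrier R"
  shows "seq_submodule R (quot_by_ideal R J) xs = (\<lambda>r. J +> r) ` adjoin R J xs"
proof
  let ?Q = "quot_by_ideal R J"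
  have Q: "module R ?Q" using module_quot[OF is_cring J] .
  interpret Q: module R ?Q by (rule Q)
  have K: "ideal (adjoin R J xs) R" by (rule ideal_adjoin[OF J xs])
  have "submodule ((\<lambda>r. J +> r) ` adjoin R J xs) R ?Q"
    using submodule_image[OF self_module_is_module Q coset_lin[OF J]] K submodule_self by blast
  moreover have "a \<odot>\<^bsub>?Q\<^esub> y \<in> (\<lambda>r. J +> r) ` adjoin R J xs" if a: "a \<in> set xs" and y: "y \<in> carrier ?Q" for a y
  proof -
    obtain s where s: "s \<in> carrier R" "y = J +> s" using y by (auto simp: carrier_quot_by_ideal)
    have "a \<in> adjoin R J xs" using adjoin_incl[OF J xs] a by blast
    then have "a \<otimes> s \<in> adjoin R J xs" using ideal.I_r_closed[OF K] s(1) by blast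
    then show ?thesis using ideal.smult_quot_by_ideal[OF J _ s(1), of a] s(2) a xs by auto
  qed
  ultimately show "seq_submodule R ?Q xs \<subseteq> (\<lambda>r. J +> r) ` adjoin R J xs"
    unfolding seq_submodule_def by blast
  show "(\<lambda>r. J +> r) ` adjoin R J xs \<subseteq> seq_submodule R ?Q xs"
    unfolding seq_submodule_def
  proof (intro Inter_greatest)
    fix N assume "N \<in> {N. submodule N R ?Q \<and> (\<forall>a\<in>set xs. \<forall>y\<in>carrier ?Q. a \<odot>\<^bsub>?Q\<^esub> y \<in> N)}"
    then have N: "submodule N R ?Q" and aN: "\<And>a y. a \<in> set xs \<Longrightarrow> y \<in> carrier ?Q \<Longrightarrow> a \<odot>\<^bsub>?Q\<^esub> y \<in> N" by auto
    note n = Q.submoduleE[OF N]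
    have z: "J \<in> N" using submodule_zero[OF N] by simp
    define L where "L = {s \<in> carrier R. J +> s \<in> N}"
    have "ideal L R"
    proof (rule idealI')
      show "\<zero> \<in> L" using ideal.coset_eq_self_iff[OF J, of \<zero>] z
          ideal_zero[OF J] by (simp add: L_def)
      show "x \<oplus> y \<in> L" if "x \<in> L" "y \<in> L" for x y
        using that n(5)[of "J +> x" "J +> y"] ideal.add_quot_by_ideal[OF J, of x y] by (simp add: L_def)
      show "a \<otimes> x \<in> L" if "a \<in> carrier R" "x \<in> L" for a x
        using that n(4)[of a "J +> x"] ideal.smult_quot_by_ideal[OF J, of a x] by (simp add: L_def)
    qed (auto simp: L_def)
    moreover have "J \<subseteq> L"
    proof
      fix j assume j: "j \<in> J"
      then have "j \<in> carrier R" using ideal.Icarr[OF J] by blast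
      then show "j \<in> L" using ideal.coset_eq_self_iff[OF J, of j] j z by (simp add: L_def)
    qed
    moreover have "set xs \<subseteq> L"
    proof
      fix x assume x: "x \<in> set xs"
      then have xR: "x \<in> carrier R" using xs by blast
      have "J +> \<one> \<in> carrier ?Q" by (auto simp: carrier_quot_by_ideal)
      then have "x \<odot>\<^bsub>?Q\<^esub> (J +> \<one>) \<in> N" using aN x by blast
      then show "x \<in> L" using ideal.smult_quot_by_ideal[OF J xR one_closed] xR by (simp add: L_def)
    qed
    ultimately have "adjoin R J xs \<subseteq> L" by (rule adjoin_minimal)
    then show "(\<lambda>r. J +> r) ` adjoin R J xs \<subseteq> N" by (auto simp: L_def)
  qed
qed

lemma regular_sequence_quot_iff:
  assumes J: "ideal J R"
  shows "regular_sequence R (quot_by_ideal R J) xs \<longleftrightarrow> set xs \<subseteq> carrier R \<and> regular_on R J xs"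
proof (cases "set xs \<subseteq> carrier R")
  case False then show ?thesis by (simp add: regular_sequence_def)
next
  case True
  let ?Q = "quot_by_ideal R J"
  have take: "set (take i xs) \<subseteq> carrier R" for i using True set_take_subset by fast
  have K: "ideal (adjoin R J (take i xs)) R" "J \<subseteq> adjoin R J (take i xs)" for i
    using ideal_adjoin[OF J take] adjoin_incl[OF J take] by auto
  have "(\<forall>y\<in>carrier ?Q. xs ! i \<odot>\<^bsub>?Q\<^esub> y \<in> seq_submodule R ?Q (take i xs) \<longrightarrow> y \<in> seq_submodule R ?Q (take i xs))
      \<longleftrightarrow> colon R (adjoin R J (take i xs)) (xs ! i) \<subseteq> adjoin R J (take i xs)" if i: "i < length xs" for i
  proof -
    have xi: "xs ! i \<in> carrier R" using True i nth_mem by blast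
    have "xs ! i \<odot>\<^bsub>?Q\<^esub> (J +> r) \<in> seq_submodule R ?Q (take i xs) \<longleftrightarrow> r \<in> colon R (adjoin R J (take i xs)) (xs ! i)"
      if r: "r \<in> carrier R" for r
      unfolding seq_submodule_quot[OF J take] ideal.smult_quot_by_ideal[OF J xi r]
      using mem_coset_image_iff[OF J K, of "xs ! i \<otimes> r" i] xi r by (simp add: colon_def m_comm)
    moreover have "J +> r \<in> seq_submodule R ?Q (take i xs) \<longleftrightarrow> r \<in> adjoin R J (take i xs)"
      if r: "r \<in> carrier R" for r
      unfolding seq_submodule_quot[OF J take] using mem_coset_image_iff[OF J K r] .
    ultimately show ?thesis by (auto simp: carrier_quot_by_ideal colon_def)
  qed
  moreover have "seq_submodule R ?Q xs \<noteq> carrier ?Q \<longleftrightarrow> adjoin R J xs \<noteq> carrier R"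
  proof -
    have "adjoin R J xs = carrier R" if "(\<lambda>r. J +> r) ` adjoin R J xs = (\<lambda>r. J +> r) ` carrier R"
    proof
      show "adjoin R J xs \<subseteq> carrier R" using K(1)[of "length xs"] ideal.Icarr by fastforce
      show "carrier R \<subseteq> adjoin R J xs"
        using mem_coset_image_iff[OF J K, of _ "length xs"] that by auto
    qed
    then show ?thesis unfolding seq_submodule_quot[OF J True] carrier_quot_by_ideal by auto
  qed
  ultimately show ?thesis unfolding regular_sequence_def regular_on_iff using True by auto
qed

lemma depth_quot_ge_iff:
  assumes J: "ideal J R" "J \<noteq> carrier R" and m: "\<mm> \<subseteq> carrier R"
  shows "enat k \<le> depth R \<mm> (quot_by_ideal R J) \<longleftrightarrow> (\<exists>xs. set xs \<subseteq> \<mm> \<and> regular_on R J xs \<and> k \<le> length xs)"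
proof
  let ?S = "{enat (length xs) | xs. set xs \<subseteq> \<mm> \<and> regular_sequence R (quot_by_ideal R J) xs}"
  assume k: "enat k \<le> depth R \<mm> (quot_by_ideal R J)"
  show "\<exists>xs. set xs \<subseteq> \<mm> \<and> regular_on R J xs \<and> k \<le> length xs"
  proof (cases k)
    case 0
    then show ?thesis using J(2) by (intro exI[of _ "[]"]) simp
  next
    case (Suc l)
    have "\<exists>xs. set xs \<subseteq> \<mm> \<and> regular_sequence R (quot_by_ideal R J) xs \<and> l < length xs"
    proof (rule ccontr)
      assume "\<not> ?thesis"
      then have "\<And>x. x \<in> ?S \<Longrightarrow> x \<le> enat l" by (auto simp: not_less)
      then have "Sup ?S \<le> enat l" by (rule Sup_least)
      with k have "enat k \<le> enat l" unfolding depth_def by (rule order_trans)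
      then show False using Suc by simp
    qed
    then show ?thesis using regular_sequence_quot_iff[OF J(1)] Suc by (auto simp: Suc_le_eq)
  qed
next
  assume "\<exists>xs. set xs \<subseteq> \<mm> \<and> regular_on R J xs \<and> k \<le> length xs"
  then obtain xs where xs: "set xs \<subseteq> \<mm>" "regular_on R J xs" "k \<le> length xs" by blast
  have "regular_sequence R (quot_by_ideal R J) xs"
    using regular_sequence_quot_iff[OF J(1)] xs m by blast
  then have "enat (length xs) \<le> depth R \<mm> (quot_by_ideal R J)"
    unfolding depth_def using xs(1) by (intro Sup_upper) blast
  then show "enat k \<le> depth R \<mm> (quot_by_ideal R J)" using xs(3) by (meson enat_ord_simps(1) order_trans)
qed

end

section \<open>Zero cohomology modules\<close>

lemma zero_quot_module_iff:
  assumes "module R M" "submodule B R M" "submodule Z R M"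
  shows "zero_module (quot_module (M\<lparr>carrier := Z\<rparr>) B) \<longleftrightarrow> Z \<subseteq> B"
proof -
  interpret M: module R M by fact
  note b = M.submoduleE[OF assms(2)] and z = M.submoduleE[OF assms(3)]
  have B0: "\<zero>\<^bsub>M\<^esub> \<in> B" and Z0: "\<zero>\<^bsub>M\<^esub> \<in> Z"
    using submodule_zero[OF assms(2)]
      submodule_zero[OF assms(3)] by simp_all
  define c where "c x = {y \<oplus>\<^bsub>M\<^esub> x | y. y \<in> B}" for x
  have *: "carrier (quot_module (M\<lparr>carrier := Z\<rparr>) B) = c ` Z" "zero (quot_module (M\<lparr>carrier := Z\<rparr>) B) = B"
    by (auto simp: quot_module_def A_RCOSETS_def' a_r_coset_def' c_def)
  have c: "c x = B" if x: "x \<in> B" for x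
  proof
    show "c x \<subseteq> B" using b(5) x by (auto simp: c_def)
    show "B \<subseteq> c x"
    proof
      fix y assume y: "y \<in> B"
      have "y = (y \<oplus>\<^bsub>M\<^esub> \<ominus>\<^bsub>M\<^esub> x) \<oplus>\<^bsub>M\<^esub> x"
        using x y b(1) by (simp add: M.a_assoc M.l_neg subset_iff)
      then show "y \<in> c x" using b(3,5) x y unfolding c_def by blast
    qed
  qed
  show ?thesis unfolding zero_module_def *
  proof
    assume eq: "c ` Z = {B}"
    show "Z \<subseteq> B"
    proof
      fix x assume x: "x \<in> Z"
      then have "c x = B" using eq by blast
      moreover have "x = \<zero>\<^bsub>M\<^esub> \<oplus>\<^bsub>M\<^esub> x" using x z(1) by auto
      then have "x \<in> c x" unfolding c_def using B0 by blast
      ultimately show "x \<in> B" by simp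
    qed
  next
    assume "Z \<subseteq> B"
    then have "c x = B" if "x \<in> Z" for x using c that by blast
    then show "c ` Z = {B}" using Z0 by blast
  qed
qed

context injective_res
begin

definition tors :: "(nat \<Rightarrow> 'a set) \<Rightarrow> nat \<Rightarrow> 'e set" where
  "tors L i = (\<Union>t. ann i (L t))"

lemma tors_submodule:
  assumes "\<And>t. ideal (L t) R" "\<And>t. L (Suc t) \<subseteq> L t"
  shows "submodule (tors L i) R (E i)"
proof -
  interpret E: module R "E i" by (rule mod_E)
  have s: "submodule (ann i (L t)) R (E i)" for t by (rule ann_submodule[OF ideal_carr[OF assms(1)]])
  note n = E.submoduleE[OF s]
  have dec: "L t \<subseteq> L s" if "s \<le> t" for s t using lift_Suc_antimono_le[of L, OF assms(2) that] .
  show ?thesis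
  proof (rule E.submoduleI)
    fix x y assume "x \<in> tors L i" "y \<in> tors L i"
    then obtain s t where "x \<in> ann i (L s)" "y \<in> ann i (L t)" by (auto simp: tors_def)
    then have "x \<in> ann i (L (max s t))" "y \<in> ann i (L (max s t))"
      using ann_antimono[OF dec[of s "max s t"]] ann_antimono[OF dec[of t "max s t"]] by auto
    then show "x \<oplus>\<^bsub>E i\<^esub> y \<in> tors L i" using n(5) unfolding tors_def by blast
  next
    show "tors L i \<subseteq> carrier (E i)" using n(1) by (auto simp: tors_def)
    show "\<zero>\<^bsub>E i\<^esub> \<in> tors L i" using submodule_zero[OF s] by (auto simp: tors_def)
    show "\<ominus>\<^bsub>E i\<^esub> x \<in> tors L i" if "x \<in> tors L i" for x using that n(3) by (auto simp: tors_def)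
    show "a \<odot>\<^bsub>E i\<^esub> x \<in> tors L i" if "a \<in> carrier R" "x \<in> tors L i" for a x
      using that n(4) by (auto simp: tors_def)
  qed
qed

lemma zero_tors_cohomology_iff:
  assumes L: "\<And>t. ideal (L t) R" "\<And>t. L (Suc t) \<subseteq> L t"
  shows "zero_module (cohomology (\<lambda>j. (E j)\<lparr>carrier := tors L j\<rparr>) \<delta> i) \<longleftrightarrow>
    {x \<in> tors L i. \<delta> i x = \<zero>\<^bsub>E (Suc i)\<^esub>} \<subseteq> (case i of 0 \<Rightarrow> {\<zero>\<^bsub>E 0\<^esub>} | Suc k \<Rightarrow> \<delta> k ` tors L k)"
proof -
  let ?C = "\<lambda>j. (E j)\<lparr>carrier := tors L j\<rparr>"
  note T = tors_submodule[of L, OF L]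
  have ker: "a_kernel (?C i) (?C (Suc i)) (\<delta> i) = {x \<in> tors L i. \<delta> i x = \<zero>\<^bsub>E (Suc i)\<^esub>}"
    by (simp add: a_kernel_eq)
  have cob: "coboundaries ?C \<delta> i = (case i of 0 \<Rightarrow> {\<zero>\<^bsub>E 0\<^esub>} | Suc k \<Rightarrow> \<delta> k ` tors L k)"
    by (simp add: coboundaries_def split: nat.split)
  have "tors L i \<subseteq> carrier (E i)" using module.submoduleE(1)[OF mod_E T] .
  then have "{x \<in> tors L i. \<delta> i x = \<zero>\<^bsub>E (Suc i)\<^esub>} = tors L i \<inter> {x \<in> carrier (E i). \<delta> i x = \<zero>\<^bsub>E (Suc i)\<^esub>}"
    by blast
  then have Z: "submodule {x \<in> tors L i. \<delta> i x = \<zero>\<^bsub>E (Suc i)\<^esub>} R (E i)"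
    using submodule_Int[OF mod_E T submodule_kernel[OF mod_E mod_E lin_\<delta>]] by simp
  have B: "submodule (case i of 0 \<Rightarrow> {\<zero>\<^bsub>E 0\<^esub>} | Suc k \<Rightarrow> \<delta> k ` tors L k) R (E i)"
  proof (cases i)
    case 0
    then show ?thesis using cobounds_submodule[of "{}" 0] by (simp add: cobounds_def)
  next
    case (Suc k)
    then show ?thesis using submodule_image[OF mod_E mod_E lin_\<delta> T] by simp
  qed
  show ?thesis
    using zero_quot_module_iff[OF mod_E B Z] unfolding cohomology_def ker cob by simp
qed

lemma zero_tors_cohomology:
  assumes L: "\<And>t. ideal (L t) R" "\<And>t. L (Suc t) \<subseteq> L t" and V: "\<And>t. ext_vanishes i (L t)"
  shows "zero_module (cohomology (\<lambda>j. (E j)\<lparr>carrier := tors L j\<rparr>) \<delta> i)"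
  unfolding zero_tors_cohomology_iff[of L, OF L]
proof
  fix x assume "x \<in> {x \<in> tors L i. \<delta> i x = \<zero>\<^bsub>E (Suc i)\<^esub>}"
  then obtain t where "x \<in> cocycles i (L t)" by (auto simp: tors_def cocycles_def)
  then have "x \<in> cobounds i (L t)" using V ext_vanishes_def by blast
  then show "x \<in> (case i of 0 \<Rightarrow> {\<zero>\<^bsub>E 0\<^esub>} | Suc k \<Rightarrow> \<delta> k ` tors L k)"
    by (auto simp: cobounds_def tors_def split: nat.splits)
qed

lemma ext_vanishes_of_zero_tors_cohomology:
  assumes L: "\<And>t. ideal (L t) R" "\<And>t. L (Suc t) \<subseteq> L t"
    and z: "zero_module (cohomology (\<lambda>j. (E j)\<lparr>carrier := tors L j\<rparr>) \<delta> i)"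
    and inj: "\<And>t x. x \<in> cocycles i (L t) \<Longrightarrow> x \<in> cobounds i (L (Suc t)) \<Longrightarrow> x \<in> cobounds i (L t)"
  shows "ext_vanishes i (L 0)"
  unfolding ext_vanishes_def
proof
  fix x assume x: "x \<in> cocycles i (L 0)"
  have dec: "L t \<subseteq> L 0" for t using lift_Suc_antimono_le[of L, OF L(2)] by simp
  have xt: "x \<in> cocycles i (L t)" for t using x ann_antimono[OF dec] by (auto simp: cocycles_def)
  have "x \<in> tors L i" "\<delta> i x = \<zero>\<^bsub>E (Suc i)\<^esub>" using x by (auto simp: cocycles_def tors_def)
  then have "x \<in> (case i of 0 \<Rightarrow> {\<zero>\<^bsub>E 0\<^esub>} | Suc k \<Rightarrow> \<delta> k ` tors L k)"
    using z unfolding zero_tors_cohomology_iff[of L, OF L] by blast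
  then have "\<exists>t. x \<in> cobounds i (L t)" by (auto simp: cobounds_def tors_def split: nat.splits)
  then obtain t where "x \<in> cobounds i (L t)" by blast
  then show "x \<in> cobounds i (L 0)"
  proof (induction t)
    case (Suc t) then show ?case using inj[OF xt] by blast
  qed
qed

section \<open>The maps on Ext\<close>

abbreviation quot_hom :: "nat \<Rightarrow> 'a set \<Rightarrow> ('a, 'a set \<Rightarrow> 'e) module" where
  "quot_hom i J \<equiv> hom_module R (quot_by_ideal R J) (E i)"

abbreviation quot_hom_diff :: "'a set \<Rightarrow> nat \<Rightarrow> ('a set \<Rightarrow> 'e) \<Rightarrow> ('a set \<Rightarrow> 'e)" where
  "quot_hom_diff J i f \<equiv> compose (carrier (quot_by_ideal R J)) (\<delta> i) f"

definition hom_of :: "nat \<Rightarrow> 'a set \<Rightarrow> 'e \<Rightarrow> 'a set \<Rightarrow> 'e" where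
  "hom_of i J e = (\<lambda>X\<in>carrier (quot_by_ideal R J). (SOME r. r \<in> carrier R \<and> X = J +> r) \<odot>\<^bsub>E i\<^esub> e)"

lemma one_coset: "J +> \<one> \<in> carrier (quot_by_ideal R J)"
  by (auto simp: carrier_quot_by_ideal)

lemma quot_hom_apply:
  assumes "ideal J R" "f \<in> carrier (quot_hom i J)" "r \<in> carrier R"
  shows "f (J +> r) = r \<odot>\<^bsub>E i\<^esub> f (J +> \<one>)"
proof -
  have "f \<in> lin_maps R (quot_by_ideal R J) (E i)" using assms(2) by (simp add: hom_module_def)
  from lin_maps_smult[OF this assms(3) one_coset] show ?thesis
    using ideal.smult_quot_by_ideal[OF assms(1,3) one_closed] assms(3) by simp
qed

lemma quot_hom_eval:
  assumes J: "ideal J R" and f: "f \<in> carrier (quot_hom i J)"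
  shows "f (J +> \<one>) \<in> ann i J"
proof -
  have l: "f \<in> lin_maps R (quot_by_ideal R J) (E i)" using f by (simp add: hom_module_def)
  have "a \<odot>\<^bsub>E i\<^esub> f (J +> \<one>) = \<zero>\<^bsub>E i\<^esub>" if a: "a \<in> J" for a
  proof -
    have aR: "a \<in> carrier R" using ideal.Icarr[OF J a] .
    have "f (J +> a) = \<zero>\<^bsub>E i\<^esub>"
      using ideal.coset_eq_self_iff[OF J aR] a lin_maps_zero[OF module_quot[OF is_cring J] mod_E l] by simp
    then show ?thesis using quot_hom_apply[OF J f aR] by simp
  qed
  then show ?thesis using lin_maps_closed[OF l one_coset] by (simp add: ann_def)
qed

lemma quot_hom_eqI:
  assumes J: "ideal J R" and f: "f \<in> carrier (quot_hom i J)" and g: "g \<in> carrier (quot_hom i J)"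
    and "f (J +> \<one>) = g (J +> \<one>)"
  shows "f = g"
proof (rule extensionalityI)
  show "f \<in> extensional (carrier (quot_by_ideal R J))" "g \<in> extensional (carrier (quot_by_ideal R J))"
    using f g by (simp_all add: hom_module_def)
  fix X assume "X \<in> carrier (quot_by_ideal R J)"
  then obtain r where r: "r \<in> carrier R" "X = J +> r" by (auto simp: carrier_quot_by_ideal)
  then show "f X = g X" using quot_hom_apply[OF J f r(1)] quot_hom_apply[OF J g r(1)] assms(4) by metis
qed

lemma hom_of_apply:
  assumes J: "ideal J R" and e: "e \<in> ann i J" and r: "r \<in> carrier R"
  shows "hom_of i J e (J +> r) = r \<odot>\<^bsub>E i\<^esub> e"
proof -
  interpret E: module R "E i" by (rule mod_E)
  let ?s = "SOME s. s \<in> carrier R \<and> J +> r = J +> s"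
  have s: "?s \<in> carrier R \<and> J +> r = J +> ?s" by (rule someI[of _ r]) (simp add: r)
  then have "?s \<ominus> r \<in> J" using ideal.coset_eq_iff[OF J _ r, of ?s] by simp
  then have "(?s \<ominus> r) \<odot>\<^bsub>E i\<^esub> e = \<zero>\<^bsub>E i\<^esub>" using e by (simp add: ann_def)
  then have "?s \<odot>\<^bsub>E i\<^esub> e \<ominus>\<^bsub>E i\<^esub> r \<odot>\<^bsub>E i\<^esub> e = \<zero>\<^bsub>E i\<^esub>"
    using s r ann_closed[OF e] by (simp add: a_minus_def E.smult_l_distr E.smult_l_minus)
  then have "?s \<odot>\<^bsub>E i\<^esub> e = r \<odot>\<^bsub>E i\<^esub> e" using E.minus_eq_zero_iff s r ann_closed[OF e] by simp
  then show ?thesis using r by (simp add: hom_of_def carrier_quot_by_ideal)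
qed

lemma hom_of_closed:
  assumes J: "ideal J R" and e: "e \<in> ann i J"
  shows "hom_of i J e \<in> carrier (quot_hom i J)" and "hom_of i J e (J +> \<one>) = e"
proof -
  interpret E: module R "E i" by (rule mod_E)
  have "hom_of i J e \<in> lin_maps R (quot_by_ideal R J) (E i)"
    using ann_closed[OF e]
    by (intro lin_mapsI)
      (auto simp: carrier_quot_by_ideal hom_of_apply[OF J e] ideal.add_quot_by_ideal[OF J]
        ideal.smult_quot_by_ideal[OF J] E.smult_l_distr E.smult_assoc1)
  then show "hom_of i J e \<in> carrier (quot_hom i J)" by (simp add: hom_module_def hom_of_def)
  show "hom_of i J e (J +> \<one>) = e" using hom_of_apply[OF J e one_closed] ann_closed[OF e] by simp
qed

lemma quot_hom_add:
  assumes J: "ideal J R" and f: "f \<in> carrier (quot_hom i J)" and g: "g \<in> carrier (quot_hom i J)"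
  shows "f \<oplus>\<^bsub>quot_hom i J\<^esub> g \<in> carrier (quot_hom i J)"
    and "(f \<oplus>\<^bsub>quot_hom i J\<^esub> g) (J +> \<one>) = f (J +> \<one>) \<oplus>\<^bsub>E i\<^esub> g (J +> \<one>)"
proof -
  let ?e = "f (J +> \<one>) \<oplus>\<^bsub>E i\<^esub> g (J +> \<one>)"
  interpret E: module R "E i" by (rule mod_E)
  have fe: "f (J +> \<one>) \<in> ann i J" and ge: "g (J +> \<one>) \<in> ann i J" using quot_hom_eval[OF J] f g by auto
  have e: "?e \<in> ann i J" using ann_add[OF fe ge ideal_carr[OF J]] .
  have "(\<lambda>X\<in>carrier (quot_by_ideal R J). f X \<oplus>\<^bsub>E i\<^esub> g X) = hom_of i J ?e"
  proof (rule extensionalityI[of _ "carrier (quot_by_ideal R J)"])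
    fix X assume X: "X \<in> carrier (quot_by_ideal R J)"
    then obtain r where r: "r \<in> carrier R" "X = J +> r" by (auto simp: carrier_quot_by_ideal)
    then show "(\<lambda>X\<in>carrier (quot_by_ideal R J). f X \<oplus>\<^bsub>E i\<^esub> g X) X = hom_of i J ?e X"
      using X hom_of_apply[OF J e r(1)] quot_hom_apply[OF J f r(1)] quot_hom_apply[OF J g r(1)]
        ann_closed[OF fe] ann_closed[OF ge] by (simp add: E.smult_r_distr)
  qed (simp_all add: hom_of_def)
  then have "f \<oplus>\<^bsub>quot_hom i J\<^esub> g = hom_of i J ?e" by (simp add: hom_module_def)
  then show "f \<oplus>\<^bsub>quot_hom i J\<^esub> g \<in> carrier (quot_hom i J)" "(f \<oplus>\<^bsub>quot_hom i J\<^esub> g) (J +> \<one>) = ?e"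
    using hom_of_closed[OF J e] by simp_all
qed

lemma quot_hom_diff:
  assumes J: "ideal J R" and f: "f \<in> carrier (quot_hom i J)"
  shows "quot_hom_diff J i f \<in> carrier (quot_hom (Suc i) J)"
    and "quot_hom_diff J i f (J +> \<one>) = \<delta> i (f (J +> \<one>))"
proof -
  have "f \<in> lin_maps R (quot_by_ideal R J) (E i)" using f by (simp add: hom_module_def)
  from lin_maps_comp[OF this lin_\<delta>]
  have "quot_hom_diff J i f \<in> lin_maps R (quot_by_ideal R J) (E (Suc i))"
    using module_quot[OF is_cring J]
    by (simp add: lin_maps_def compose_def Pi_iff module.smult_closed abelian_group.axioms
        module.axioms(2) abelian_monoid.a_closed)
  then show "quot_hom_diff J i f \<in> carrier (quot_hom (Suc i) J)" by (simp add: hom_module_def)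
  show "quot_hom_diff J i f (J +> \<one>) = \<delta> i (f (J +> \<one>))" using one_coset by (simp add: compose_def)
qed

lemma quot_hom_zero:
  assumes J: "ideal J R"
  shows "\<zero>\<^bsub>quot_hom i J\<^esub> \<in> carrier (quot_hom i J)" and "\<zero>\<^bsub>quot_hom i J\<^esub> (J +> \<one>) = \<zero>\<^bsub>E i\<^esub>"
proof -
  have "\<zero>\<^bsub>quot_hom i J\<^esub> = hom_of i J \<zero>\<^bsub>E i\<^esub>"
  proof (rule extensionalityI[of _ "carrier (quot_by_ideal R J)"])
    fix X assume "X \<in> carrier (quot_by_ideal R J)"
    then show "\<zero>\<^bsub>quot_hom i J\<^esub> X = hom_of i J \<zero>\<^bsub>E i\<^esub> X"
      using hom_of_apply[OF J ann_zero[OF ideal_carr[OF J]]] by (auto simp: carrier_quot_by_ideal hom_module_def)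
  qed (simp_all add: hom_of_def hom_module_def)
  then show "\<zero>\<^bsub>quot_hom i J\<^esub> \<in> carrier (quot_hom i J)" "\<zero>\<^bsub>quot_hom i J\<^esub> (J +> \<one>) = \<zero>\<^bsub>E i\<^esub>"
    using hom_of_closed[OF J ann_zero[OF ideal_carr[OF J]]] by simp_all
qed

lemma quot_hom_coboundaries:
  assumes J: "ideal J R"
  shows "coboundaries (\<lambda>i. quot_hom i J) (quot_hom_diff J) i =
    {f \<in> carrier (quot_hom i J). f (J +> \<one>) \<in> cobounds i J}"
proof (cases i)
  case 0
  have "f = \<zero>\<^bsub>quot_hom 0 J\<^esub> \<longleftrightarrow> f \<in> carrier (quot_hom 0 J) \<and> f (J +> \<one>) = \<zero>\<^bsub>E 0\<^esub>" for f
    using quot_hom_zero[OF J, of 0] quot_hom_eqI[OF J _ quot_hom_zero(1)[OF J], of f 0] by metis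
  then show ?thesis unfolding 0 by (auto simp: coboundaries_def cobounds_def)
next
  case (Suc k)
  have "quot_hom_diff J k ` carrier (quot_hom k J) = {f \<in> carrier (quot_hom (Suc k) J). f (J +> \<one>) \<in> \<delta> k ` ann k J}"
  proof
    show "quot_hom_diff J k ` carrier (quot_hom k J) \<subseteq> {f \<in> carrier (quot_hom (Suc k) J). f (J +> \<one>) \<in> \<delta> k ` ann k J}"
      using quot_hom_diff[OF J] quot_hom_eval[OF J] by auto
    show "{f \<in> carrier (quot_hom (Suc k) J). f (J +> \<one>) \<in> \<delta> k ` ann k J} \<subseteq> quot_hom_diff J k ` carrier (quot_hom k J)"
    proof
      fix f assume "f \<in> {f \<in> carrier (quot_hom (Suc k) J). f (J +> \<one>) \<in> \<delta> k ` ann k J}"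
      then obtain e where f: "f \<in> carrier (quot_hom (Suc k) J)" and e: "e \<in> ann k J" "f (J +> \<one>) = \<delta> k e" by blast
      note h = hom_of_closed[OF J e(1)]
      have "f = quot_hom_diff J k (hom_of k J e)"
        using quot_hom_diff[OF J h(1)] h(2) e(2) by (intro quot_hom_eqI[OF J f]) simp_all
      then show "f \<in> quot_hom_diff J k ` carrier (quot_hom k J)" using h(1) by blast
    qed
  qed
  then show ?thesis using Suc by (simp add: coboundaries_def cobounds_def)
qed

lemma cobounds_of_Ext_map_inj:
  assumes J: "ideal J R" and K: "ideal K R" and KJ: "K \<subseteq> J"
    and inj: "inj_on (cohomology_map (\<lambda>i. quot_hom i K) (quot_hom_diff K)
        (\<lambda>_ f. compose (carrier (quot_by_ideal R K)) f (natural_surj R J)) i)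
      (carrier (cohomology (\<lambda>i. quot_hom i J) (quot_hom_diff J) i))"
    and x: "x \<in> cocycles i J" and xK: "x \<in> cobounds i K"
  shows "x \<in> cobounds i J"
proof -
  interpret E: module R "E i" by (rule mod_E)
  let ?BJ = "coboundaries (\<lambda>i. quot_hom i J) (quot_hom_diff J) i"
  let ?BK = "coboundaries (\<lambda>i. quot_hom i K) (quot_hom_diff K) i"
  let ?res = "\<lambda>f. compose (carrier (quot_by_ideal R K)) f (natural_surj R J)"
  let ?map = "cohomology_map (\<lambda>i. quot_hom i K) (quot_hom_diff K) (\<lambda>_ f. ?res f) i"
  note BJ = quot_hom_coboundaries[OF J, of i] and BK = quot_hom_coboundaries[OF K, of i]
  have surj: "natural_surj R J (K +> r) = J +> r" if r: "r \<in> carrier R" for r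
  proof -
    interpret J: ideal J R by fact
    interpret K: ideal K R by fact
    show ?thesis
    proof
      show "natural_surj R J (K +> r) \<subseteq> J +> r"
      proof
        fix y assume "y \<in> natural_surj R J (K +> r)"
        then obtain j k where jk: "j \<in> J" "k \<in> K" "y = j \<oplus> (k \<oplus> r)"
          by (auto simp: natural_surj_def set_add_def' mem_a_r_coset)
        then have "y = (j \<oplus> k) \<oplus> r" "j \<oplus> k \<in> J" using r KJ J.Icarr by (auto simp: a_assoc subset_iff)
        then show "y \<in> J +> r" by (auto simp: mem_a_r_coset)
      qed
      show "J +> r \<subseteq> natural_surj R J (K +> r)"
      proof
        fix y assume "y \<in> J +> r"
        then obtain j where j: "j \<in> J" "y = j \<oplus> r" by (auto simp: mem_a_r_coset)
        then have "y = j \<oplus> (\<zero> \<oplus> r)" using r by simp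
        moreover have "\<zero> \<oplus> r \<in> K +> r" by (auto simp: mem_a_r_coset simp del: l_zero)
        ultimately show "y \<in> natural_surj R J (K +> r)"
          using j(1) by (auto simp: natural_surj_def set_add_def' simp del: l_zero)
      qed
    qed
  qed
  have res: "?res f \<in> carrier (quot_hom i K)" "?res f (K +> \<one>) = f (J +> \<one>)" if f: "f \<in> carrier (quot_hom i J)" for f
  proof -
    have fe: "f (J +> \<one>) \<in> ann i K" using quot_hom_eval[OF J f] ann_antimono[OF KJ] by blast
    have "?res f = hom_of i K (f (J +> \<one>))"
    proof (rule extensionalityI[of _ "carrier (quot_by_ideal R K)"])
      fix X assume X: "X \<in> carrier (quot_by_ideal R K)"
      then obtain r where r: "r \<in> carrier R" "X = K +> r" by (auto simp: carrier_quot_by_ideal)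
      then show "?res f X = hom_of i K (f (J +> \<one>)) X"
        using X surj hom_of_apply[OF K fe r(1)] quot_hom_apply[OF J f r(1)] by (simp add: compose_def)
    qed (simp_all add: hom_of_def)
    then show "?res f \<in> carrier (quot_hom i K)" "?res f (K +> \<one>) = f (J +> \<one>)"
      using hom_of_closed[OF K fe] by simp_all
  qed
  have cosetK: "?BK +>\<^bsub>quot_hom i K\<^esub> f = ?BK" if f: "f \<in> ?BK" for f
  proof
    note bK = E.submoduleE[OF cobounds_submodule[OF ideal_carr[OF K], of i]]
    have fK: "f \<in> carrier (quot_hom i K)" "f (K +> \<one>) \<in> cobounds i K" using f BK by auto
    show "?BK +>\<^bsub>quot_hom i K\<^esub> f \<subseteq> ?BK"
      using fK quot_hom_add[OF K _ fK(1)] bK(5) by (auto simp: mem_a_r_coset BK)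
    show "?BK \<subseteq> ?BK +>\<^bsub>quot_hom i K\<^esub> f"
    proof
      fix g assume "g \<in> ?BK"
      then have g: "g \<in> carrier (quot_hom i K)" "g (K +> \<one>) \<in> cobounds i K" using BK by auto
      let ?e = "g (K +> \<one>) \<ominus>\<^bsub>E i\<^esub> f (K +> \<one>)"
      have e: "?e \<in> ann i K" using ann_minus[OF quot_hom_eval[OF K g(1)] quot_hom_eval[OF K fK(1)] ideal_carr[OF K]] .
      have eb: "?e \<in> cobounds i K" using g(2) fK(2) bK(3,5) by (simp add: a_minus_def)
      note h = hom_of_closed[OF K e]
      have "hom_of i K ?e \<oplus>\<^bsub>quot_hom i K\<^esub> f = g"
        using quot_hom_add[OF K h(1) fK(1)] h(2) g(1) E.minus_add_cancel
          ann_closed[OF quot_hom_eval[OF K g(1)]] ann_closed[OF quot_hom_eval[OF K fK(1)]]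
        by (intro quot_hom_eqI[OF K]) simp_all
      moreover have "hom_of i K ?e \<in> ?BK" using h eb BK by simp
      ultimately show "g \<in> ?BK +>\<^bsub>quot_hom i K\<^esub> f" unfolding mem_a_r_coset by metis
    qed
  qed
  define cl where "cl f = ?BJ +>\<^bsub>quot_hom i J\<^esub> f" for f
  have map_cl: "?map (cl f) = ?BK" if f: "f \<in> carrier (quot_hom i J)" "f (J +> \<one>) \<in> cobounds i K" for f
  proof -
    have sub: "cobounds i J \<subseteq> cobounds i K"
      using ann_antimono[OF KJ] by (auto simp: cobounds_def split: nat.splits)
    note bK = E.submoduleE(5)[OF cobounds_submodule[OF ideal_carr[OF K], of i]]
    have "?BK +>\<^bsub>quot_hom i K\<^esub> ?res g = ?BK" if "g \<in> cl f" for g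
    proof (rule cosetK)
      obtain b where b: "b \<in> ?BJ" "g = b \<oplus>\<^bsub>quot_hom i J\<^esub> f" using \<open>g \<in> cl f\<close> by (auto simp: cl_def mem_a_r_coset)
      have bH: "b \<in> carrier (quot_hom i J)" "b (J +> \<one>) \<in> cobounds i J" using b(1) BJ by auto
      have g: "g \<in> carrier (quot_hom i J)" "g (J +> \<one>) \<in> cobounds i K"
        using quot_hom_add[OF J bH(1) f(1)] b(2) bK bH(2) sub f(2) by auto
      then show "?res g \<in> ?BK" using res[OF g(1)] BK by simp
    qed
    moreover have "cl f \<noteq> {}"
    proof -
      have "\<zero>\<^bsub>quot_hom i J\<^esub> \<in> ?BJ"
        using quot_hom_zero[OF J] BJ submodule_zero[OF cobounds_submodule[OF ideal_carr[OF J]]] by simp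
      then have "\<zero>\<^bsub>quot_hom i J\<^esub> \<oplus>\<^bsub>quot_hom i J\<^esub> f \<in> cl f" unfolding cl_def mem_a_r_coset by blast
      then show ?thesis by blast
    qed
    ultimately show ?thesis by (auto simp: cohomology_map_def)
  qed
  note hx = hom_of_closed[OF J cocycles_ann[OF x]]
  let ?ker = "a_kernel (quot_hom i J) (quot_hom (Suc i) J) (quot_hom_diff J i)"
  have carr: "carrier (cohomology (\<lambda>i. quot_hom i J) (quot_hom_diff J) i) = cl ` ?ker"
    by (auto simp: cohomology_def quot_module_def A_RCOSETS_def' a_r_coset_def' cl_def)
  have in_ker: "f \<in> ?ker" if f: "f \<in> carrier (quot_hom i J)" "\<delta> i (f (J +> \<one>)) = \<zero>\<^bsub>E (Suc i)\<^esub>" for f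
    using f quot_hom_diff[OF J f(1)] quot_hom_zero[OF J, of "Suc i"]
    by (auto simp: a_kernel_eq intro: quot_hom_eqI[OF J])
  have zK: "\<zero>\<^bsub>E i\<^esub> \<in> cobounds i K" "\<zero>\<^bsub>E i\<^esub> \<in> cobounds i J"
    using submodule_zero[OF cobounds_submodule[OF ideal_carr]] J K by auto
  have kers: "hom_of i J x \<in> ?ker" "\<zero>\<^bsub>quot_hom i J\<^esub> \<in> ?ker"
    using in_ker hx cocycles_zero[OF x] quot_hom_zero[OF J, of i] \<delta>_zero by simp_all
  have "?map (cl (hom_of i J x)) = ?map (cl \<zero>\<^bsub>quot_hom i J\<^esub>)"
    using map_cl[OF hx(1)] map_cl[OF quot_hom_zero(1)[OF J]] hx(2) xK quot_hom_zero(2)[OF J, of i] zK(1) by simp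
  then have eq: "cl (hom_of i J x) = cl \<zero>\<^bsub>quot_hom i J\<^esub>"
    using inj_onD[OF inj] kers unfolding carr by blast
  have zB: "\<zero>\<^bsub>quot_hom i J\<^esub> \<in> ?BJ" using quot_hom_zero[OF J, of i] BJ zK(2) by simp
  then have "\<zero>\<^bsub>quot_hom i J\<^esub> \<oplus>\<^bsub>quot_hom i J\<^esub> hom_of i J x \<in> cl \<zero>\<^bsub>quot_hom i J\<^esub>"
    unfolding eq[symmetric] by (auto simp: cl_def mem_a_r_coset)
  then obtain b where b: "b \<in> ?BJ" "\<zero>\<^bsub>quot_hom i J\<^esub> \<oplus>\<^bsub>quot_hom i J\<^esub> hom_of i J x = b \<oplus>\<^bsub>quot_hom i J\<^esub> \<zero>\<^bsub>quot_hom i J\<^esub>"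
    by (auto simp: cl_def mem_a_r_coset)
  have bH: "b \<in> carrier (quot_hom i J)" "b (J +> \<one>) \<in> cobounds i J" using b(1) BJ by auto
  have "\<zero>\<^bsub>E i\<^esub> \<oplus>\<^bsub>E i\<^esub> x = b (J +> \<one>) \<oplus>\<^bsub>E i\<^esub> \<zero>\<^bsub>E i\<^esub>"
    using arg_cong[OF b(2), of "\<lambda>f. f (J +> \<one>)"] quot_hom_add(2)[OF J quot_hom_zero(1)[OF J] hx(1)]
      quot_hom_add(2)[OF J bH(1) quot_hom_zero(1)[OF J]] quot_hom_zero(2)[OF J, of i] hx(2) by simp
  then have "x = b (J +> \<one>)"
    using cocycles_closed[OF x] ann_closed[OF quot_hom_eval[OF J bH(1)]] by simp
  then show ?thesis using bH(2) by simp
qed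

end

section \<open>Finite injective and projective dimension\<close>

lemma Inf_enat_attained:
  assumes "Inf {enat n | n. P n} < \<infinity>"
  obtains n where "Inf {enat n | n. P n} = enat n" "P n"
proof -
  have "{enat n | n. P n} \<noteq> {}"
  proof
    assume "{enat n | n. P n} = {}"
    then show False using assms by (simp add: top_enat_def)
  qed
  then obtain k where "k \<in> {enat n | n. P n}" by blast
  then have "Inf {enat n | n. P n} \<in> {enat n | n. P n}"
    unfolding Inf_enat_def by (auto intro: LeastI)
  then show thesis using that by blast
qed

lemma (in cring) free_module_embed:
  fixes A :: "'i set"
  assumes "finite A" "infinite (UNIV :: 'j set)"
  shows "\<exists>\<sigma> :: ('i \<Rightarrow> 'a) \<Rightarrow> ('j \<Rightarrow> 'a). inj_on \<sigma> (carrier (free_module R A))"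
proof -
  obtain \<kappa> :: "'i \<Rightarrow> 'j" where \<kappa>: "inj_on \<kappa> A" using ex_inj_on_infinite[OF assms] by blast
  define \<sigma> where "\<sigma> x = (\<lambda>j. x (inv_into A \<kappa> j))" for x :: "'i \<Rightarrow> 'a"
  have "inj_on \<sigma> (carrier (free_module R A))"
  proof (rule inj_onI)
    fix x y assume x: "x \<in> carrier (free_module R A)" and y: "y \<in> carrier (free_module R A)" and eq: "\<sigma> x = \<sigma> y"
    show "x = y"
    proof
      fix i show "x i = y i"
      proof (cases "i \<in> A")
        case True
        then show ?thesis using fun_cong[OF eq, of "\<kappa> i"] \<kappa> by (simp add: \<sigma>_def)
      next
        case False
        then show ?thesis using x y by (simp add: free_module_simps)
      qed
    qed
  qed
  then show ?thesis by blast
qed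

lemma infinite_univ:
  fixes R :: "('a, 'r) ring_scheme"
  assumes "one R \<noteq> zero R"
  shows "infinite (UNIV :: ('b list \<Rightarrow> 'a) set)"
proof -
  have "inj (\<lambda>(l :: 'b list) k. if k = l then one R else zero R)"
    using assms by (intro injI) (metis (full_types))
  then show ?thesis using infinite_UNIV_listI finite_imageD[of _ UNIV] by (metis finite_subset subset_UNIV)
qed

lemma injective_free_res_univ:
  fixes \<epsilon> :: "'a \<Rightarrow> ('a, 'b) univ" and e0 :: 'c
  assumes "injective_res R \<epsilon> E \<delta>" "free_resolution R J e0 A d"
  shows "injective_free_res R J e0 A d \<epsilon> E \<delta>"
proof -
  interpret I: injective_res R \<epsilon> E \<delta> by fact
  interpret F: free_resolution R J e0 A d by fact
  show ?thesis
  proof unfold_locales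
    fix k
    obtain \<sigma> :: "('c \<Rightarrow> 'a) \<Rightarrow> ('a, 'b) univ" where \<sigma>: "inj_on \<sigma> (carrier (free_module R (A k)))"
      using I.free_module_embed[OF F.fin infinite_UNIV_listI] by blast
    have "inj_on (\<lambda>x. Inr (\<sigma> x) :: 'a + ('a, 'b) univ) (carrier (free_module R (A k)))"
      using \<sigma> by (simp add: inj_on_def)
    then show "\<exists>\<sigma> :: ('c \<Rightarrow> 'a) \<Rightarrow> 'a + ('a, 'b) univ. inj_on \<sigma> (carrier (free_module R (A k)))" by blast
  qed
qed

lemma ext_vanishes_indep:
  fixes \<epsilon> \<epsilon>' :: "'a \<Rightarrow> ('a, 'b) univ"
  assumes "injective_res R \<epsilon> E \<delta>" "injective_res R \<epsilon>' E' \<delta>'" "noetherian_ring R" "ideal J R"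
  shows "injective_res.ext_vanishes E \<delta> (Suc i) J \<longleftrightarrow> injective_res.ext_vanishes E' \<delta>' (Suc i) J"
proof -
  interpret I: injective_res R \<epsilon> E \<delta> by fact
  obtain A d where F: "free_resolution R J ([] :: unit list) A d"
    using I.ex_free_resolution[OF assms(3,4) infinite_UNIV_listI] by blast
  interpret X: injective_free_res R J "[]" A d \<epsilon> E \<delta> by (rule injective_free_res_univ[OF assms(1) F])
  interpret Y: injective_free_res R J "[]" A d \<epsilon>' E' \<delta>' by (rule injective_free_res_univ[OF assms(2) F])
  show ?thesis using X.dual_exact_iff_ext_vanishes Y.dual_exact_iff_ext_vanishes by simp
qed

lemma gorenstein_injective_res:
  fixes R :: "('a, 'r) ring_scheme"
  assumes "gorenstein_local R \<mm>"
  defines "E \<equiv> inj_res_obj R (self_module R)" and "\<delta> \<equiv> inj_res_diff R (self_module R)"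
  obtains \<epsilon> n where "injective_res R \<epsilon> E \<delta>"
    and "\<And>j J. j > n \<Longrightarrow> ideal J R \<Longrightarrow> injective_res.ext_vanishes E \<delta> j J"
proof -
  have loc: "noetherian_local R \<mm>" and fin: "inj_dim R (self_module R) < \<infinity>"
    using assms(1) by (simp_all add: gorenstein_local_def)
  obtain n where "\<exists>\<epsilon> (E :: nat \<Rightarrow> ('a, ('a, 'a) univ) module) d.
      injective_resolution R (self_module R) \<epsilon> E d \<and> (\<forall>i>n. zero_module (E i))"
    using Inf_enat_attained[OF fin[unfolded inj_dim_def]] by metis
  then obtain \<epsilon>' and E' :: "nat \<Rightarrow> ('a, ('a, 'a) univ) module" and \<delta>' where
    res': "injective_resolution R (self_module R) \<epsilon>' E' \<delta>'" and z: "\<And>i. i > n \<Longrightarrow> zero_module (E' i)" by blast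
  have "\<exists>p. case p of (E, d) \<Rightarrow> \<exists>\<epsilon>. injective_resolution R (self_module R) \<epsilon> (E :: nat \<Rightarrow> ('a, ('a, 'a) univ) module) d"
    using res' by (intro exI[of _ "(E', \<delta>')"]) auto
  then have "case some_injective_resolution R (self_module R) of (E, d) \<Rightarrow> \<exists>\<epsilon>. injective_resolution R (self_module R) \<epsilon> E d"
    unfolding some_injective_resolution_def by (rule someI_ex)
  then obtain \<epsilon> where res: "injective_resolution R (self_module R) \<epsilon> E \<delta>"
    by (auto simp: E_def \<delta>_def split: prod.splits)
  have cr: "cring R" using local_cring[OF loc] .
  have I: "injective_res R \<epsilon> E \<delta>" and I': "injective_res R \<epsilon>' E' \<delta>'"
    using res res' cr by (simp_all add: injective_res_def injective_res_axioms_def)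
  interpret I': injective_res R \<epsilon>' E' \<delta>' by (rule I')
  have "injective_res.ext_vanishes E \<delta> j J" if j: "j > n" and J: "ideal J R" for j J
  proof -
    have "I'.cocycles j J \<subseteq> {\<zero>\<^bsub>E' j\<^esub>}"
      using z[OF j] I'.cocycles_closed by (auto simp: zero_module_def)
    then have "I'.ext_vanishes j J"
      using submodule_zero[OF I'.cobounds_submodule[OF I'.ideal_carr[OF J]]] by (auto simp: I'.ext_vanishes_def)
    then show ?thesis using ext_vanishes_indep[OF I I' local_noetherian[OF loc] J] j by (cases j) auto
  qed
  then show thesis using that[OF I] by blast
qed

theorem theorem3p3:
  fixes R :: "('a, 'r) ring_scheme" and \<mm> I :: "'a set" and \<phi> :: "'a \<Rightarrow> 'a"
  assumes "gorenstein_local R \<mm>"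
    and "local_endomorphism R \<mm> \<phi>"
    and "ideal I R" and "I \<noteq> carrier R"
    and "\<And>t. iterated_image_ideal R \<phi> I (Suc t) \<subseteq> iterated_image_ideal R \<phi> I t"
    and "cofinal_families (iterated_image_ideal R \<phi> I) (ideal_power R I)"
    and "\<And>t. depth R \<mm> (quot_by_ideal R (iterated_image_ideal R \<phi> I t))
          \<le> depth R \<mm> (quot_by_ideal R (iterated_image_ideal R \<phi> I (Suc t)))"
    and "proj_dim R (quot_by_ideal R I) < \<infinity>"
  shows "coh_dim R I \<le> proj_dim R (quot_by_ideal R I) \<and>
    ((\<forall>i t. inj_on
        (Ext_map R i (quot_by_ideal R (iterated_image_ideal R \<phi> I (Suc t)))
          (natural_surj R (iterated_image_ideal R \<phi> I t)) (self_module R))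
        (carrier (Ext R i (quot_by_ideal R (iterated_image_ideal R \<phi> I t)) (self_module R)))) \<longrightarrow>
     coh_dim R I = proj_dim R (quot_by_ideal R I))"
proof -
  define E where "E = inj_res_obj R (self_module R)"
  define \<delta> where "\<delta> = inj_res_diff R (self_module R)"
  define L where "L = iterated_image_ideal R \<phi> I"
  have loc: "noetherian_local R \<mm>" using assms(1) by (simp add: gorenstein_local_def)
  obtain \<epsilon> n0 where IR: "injective_res R \<epsilon> E \<delta>"
    and n0: "\<And>j J. j > n0 \<Longrightarrow> ideal J R \<Longrightarrow> injective_res.ext_vanishes E \<delta> j J"
    using gorenstein_injective_res[OF assms(1)] unfolding E_def \<delta>_def by metis
  interpret I: local_injective_res R \<epsilon> E \<delta> \<mm>
    using IR loc by (simp add: local_injective_res_def local_injective_res_axioms_def)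
  have "one R \<noteq> zero R"
  proof
    assume 1: "one R = zero R"
    have "zero R \<in> \<mm>"
      using I.ideal_zero[OF local_max_ideal[OF loc]] .
    then show False
      using ideal.one_imp_carrier[OF local_max_ideal[OF loc]] local_max_proper[OF loc] 1 by simp
  qed
  note inf = infinite_univ[OF this]

  have iter: "(\<phi> ^^ t) ` I \<subseteq> carrier R" for t
  proof (induction t)
    case 0 show ?case using I.ideal_carr[OF assms(3)] by simp
  next
    case (Suc t)
    have "\<phi> x \<in> carrier R" if "x \<in> carrier R" for x
      using assms(2) that by (auto simp: local_endomorphism_def ring_hom_def)
    then show ?case using Suc by auto
  qed
  have L: "ideal (L t) R" for t
    unfolding L_def iterated_image_ideal_def by (rule I.genideal_ideal[OF iter])
  have L0: "L 0 = I"
    unfolding L_def iterated_image_ideal_def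
    using I.genideal_self[OF iter, of 0] I.genideal_minimal[OF assms(3), of I] by auto
  have LS: "L (Suc t) \<subseteq> L t" for t using assms(5) by (simp add: L_def)
  have LI: "L t \<subseteq> I" for t using lift_Suc_antimono_le[of L, OF LS, of 0 t] L0 by simp
  have Lp: "L t \<noteq> carrier R" for t using LI[of t] assms(4) I.ideal_carr[OF assms(3)] by blast

  obtain p where p: "proj_dim R (quot_by_ideal R I) = enat p"
    and "\<exists>\<epsilon> (P :: nat \<Rightarrow> ('a, ('a, 'a set) univ) module) d.
      projective_resolution R (quot_by_ideal R I) \<epsilon> P d \<and> (\<forall>i>p. zero_module (P i))"
    by (rule Inf_enat_attained[OF assms(8)[unfolded proj_dim_def], folded proj_dim_def])
  then obtain \<epsilon>P and P :: "nat \<Rightarrow> ('a, ('a, 'a set) univ) module" and dP where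
    P: "projective_resolution R (quot_by_ideal R I) \<epsilon>P P dP" "\<And>i. i > p \<Longrightarrow> zero_module (P i)" by blast
  obtain A d where F: "free_resolution R I ([] :: ('a + 'a set) list) A d"
    using I.ex_free_resolution[OF local_noetherian[OF loc] assms(3) infinite_UNIV_listI] by blast
  interpret X: injective_free_res R I "[]" A d \<epsilon> E \<delta> by (rule injective_free_res_univ[OF IR F])
  define \<rho> :: "'a set \<Rightarrow> ('a, 'a set) univ"
    where "\<rho> X = (\<lambda>_. SOME r. r \<in> carrier R \<and> X = I +>\<^bsub>R\<^esub> r)" for X
  have splits: "X.splits k" if kp: "k \<ge> p" for k
  proof (rule X.splits_of_projective_resolution[OF P _ _ _ kp])
    show "\<exists>\<sigma> :: (('a + 'a set) list \<Rightarrow> 'a) \<Rightarrow> ('a, 'a set) univ \<Rightarrow> 'a. inj_on \<sigma> (carrier (X.F k))" for k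
      by (rule I.free_module_embed[OF X.fin inf])
    show "\<exists>\<tau> :: (('a + 'a set) list \<Rightarrow> 'a) \<Rightarrow> ('a, 'a set) univ. inj_on \<tau> (carrier (X.F k))" for k
      by (rule exI[of _ id]) simp
    show "inj_on \<rho> (carrier (quot_by_ideal R I))"
    proof (rule inj_onI)
      fix X Y assume X: "X \<in> carrier (quot_by_ideal R I)" and Y: "Y \<in> carrier (quot_by_ideal R I)"
        and eq: "\<rho> X = \<rho> Y"
      have s: "Z = I +>\<^bsub>R\<^esub> (\<rho> Z [])" if "Z \<in> carrier (quot_by_ideal R I)" for Z
        using someI_ex[of "\<lambda>r. r \<in> carrier R \<and> Z = I +>\<^bsub>R\<^esub> r"] that
        by (auto simp: carrier_quot_by_ideal \<rho>_def)
      show "X = Y" using s[OF X] s[OF Y] eq by metis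
    qed
  qed
  have V: "I.ext_vanishes j I" if j: "j > p" for j
  proof -
    obtain k where k: "j = Suc k" "k \<ge> p" using j by (cases j) auto
    show ?thesis using X.splits_imp_dual_exact[OF splits[OF k(2)]] X.dual_exact_iff_ext_vanishes k(1) by simp
  qed

  define D where "D = (LEAST D. \<forall>j>D. \<forall>J. ideal J R \<longrightarrow> I.ext_vanishes j J)"
  have "\<forall>j>n0. \<forall>J. ideal J R \<longrightarrow> I.ext_vanishes j J" using n0 by blast
  then have "\<forall>j>D. \<forall>J. ideal J R \<longrightarrow> I.ext_vanishes j J" unfolding D_def by (rule LeastI)
  then have top: "\<And>j J. j > D \<Longrightarrow> ideal J R \<Longrightarrow> I.ext_vanishes j J" by blast
  have least: "D = 0 \<or> (\<exists>K. ideal K R \<and> \<not> I.ext_vanishes D K)"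
  proof (rule ccontr)
    assume n: "\<not> ?thesis"
    have "\<forall>j>D - 1. \<forall>J. ideal J R \<longrightarrow> I.ext_vanishes j J"
    proof (intro allI impI)
      fix j J assume "j > D - 1" "ideal J R"
      then show "I.ext_vanishes j J" using top n by (cases "j = D") auto
    qed
    then have "D \<le> D - 1" unfolding D_def by (rule Least_le)
    moreover have "0 < D" using n by auto
    ultimately show False by linarith
  qed
  have mR: "\<mm> \<subseteq> carrier R" using I.max_carr by blast
  obtain xs where "set xs \<subseteq> \<mm>" "regular_on R I xs" "D \<le> p + length xs"
    using I.ex_long_regular_seq[OF top least assms(3,4) V] by blast
  then have "enat (D - p) \<le> depth R \<mm> (quot_by_ideal R (L 0))"
    unfolding L0 I.depth_quot_ge_iff[OF assms(3,4) mR] by (intro exI[of _ xs]) simp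
  then have depth: "enat (D - p) \<le> depth R \<mm> (quot_by_ideal R (L t))" for t
    by (induction t) (auto intro: order_trans simp: assms(7) L_def)
  have VL: "I.ext_vanishes j (L t)" if j: "j > p" for j t
  proof -
    obtain ys where "set ys \<subseteq> \<mm>" "regular_on R (L t) ys" "D - p \<le> length ys"
      using depth[of t] unfolding I.depth_quot_ge_iff[OF L Lp mR] by blast
    then show ?thesis using I.ext_vanishes_of_regular_seq[OF top L] j by simp
  qed

  have tors: "{x \<in> carrier (E j). \<exists>t. \<forall>a\<in>ideal_power R I t. a \<odot>\<^bsub>E j\<^esub> x = \<zero>\<^bsub>E j\<^esub>} = I.tors L j" for j
  proof -
    have cof: "\<exists>s. L s \<subseteq> ideal_power R I t" "\<exists>s. ideal_power R I s \<subseteq> L t" for t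
      using assms(6) unfolding cofinal_families_def L_def by blast+
    have "(\<exists>t. x \<in> I.ann j (ideal_power R I t)) \<longleftrightarrow> (\<exists>t. x \<in> I.ann j (L t))" for x
      using cof I.ann_antimono by (meson subsetD)
    moreover have "{x \<in> carrier (E j). \<exists>t. \<forall>a\<in>ideal_power R I t. a \<odot>\<^bsub>E j\<^esub> x = \<zero>\<^bsub>E j\<^esub>}
        = {x. \<exists>t. x \<in> I.ann j (ideal_power R I t)}"
      by (auto simp: I.ann_def)
    ultimately show ?thesis by (auto simp: I.tors_def)
  qed
  have lc: "local_cohomology R I j (self_module R) = cohomology (\<lambda>j. (E j)\<lparr>carrier := I.tors L j\<rparr>) \<delta> j" for j
  proof -
    have "torsion_part R I (E j) = (E j)\<lparr>carrier := I.tors L j\<rparr>" for j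
      using tors[of j] by (simp add: torsion_part_def)
    then show ?thesis by (simp add: local_cohomology_def E_def \<delta>_def)
  qed
  have "\<forall>j>p. zero_module (local_cohomology R I j (self_module R))"
    unfolding lc using I.zero_tors_cohomology[of L, OF L LS VL] by blast
  then have le: "coh_dim R I \<le> enat p" unfolding coh_dim_def by (intro Inf_lower) blast
  moreover have "coh_dim R I = enat p"
    if inj: "\<forall>i t. inj_on
        (Ext_map R i (quot_by_ideal R (L (Suc t))) (natural_surj R (L t)) (self_module R))
        (carrier (Ext R i (quot_by_ideal R (L t)) (self_module R)))"
  proof -
    have "coh_dim R I < \<infinity>" using le by (rule le_less_trans) simp
    then obtain c where c: "coh_dim R I = enat c"
      "\<forall>j>c. zero_module (local_cohomology R I j (self_module R))"
      by (rule Inf_enat_attained[of "\<lambda>i. \<forall>j>i. zero_module (local_cohomology R I j (self_module R))",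
          folded coh_dim_def])
    have descend: "x \<in> I.cobounds j (L t)"
      if x: "x \<in> I.cocycles j (L t)" "x \<in> I.cobounds j (L (Suc t))" for j t x
    proof (rule I.cobounds_of_Ext_map_inj[OF L L LS _ x])
      have "hom_complex R (quot_by_ideal R (L s)) (self_module R) = (\<lambda>i. I.quot_hom i (L s))"
        "hom_diff R (quot_by_ideal R (L s)) (self_module R) = I.quot_hom_diff (L s)" for s
        by (auto simp: hom_complex_def hom_diff_def E_def \<delta>_def fun_eq_iff)
      then show "inj_on (cohomology_map (\<lambda>i. I.quot_hom i (L (Suc t))) (I.quot_hom_diff (L (Suc t)))
          (\<lambda>_ f. compose (carrier (quot_by_ideal R (L (Suc t)))) f (natural_surj R (L t))) j)
          (carrier (cohomology (\<lambda>i. I.quot_hom i (L t)) (I.quot_hom_diff (L t)) j))"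
        using inj unfolding Ext_map_def Ext_def by simp
    qed
    have "I.ext_vanishes j I" if j: "j > c" for j
      using I.ext_vanishes_of_zero_tors_cohomology[of L j, OF L LS _ descend] c(2) j L0 unfolding lc by simp
    then have dual: "X.dual_exact k" if "k \<ge> c" for k
      using X.dual_exact_iff_ext_vanishes that by simp
    have "X.splits c"
    proof (cases "c \<le> p")
      case True
      have "X.splits p" by (rule splits) simp
      with True show ?thesis
        by (induction rule: inc_induct) (auto intro: X.dual_exact_imp_splits dual)
    qed (use splits in simp)
    then obtain \<epsilon>' and P' :: "nat \<Rightarrow> ('a, ('a, 'a set) univ) module" and d' where
      "projective_resolution R (quot_by_ideal R I) \<epsilon>' P' d'" "\<forall>i>c. zero_module (P' i)"
      using X.projective_resolution_of_splits by blast
    then have "proj_dim R (quot_by_ideal R I) \<le> enat c"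
      unfolding proj_dim_def by (intro Inf_lower) blast
    then show ?thesis using le c(1) p by simp
  qed
  ultimately show ?thesis unfolding p L_def by blast
qed

end
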